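(* Let $\alpha\in\mathbb{N}_0$ and $\beta>\frac12$. Let $\mathrm{K}_\alpha|_{D_r}$ be the integral operator on $L^2(D_r,\mu)$, $\mathrm{d}\mu=\frac1\pi e^{-|z|^2}\mathrm{d}m$, with kernel $K_\alpha(z,w)=L_\alpha(|z-w|^2)e^{z\bar w}$. Then, as $r\to\infty$, \[ S_\alpha^\beta(D_r):=\operatorname{Tr}\bigl[f_\beta(\mathrm{K}_\alpha|_{D_r})\bigr]=r\int_{\mathbb{R}}f_\beta(\Phi_\alpha(x))\,\mathrm{d}x+o(1), \] where $f_\beta(x)=\frac{\log(x^\beta+(1-x)^\beta)}{1-\beta}$ for $\beta\ne1$ and $f_1(x)=-x\log x-(1-x)\log(1-x)$, $x\in[0,1]$.
   Context: $D_r=\{|z|<r\}$; $L_\alpha(x)=\sum_{\ell=0}^\alpha\binom{\alpha}{\ell}\frac{(-x)^\ell}{\ell!}$. $H_\alpha$ is the degree-$\alpha$ Hermite polynomial orthonormal with respect to $e^{-x^2/2}/\sqrt{2\pi}$, $h_\alpha(x)^2=H_\alpha(x)^2e^{-x^2/2}/\sqrt{2\pi}$, and $\Phi_\alpha(x)=\int_x^\infty h_\alpha(t)^2\mathrm{d}t$. $f_\beta$ of the operator is defined by functional calculus (the operator is self-adjoint with spectrum in $[0,1]$). *)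

theory Defs
  imports "HOL-Analysis.Analysis"
begin

definition Lag :: "nat \<Rightarrow> real \<Rightarrow> real" where
  "Lag a x = (\<Sum>l=0..a. real (a choose l) * (-x)^l / fact l)"

definition Kker :: "nat \<Rightarrow> complex \<Rightarrow> complex \<Rightarrow> complex" where
  "Kker a z w = of_real (Lag a ((cmod (z - w))^2)) * exp (z * cnj w)"

definition gdens :: "complex \<Rightarrow> real" where
  "gdens w = exp (-((cmod w)^2)) / pi"

definition L2disc :: "real \<Rightarrow> (complex \<Rightarrow> complex) \<Rightarrow> bool" where
  "L2disc r g \<longleftrightarrow> g \<in> borel_measurable lborel \<and>
     set_integrable lborel (ball 0 r) (\<lambda>w. gdens w * (cmod (g w))^2)"

definition ipD :: "real \<Rightarrow> (complex \<Rightarrow> complex) \<Rightarrow> (complex \<Rightarrow> complex) \<Rightarrow> complex" where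
  "ipD r g h = set_lebesgue_integral lborel (ball 0 r) (\<lambda>w. of_real (gdens w) * g w * cnj (h w))"

definition Kop :: "nat \<Rightarrow> real \<Rightarrow> (complex \<Rightarrow> complex) \<Rightarrow> complex \<Rightarrow> complex" where
  "Kop a r g z = set_lebesgue_integral lborel (ball 0 r) (\<lambda>w. of_real (gdens w) * Kker a z w * g w)"

definition is_eigfun :: "nat \<Rightarrow> real \<Rightarrow> real \<Rightarrow> (complex \<Rightarrow> complex) \<Rightarrow> bool" where
  "is_eigfun a r l g \<longleftrightarrow> L2disc r g \<and>
     (AE z in lborel. z \<in> ball 0 r \<longrightarrow> Kop a r g z = of_real l * g z)"

text \<open>Multiplicity of l: dimension of the eigenspace = maximal size of an orthonormal
  family of eigenvectors (finite for l \<noteq> 0, as the operator is compact).\<close>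
definition eig_mult :: "nat \<Rightarrow> real \<Rightarrow> real \<Rightarrow> nat" where
  "eig_mult a r l = Sup {n. \<exists>gs :: nat \<Rightarrow> complex \<Rightarrow> complex.
      (\<forall>i<n. is_eigfun a r l (gs i)) \<and>
      (\<forall>i<n. \<forall>j<n. ipD r (gs i) (gs j) = (if i = j then 1 else 0))}"

definition fbeta :: "real \<Rightarrow> real \<Rightarrow> real" where
  "fbeta b x = (if b = 1 then - x * ln x - (1 - x) * ln (1 - x)
                else ln (x powr b + (1 - x) powr b) / (1 - b))"

text \<open>Tr f_beta(K_alpha|D_r) = sum over nonzero eigenvalues (with multiplicity) of f_beta
  (f_beta(0)=0, so the kernel does not contribute).\<close>
definition Sab :: "nat \<Rightarrow> real \<Rightarrow> real \<Rightarrow> real" where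
  "Sab a b r = infsum (\<lambda>l. real (eig_mult a r l) * fbeta b l) (UNIV - {0})"

fun He :: "nat \<Rightarrow> real \<Rightarrow> real" where
  "He 0 x = 1"
| "He (Suc 0) x = x"
| "He (Suc (Suc n)) x = x * He (Suc n) x - real (Suc n) * He n x"

text \<open>Orthonormal Hermite polynomial w.r.t. e^{-x^2/2}/sqrt(2 pi)\<close>
definition Herm :: "nat \<Rightarrow> real \<Rightarrow> real" where
  "Herm a x = He a x / sqrt (fact a)"

definition hsq :: "nat \<Rightarrow> real \<Rightarrow> real" where
  "hsq a x = (Herm a x)^2 * exp (-(x^2) / 2) / sqrt (2 * pi)"

definition Phi :: "nat \<Rightarrow> real \<Rightarrow> real" where
  "Phi a x = set_lebesgue_integral lborel {x..} (hsq a)"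

end

theory Submission
  imports Defs "HOL-Probability.Distributions"
begin

text \<open>
  The kernel is \<open>\<Sum>k. \<phi> k z * cnj (\<phi> k w)\<close>, where \<open>\<phi> k\<close> are the normalised complex Hermite
  polynomials. By rotation invariance these stay orthogonal on every disc, so the nonzero
  eigenvalues are \<open>\<lambda> k r\<close>, the mass of \<open>\<phi> k\<close> in the disc, and the trace is \<open>\<Sum>k. f (\<lambda> k r)\<close>.

  For \<open>k = \<alpha> + a\<close>, \<open>\<kappa> = sqrt (a + 1/2)\<close> and \<open>|z| = \<kappa> - u / 2\<close>, the density of \<open>\<phi> k\<close> becomes a
  function of \<open>u\<close> and \<open>\<epsilon> = 1 / \<kappa>\<close> which at \<open>\<epsilon> = 0\<close> is the Hermite density and is invariant under
  \<open>(u, \<epsilon>) \<mapsto> (-u, -\<epsilon>)\<close>. Hence \<open>\<lambda> k r = \<Phi> x + c x / \<kappa> + o (1 / \<kappa>)\<close> at \<open>x = 2 * (\<kappa> - r)\<close> with an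
  \<^emph>\<open>even\<close> function \<open>c\<close>. The sum over \<open>a\<close> is a midpoint sum of spacing about \<open>1 / r\<close>, so the
  first-order correction to \<open>r * \<integral> f (\<Phi> x)\<close> is \<open>\<integral> f' (\<Phi> x) * c x\<close>, which vanishes because
  \<open>f (1 - x) = f x\<close> and \<open>\<Phi> (-x) = 1 - \<Phi> x\<close> make \<open>f' (\<Phi> x)\<close> odd. Dominated convergence needs
  \<open>|\<lambda> - \<Phi>| \<le> C * exp (-(1/4 - \<eta>) * x^2) / \<kappa>\<close> to beat the singularity of \<open>f'\<close>, which is of order
  \<open>\<Phi> powr (-\<gamma>)\<close> with \<open>\<gamma> < 1/2\<close> exactly when \<open>\<beta> > 1/2\<close>.
\<close>

section \<open>Complex Hermite polynomials and the kernel\<close>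

text \<open>The difficulty is one of size. About r eigenvalues lie in the window where x stays
  bounded, so an error of order 1 / r in each term, the natural accuracy of replacing
  \<open>lam\<close> by \<open>Phi\<close>, already moves the trace by a bounded amount. An o(1)
  remainder needs the first-order term exactly, and its cancellation has to come from symmetry, not
  from estimates. Two more contributions of order one disappear similarly: the displacement from
  cell midpoints is removed by averaging over mirror points, and the Jacobian r + u / 2 of the
  substitution v = (r + u / 2)^2 leaves only its r, because u / 2 integrates to 0 against the even
  function \<open>fbeta b (Phi n u)\<close>. The rate 1/4 is half of the rate 1/2 of the limit
  density: uniformly in \<epsilon>, the inequality ln (1 - v) <= - v bounds the weight by exp (- u^2
  / 4), having lost the quadratic term. As \<open>Phi\<close> decays no faster than about exp (- x^2
  / 2), a singularity of order \<gamma> costs about exp (\<gamma> * x^2 / 2), and \<gamma> / 2 < 1/4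
  becomes the condition on \<beta>.\<close>

fun cherm :: "nat \<Rightarrow> nat \<Rightarrow> complex \<Rightarrow> complex" where
  "cherm 0 q z = z ^ q"
| "cherm (Suc p) q z = cnj z * cherm p q z - of_nat q * cherm p (q - 1) z"

text \<open>The definition raises the first index by \<open>cnj z\<close> minus the derivative in z,
  which is \<open>q * cherm p (q - 1)\<close>. Here the second index is raised by the conjugate
  rule; having both gives \<open>cherm_swap\<close>. The truncated index 0 - 1 always carries the
  factor 0.\<close>

lemma cherm_Suc_right:
  "cherm p (Suc q) z = z * cherm p q z - of_nat p * cherm (p - 1) q z"
proof (induction p arbitrary: q)
  case 0
  show ?case by simp
next
  case (Suc p)
  have 1: "of_nat p * (cnj z * cherm (p - 1) q z) =
      of_nat p * cherm p q z + of_nat p * of_nat q * cherm (p - 1) (q - 1) z"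
    by (cases p) (auto simp: algebra_simps)
  have 2: "of_nat q * (z * cherm p (q - 1) z) =
      of_nat q * cherm p q z + of_nat q * of_nat p * cherm (p - 1) (q - 1) z"
  proof (cases q)
    case (Suc n)
    then have "z * cherm p (q - 1) z = cherm p q z + of_nat p * cherm (p - 1) (q - 1) z"
      using Suc.IH[of n] by simp
    then show ?thesis by (simp only: distrib_left mult.assoc)
  qed simp
  have "cherm (Suc p) (Suc q) z = cnj z * (z * cherm p q z - of_nat p * cherm (p - 1) q z)
      - of_nat (Suc q) * cherm p q z"
    using Suc[of q] by simp
  also have "\<dots> = cnj z * z * cherm p q z - of_nat p * (cnj z * cherm (p - 1) q z) - of_nat (Suc q) * cherm p q z"
    by (simp add: algebra_simps)
  also have "\<dots> = z * cnj z * cherm p q z - of_nat q * (z * cherm p (q - 1) z) - of_nat (Suc p) * cherm p q z"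
    unfolding 1 2 by (simp add: algebra_simps)
  also have "\<dots> = z * cherm (Suc p) q z - of_nat (Suc p) * cherm (Suc p - 1) q z"
    by (simp add: algebra_simps)
  finally show ?case .
qed

lemma cherm_0_right: "cherm p 0 z = cnj z ^ p"
  by (induction p) auto

lemma cherm_swap: "cherm p q z = cnj (cherm q p z)"
proof (induction p arbitrary: q)
  case 0
  show ?case by (simp add: cherm_0_right)
next
  case (Suc p)
  have "cherm (Suc p) q z = cnj z * cnj (cherm q p z) - of_nat q * cnj (cherm (q - 1) p z)"
    by (simp add: Suc[symmetric])
  then show ?case by (simp add: cherm_Suc_right)
qed

text \<open>The polynomial factor of the sum over k of
  \<open>cherm a k z * cnj (cherm b k w) / fact k\<close>. Unequal a and b must be allowed because
  the recursion in a refers to b - 1.\<close>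

definition sherm :: "nat \<Rightarrow> nat \<Rightarrow> complex \<Rightarrow> complex \<Rightarrow> complex" where
  "sherm a b u v = (\<Sum>j\<le>a. fact j * of_nat (a choose j) * of_nat (b choose j) * u ^ (a - j) * v ^ (b - j))"

lemma sherm_Suc: "sherm (Suc a) b u v = u * sherm a b u v + of_nat b * sherm a (b - 1) u v"
proof -
  define t where "t j = fact j * of_nat (a choose j) * of_nat (b choose j) * u ^ (Suc a - j) * v ^ (b - j)" for j
  define s where "s j = of_nat b * (fact j * of_nat (a choose j) * of_nat ((b - 1) choose j) * u ^ (a - j) * v ^ (b - 1 - j))" for j
  have absorb: "of_nat (Suc j) * of_nat (b choose Suc j) = (of_nat b * of_nat ((b - 1) choose j) :: complex)" for j
    by (metis binomial_absorption of_nat_mult)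
  have step: "fact (Suc j) * of_nat (Suc a choose Suc j) * of_nat (b choose Suc j) * u ^ (Suc a - Suc j) * v ^ (b - Suc j)
      = s j + t (Suc j)" for j
  proof -
    have "fact (Suc j) * of_nat (a choose j) * of_nat (b choose Suc j) * u ^ (a - j) * v ^ (b - Suc j)
      = fact j * of_nat (a choose j) * (of_nat (Suc j) * of_nat (b choose Suc j)) * u ^ (a - j) * v ^ (b - Suc j)"
      by (simp add: algebra_simps)
    also have "\<dots> = s j"
      unfolding absorb s_def by (simp add: algebra_simps)
    finally show ?thesis
      by (simp add: t_def algebra_simps)
  qed
  have "sherm (Suc a) b u v = t 0 + (\<Sum>j\<le>a. s j + t (Suc j))"
    unfolding sherm_def sum.atMost_Suc_shift step by (simp add: t_def)
  also have "\<dots> = (\<Sum>j\<le>a. s j) + (\<Sum>j\<le>Suc a. t j)"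
    by (simp add: sum.distrib sum.atMost_Suc_shift del: sum.atMost_Suc)
  also have "(\<Sum>j\<le>Suc a. t j) = (\<Sum>j\<le>a. t j)"
    by (simp add: t_def)
  also have "\<dots> = u * sherm a b u v"
    unfolding sherm_def t_def sum_distrib_left by (rule sum.cong) (auto simp: Suc_diff_le algebra_simps)
  also have "(\<Sum>j\<le>a. s j) = of_nat b * sherm a (b - 1) u v"
    unfolding sherm_def s_def sum_distrib_left ..
  finally show ?thesis by simp
qed

text \<open>For equal indices each term is a power of u * v, and reversing the summation exposes the
  Laguerre coefficients through fact (a - l) * (a choose l) = fact a / fact l.\<close>

lemma sherm_diag:
  assumes "u * v = of_real (- x)"
  shows "sherm a a u v = fact a * of_real (Lag a x)"
proof -
  have "sherm a a u v = (\<Sum>j\<le>a. fact j * of_nat (a choose j) ^ 2 * of_real (- x) ^ (a - j))"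
    unfolding sherm_def using assms[symmetric]
    by (intro sum.cong) (auto simp: power_mult_distrib power2_eq_square)
  also have "\<dots> = (\<Sum>l\<le>a. fact (a - l) * of_nat (a choose l) ^ 2 * of_real (- x) ^ l)"
    by (rule sum.reindex_bij_witness[of _ "\<lambda>j. a - j" "\<lambda>j. a - j"]) (auto simp: binomial_symmetric[symmetric])
  also have "\<dots> = (\<Sum>l\<le>a. fact a * of_real (real (a choose l) * (-x)^l / fact l))"
  proof (rule sum.cong)
    fix l assume "l \<in> {..a}"
    then have "fact (a - l) * of_nat (a choose l) = (fact a / fact l :: complex)"
      by (simp add: binomial_fact)
    then have "fact (a - l) * of_nat (a choose l) ^ 2 = fact a * (of_nat (a choose l) / fact l :: complex)"
      by (simp add: power2_eq_square mult.assoc[symmetric])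
    then show "fact (a - l) * of_nat (a choose l) ^ 2 * of_real (- x) ^ l
        = (fact a * of_real (real (a choose l) * (-x)^l / fact l) :: complex)"
      by simp
  qed simp
  also have "\<dots> = fact a * of_real (Lag a x)"
    unfolding Lag_def by (simp add: sum_distrib_left atMost_atLeast0)
  finally show ?thesis .
qed

lemma sums_nat_times_pred:
  fixes f :: "nat \<Rightarrow> complex"
  assumes "(\<lambda>m. f (Suc m) / fact m) sums s"
  shows "(\<lambda>k. of_nat k * f k / fact k) sums s"
proof -
  have "of_nat (Suc m) * f (Suc m) / fact (Suc m) = f (Suc m) / fact m" for m
    by (simp add: field_simps del: of_nat_Suc)
  then have "(\<lambda>m. of_nat (Suc m) * f (Suc m) / fact (Suc m)) sums s"
    using assms by simp
  from sums_Suc[OF this] show ?thesis by simp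
qed

text \<open>The start is the exponential series. Each recursion produces a factor k, which k / k! =
  1 / (k - 1)! turns into a shift of the series; the factor whose k is shifted is then expanded by
  the recursion in its second index.\<close>

lemma cherm_kernel_sums:
  "(\<lambda>k. cherm a k z * cnj (cherm b k w) / fact k) sums (exp (z * cnj w) * sherm a b (cnj z - cnj w) (w - z))"
proof (induction a arbitrary: b)
  case 0
  have "(\<lambda>k. z ^ k * cnj (cherm b k w) / fact k) sums (exp (z * cnj w) * (w - z) ^ b)" for b
  proof (induction b)
    case 0
    have "(\<lambda>k. (z * cnj w) ^ k /\<^sub>R fact k) sums exp (z * cnj w)"
      by (rule exp_converges)
    then show ?case by (simp add: scaleR_conv_of_real field_simps power_mult_distrib)
  next
    case (Suc b)
    have "(\<lambda>m. z * (z ^ m * cnj (cherm b m w) / fact m)) sums (z * (exp (z * cnj w) * (w - z) ^ b))"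
      by (rule sums_mult[OF Suc])
    then have "(\<lambda>m. (z ^ Suc m * cnj (cherm b (Suc m - 1) w)) / fact m) sums (z * (exp (z * cnj w) * (w - z) ^ b))"
      by (simp add: mult.assoc)
    from sums_nat_times_pred[of "\<lambda>k. z ^ k * cnj (cherm b (k - 1) w)", OF this]
    have "(\<lambda>k. of_nat k * (z ^ k * cnj (cherm b (k - 1) w)) / fact k) sums (z * (exp (z * cnj w) * (w - z) ^ b))" .
    from sums_diff[OF sums_mult[OF Suc, of w] this] show ?case
      by (rule arg_cong2[of _ _ _ _ "(sums)", THEN iffD1, rotated 2]) (auto simp: fun_eq_iff algebra_simps diff_divide_distrib)
  qed
  then show ?case by (simp add: sherm_def)
next
  case (Suc a)
  have "(\<lambda>m. cnj w * (cherm a m z * cnj (cherm b m w) / fact m) - of_nat b * (cherm a m z * cnj (cherm (b - 1) m w) / fact m))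
     sums (cnj w * (exp (z * cnj w) * sherm a b (cnj z - cnj w) (w - z)) - of_nat b * (exp (z * cnj w) * sherm a (b - 1) (cnj z - cnj w) (w - z)))"
    (is "_ sums ?s")
    by (intro sums_diff sums_mult Suc)
  then have "(\<lambda>m. cherm a (Suc m - 1) z * cnj (cherm b (Suc m) w) / fact m) sums ?s"
    by (simp add: cherm_Suc_right algebra_simps diff_divide_distrib)
  from sums_nat_times_pred[of "\<lambda>k. cherm a (k - 1) z * cnj (cherm b k w)", OF this]
  have "(\<lambda>k. of_nat k * (cherm a (k - 1) z * cnj (cherm b k w)) / fact k) sums ?s" .
  from sums_diff[OF sums_mult[OF Suc[of b], of "cnj z"] this] show ?case
    by (rule arg_cong2[of _ _ _ _ "(sums)", THEN iffD1, rotated 2])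
       (auto simp: fun_eq_iff sherm_Suc algebra_simps diff_divide_distrib)
qed

definition phi :: "nat \<Rightarrow> nat \<Rightarrow> complex \<Rightarrow> complex" where
  "phi a k z = cherm a k z / of_real (sqrt (fact a * fact k))"

lemma Kker_sums: "(\<lambda>k. phi a k z * cnj (phi a k w)) sums Kker a z w"
proof -
  have "(cnj z - cnj w) * (w - z) = of_real (- ((cmod (z - w))\<^sup>2))"
    unfolding of_real_minus complex_norm_square by (simp add: algebra_simps)
  note d = sherm_diag[OF this]
  have sq: "complex_of_real (sqrt (fact a * fact k)) * of_real (sqrt (fact a * fact k)) = fact a * fact k" for k
    by (simp flip: of_real_mult) simp
  have "(\<lambda>k. (cherm a k z * cnj (cherm a k w) / fact k) / fact a) sums
     (exp (z * cnj w) * (fact a * of_real (Lag a ((cmod (z - w))\<^sup>2))) / fact a)"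
    unfolding d[of a, symmetric] by (intro sums_divide cherm_kernel_sums)
  then show ?thesis
    unfolding phi_def Kker_def complex_cnj_divide complex_cnj_complex_of_real times_divide_times_eq sq
    by (simp add: mult.commute)
qed

text \<open>Rotation covariance with angular momentum k - a. Powers of c stand on both sides because
  k - a may be negative.\<close>

lemma phi_rotate:
  assumes "cmod c = 1"
  shows "c ^ a * phi a k (c * z) = c ^ k * phi a k z"
proof -
  have c: "c * cnj c = 1"
    using assms by (simp add: complex_norm_square[symmetric])
  have "c ^ a * cherm a k (c * z) = c ^ k * cherm a k z" for k
  proof (induction a arbitrary: k)
    case 0
    show ?case by (simp add: power_mult_distrib)
  next
    case (Suc a)
    have "c ^ Suc a * cherm (Suc a) k (c * z) =
        (c * cnj c) * cnj z * (c ^ a * cherm a k (c * z)) - of_nat k * c * (c ^ a * cherm a (k - 1) (c * z))"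
      by (simp add: algebra_simps)
    also have "\<dots> = c ^ k * cnj z * cherm a k z - of_nat k * (c * c ^ (k - 1)) * cherm a (k - 1) z"
      unfolding Suc c by (simp add: algebra_simps)
    also have "of_nat k * (c * c ^ (k - 1)) = of_nat k * c ^ k"
      by (cases k) auto
    finally show ?case by (simp add: algebra_simps)
  qed
  then show ?thesis unfolding phi_def by (metis times_divide_eq_right)
qed

lemma continuous_phi: "continuous_on S (phi a k)"
proof -
  have "continuous_on S (cherm a k)" for k
    by (induction a arbitrary: k) (auto intro!: continuous_intros)
  then show ?thesis unfolding phi_def by (auto intro!: continuous_intros)
qed

lemma borel_measurable_phi[measurable]: "phi a k \<in> borel_measurable borel"
  by (intro borel_measurable_continuous_onI continuous_phi)

lemma phi_sq_sums: "(\<lambda>k. (cmod (phi a k z))\<^sup>2) sums exp ((cmod z)\<^sup>2)"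
proof -
  have "Lag a 0 = 1"
    by (simp add: Lag_def power_0_left if_distrib if_distribR sum.delta cong: if_cong)
  then have "Kker a z z = of_real (exp ((cmod z)\<^sup>2))"
    by (simp add: Kker_def flip: complex_norm_square exp_of_real)
  with Kker_sums[of a z z] show ?thesis
    by (simp flip: complex_norm_square of_real_power) (simp only: sums_of_real_iff flip: of_real_power)
qed

section \<open>Spectral decomposition on the disc\<close>

lemma borel_measurable_cnj[measurable (raw)]:
  "f \<in> borel_measurable M \<Longrightarrow> (\<lambda>x. cnj (f x)) \<in> borel_measurable M"
  by (rule borel_measurable_continuous_on[where f = cnj]) (intro continuous_intros)

lemma ball_in_borel[measurable]: "ball (c :: complex) r \<in> sets borel"
  by simp

lemma nn_integral_real_shift:
  fixes h :: "real \<Rightarrow> ennreal"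
  assumes "h \<in> borel_measurable borel"
  shows "(\<integral>\<^sup>+x. h (x + t) \<partial>lborel) = (\<integral>\<^sup>+x. h x \<partial>lborel)"
  using nn_integral_real_affine[OF assms, of 1 t] by (simp add: add.commute)

lemma lborel_complex_eq:
  "(lborel :: complex measure) = distr (lborel \<Otimes>\<^sub>M lborel) borel (\<lambda>(x, y). Complex x y)"
proof (rule lborel_eqI)
  fix l u :: complex
  assume *: "\<And>b. b \<in> Basis \<Longrightarrow> l \<bullet> b \<le> u \<bullet> b"
  have le: "Re l \<le> Re u" "Im l \<le> Im u"
    using *[of 1] *[of \<i>] by (auto simp: Basis_complex_def)
  have "(\<lambda>(x, y). Complex x y) -` box l u = {Re l<..<Re u} \<times> {Im l<..<Im u}"
    by (auto simp: box_def Basis_complex_def)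
  moreover have "box l u \<in> sets borel" by simp
  moreover have "(\<lambda>(x, y). Complex x y) \<in> borel_measurable (lborel \<Otimes>\<^sub>M lborel)"
    unfolding Complex_eq by measurable
  ultimately show "emeasure (distr (lborel \<Otimes>\<^sub>M lborel) borel (\<lambda>(x, y). Complex x y)) (box l u)
      = ennreal (\<Prod>b\<in>Basis. (u - l) \<bullet> b)"
    using le by (simp add: emeasure_distr space_pair_measure lborel.emeasure_pair_measure_Times Basis_complex_def
        complex_i_not_one[symmetric] ennreal_mult')
qed simp

text \<open>For a fixed value of the other coordinate a shear is a translation, so Tonelli reduces
  both claims to \<open>nn_integral_real_shift\<close>.\<close>

lemma nn_integral_complex_shear:
  fixes f :: "complex \<Rightarrow> ennreal"
  assumes [measurable]: "f \<in> borel_measurable borel"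
  shows "(\<integral>\<^sup>+z. f (z + of_real (s * Im z)) \<partial>lborel) = (\<integral>\<^sup>+z. f z \<partial>lborel)" (is ?re)
    and "(\<integral>\<^sup>+z. f (z + \<i> * of_real (s * Re z)) \<partial>lborel) = (\<integral>\<^sup>+z. f z \<partial>lborel)" (is ?im)
proof -
  have [measurable]: "(\<lambda>(x, y). Complex x y) \<in> borel_measurable (lborel \<Otimes>\<^sub>M lborel)"
    unfolding Complex_eq by measurable
  have m[measurable]: "(\<lambda>p. Complex (g p) (h p)) \<in> borel_measurable M"
    if "g \<in> borel_measurable M" "h \<in> borel_measurable M" for g h and M :: "'z measure"
    using that unfolding Complex_eq by measurable
  have eq: "(\<integral>\<^sup>+z. h z \<partial>lborel) = (\<integral>\<^sup>+p. h (Complex (fst p) (snd p)) \<partial>(lborel \<Otimes>\<^sub>M lborel))"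
    if [measurable]: "h \<in> borel_measurable borel" for h :: "complex \<Rightarrow> ennreal"
    by (subst lborel_complex_eq) (simp add: nn_integral_distr case_prod_beta)
  have "(\<integral>\<^sup>+z. f (z + of_real (s * Im z)) \<partial>lborel) =
      (\<integral>\<^sup>+p. f (Complex (fst p + s * snd p) (snd p)) \<partial>(lborel \<Otimes>\<^sub>M lborel))"
    by (subst eq) (auto simp: complex_eq_iff intro!: nn_integral_cong arg_cong[where f = f])
  also have "\<dots> = (\<integral>\<^sup>+y. (\<integral>\<^sup>+x. f (Complex (x + s * y) y) \<partial>lborel) \<partial>lborel)"
    by (subst lborel_pair.nn_integral_snd[symmetric]) auto
  also have "\<dots> = (\<integral>\<^sup>+y. (\<integral>\<^sup>+x. f (Complex x y) \<partial>lborel) \<partial>lborel)"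
    by (intro nn_integral_cong nn_integral_real_shift) auto
  also have "\<dots> = (\<integral>\<^sup>+p. f (Complex (fst p) (snd p)) \<partial>(lborel \<Otimes>\<^sub>M lborel))"
    by (subst lborel_pair.nn_integral_snd[symmetric]) auto
  finally show ?re by (simp add: eq)
  have "(\<integral>\<^sup>+z. f (z + \<i> * of_real (s * Re z)) \<partial>lborel) =
      (\<integral>\<^sup>+p. f (Complex (fst p) (snd p + s * fst p)) \<partial>(lborel \<Otimes>\<^sub>M lborel))"
    by (subst eq) (auto simp: complex_eq_iff intro!: nn_integral_cong arg_cong[where f = f])
  also have "\<dots> = (\<integral>\<^sup>+x. (\<integral>\<^sup>+y. f (Complex x (y + s * x)) \<partial>lborel) \<partial>lborel)"
    by (subst lborel.nn_integral_fst[symmetric]) auto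
  also have "\<dots> = (\<integral>\<^sup>+x. (\<integral>\<^sup>+y. f (Complex x y) \<partial>lborel) \<partial>lborel)"
    by (intro nn_integral_cong nn_integral_real_shift) auto
  also have "\<dots> = (\<integral>\<^sup>+p. f (Complex (fst p) (snd p)) \<partial>(lborel \<Otimes>\<^sub>M lborel))"
    by (subst lborel.nn_integral_fst[symmetric]) auto
  finally show ?im by (simp add: eq)
qed

text \<open>A rotation by an angle other than \<open>\<pi>\<close> is a product of three shears.\<close>

lemma lborel_distr_rotation:
  assumes "cmod c = 1" "Re c \<noteq> - 1"
  shows "distr lborel borel (\<lambda>z. c * z) = lborel"
proof (rule measure_eqI)
  fix A assume "A \<in> sets (distr lborel borel (\<lambda>z. c * z))"
  then have [measurable]: "A \<in> sets borel" by simp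
  \<comment> \<open>Minus the tangent of half the angle of c; it is undefined exactly at the angle
    pi.\<close>
  define t where "t = - (Im c / (1 + Re c))"
  have c: "(Re c)\<^sup>2 + (Im c)\<^sup>2 = 1"
    using assms(1) by (simp add: cmod_def)
  have ts: "t * Im c = Re c - 1" and tt: "t * (1 + Re c) = - Im c"
  proof -
    have n: "1 + Re c \<noteq> 0" using assms(2) by linarith
    have "(Im c)\<^sup>2 = (1 - Re c) * (1 + Re c)" using c by (simp add: power2_eq_square algebra_simps)
    then show "t * Im c = Re c - 1" "t * (1 + Re c) = - Im c"
      using n by (simp_all add: t_def field_simps power2_eq_square)
  qed
  define S1 where "S1 z = z + complex_of_real (t * Im z)" for z
  define S2 where "S2 z = z + \<i> * complex_of_real (Im c * Re z)" for z
  have rot: "S1 (S2 (S1 z)) = c * z" for z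
  proof (rule complex_eqI)
    have "Re (S1 (S2 (S1 z))) = Re z * (1 + t * Im c) + Im z * (t * (1 + (1 + t * Im c)))"
      by (simp add: S1_def S2_def algebra_simps)
    also have "\<dots> = Re (c * z)" unfolding ts using tt by simp
    finally show "Re (S1 (S2 (S1 z))) = Re (c * z)" .
    have "Im (S1 (S2 (S1 z))) = Im z * (1 + t * Im c) + Im c * Re z"
      by (simp add: S1_def S2_def algebra_simps)
    then show "Im (S1 (S2 (S1 z))) = Im (c * z)" unfolding ts by simp
  qed
  have [measurable]: "S1 \<in> borel_measurable borel" "S2 \<in> borel_measurable borel"
    unfolding S1_def S2_def by measurable
  have i1: "(\<integral>\<^sup>+z. f (S1 z) \<partial>lborel) = (\<integral>\<^sup>+z. f z \<partial>lborel)"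
   and i2: "(\<integral>\<^sup>+z. f (S2 z) \<partial>lborel) = (\<integral>\<^sup>+z. f z \<partial>lborel)"
    if "f \<in> borel_measurable borel" for f :: "complex \<Rightarrow> ennreal"
    unfolding S1_def S2_def using nn_integral_complex_shear[OF that] by auto
  have "(\<integral>\<^sup>+z. indicator A (c * z) \<partial>lborel) = (\<integral>\<^sup>+z. indicator A (S1 (S2 (S1 z))) \<partial>lborel)"
    by (simp add: rot)
  also have "\<dots> = (\<integral>\<^sup>+z. indicator A (S1 (S2 z)) \<partial>lborel)"
    by (rule i1[where f = "\<lambda>z. indicator A (S1 (S2 z))"]) measurable
  also have "\<dots> = (\<integral>\<^sup>+z. indicator A (S1 z) \<partial>lborel)"
    by (rule i2[where f = "\<lambda>z. indicator A (S1 z)"]) measurable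
  also have "\<dots> = (\<integral>\<^sup>+z. indicator A z \<partial>lborel)"
    by (rule i1) measurable
  finally have fin: "(\<integral>\<^sup>+z. indicator A (c * z) \<partial>lborel) = emeasure lborel A"
    by simp
  have "emeasure (distr lborel borel (\<lambda>z. c * z)) A = (\<integral>\<^sup>+z. indicator A z \<partial>(distr lborel borel (\<lambda>z. c * z)))"
    by (rule nn_integral_indicator[symmetric]) simp
  also have "\<dots> = (\<integral>\<^sup>+z. indicator A (c * z) \<partial>lborel)"
    by (rule nn_integral_distr) measurable
  finally show "emeasure (distr lborel borel (\<lambda>z. c * z)) A = emeasure lborel A"
    by (simp only: fin)
qed simp

lemma integral_sum_cmult:
  fixes F :: "'i \<Rightarrow> 'a \<Rightarrow> complex"
  assumes "\<And>k. integrable M (F k)"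
  shows "(\<integral>x. (\<Sum>k\<in>I. c k * F k x) \<partial>M) = (\<Sum>k\<in>I. c k * (\<integral>x. F k x \<partial>M))"
  using assms by (subst Bochner_Integration.integral_sum) auto

section \<open>The Gaussian weight and orthogonality on discs\<close>

lemma gdens_measurable[measurable]: "gdens \<in> borel_measurable borel"
  unfolding gdens_def by measurable

lemma gdens_nonneg: "gdens w \<ge> 0"
  by (simp add: gdens_def)

lemma gdens_le_one: "gdens w \<le> 1"
proof -
  have "exp (- (cmod w)\<^sup>2) \<le> 1" by simp
  also have "1 \<le> pi" using pi_gt3 by simp
  finally show ?thesis by (simp add: gdens_def)
qed

lemma L2disc_phi: "L2disc r (phi a k)"
proof -
  have "set_integrable lborel (cball 0 r) (\<lambda>w. gdens w * (cmod (phi a k w))\<^sup>2)"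
    unfolding gdens_def set_integrable_def
    by (intro borel_integrable_compact continuous_intros continuous_phi) auto
  then have "set_integrable lborel (ball 0 r) (\<lambda>w. gdens w * (cmod (phi a k w))\<^sup>2)"
    by (rule set_integrable_subset) auto
  then show ?thesis by (simp add: L2disc_def)
qed

lemma ipD_phi_orthogonal:
  assumes "j \<noteq> k"
  shows "ipD r (phi a j) (phi a k) = 0"
proof -
  define d where "d = \<bar>real j - real k\<bar>"
  \<comment> \<open>With this angle the rotation multiplies the integrand by i or -i, hence by a
    number other than 1. The angle is at most pi / 2, so the excluded half turn is avoided.\<close>
  define th where "th = pi / (2 * d)"
  define c where "c = cis th"
  have d: "d \<ge> 1" using assms unfolding d_def by linarith
  have th: "0 < th" "th \<le> pi / 2" unfolding th_def using d by (simp_all add: field_simps)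
  have "cos th \<ge> 0" using th by (intro cos_ge_zero) auto
  then have Re: "Re c \<noteq> -1" by (simp add: c_def)
  have c1: "cmod c = 1" by (simp add: c_def)
  have "c ^ j * cnj c ^ k = cis ((real j - real k) * th)"
    unfolding c_def cis_cnj Complex.DeMoivre cis_mult by (simp add: algebra_simps)
  moreover have "(real j - real k) * th = pi / 2 \<or> (real j - real k) * th = - (pi / 2)"
    using d by (cases "j < k") (auto simp: th_def d_def field_simps)
  ultimately have "c ^ j * cnj c ^ k = cis (pi / 2) \<or> c ^ j * cnj c ^ k = cis (- (pi / 2))"
    by metis
  then have "Re (c ^ j * cnj c ^ k) = 0" by (metis cis.sel(1) cos_minus cos_pi_half)
  then have q: "c ^ j * cnj c ^ k \<noteq> 1" by (metis one_complex.sel(1) zero_neq_one)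
  have ca: "c ^ a * cnj c ^ a = 1"
    using c1 by (simp add: complex_norm_square[symmetric] flip: power_mult_distrib)
  define F where "F z = indicator (ball 0 r) z *\<^sub>R (of_real (gdens z) * phi a j z * cnj (phi a k z))" for z
  have [measurable]: "F \<in> borel_measurable borel"
    unfolding F_def by measurable
  have rot: "F (c * z) = c ^ j * cnj c ^ k * F z" for z
  proof -
    have "phi a j (c * z) * cnj (phi a k (c * z))
       = (c ^ a * cnj c ^ a) * (phi a j (c * z) * cnj (phi a k (c * z)))"
      by (simp add: ca)
    also have "\<dots> = (c ^ a * phi a j (c * z)) * cnj (c ^ a * phi a k (c * z))"
      by (simp add: algebra_simps)
    also have "\<dots> = c ^ j * cnj c ^ k * (phi a j z * cnj (phi a k z))"
      unfolding phi_rotate[OF c1] by (simp add: algebra_simps)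
    finally have "phi a j (c * z) * cnj (phi a k (c * z)) = c ^ j * cnj c ^ k * (phi a j z * cnj (phi a k z))" .
    moreover have "gdens (c * z) = gdens z" "indicator (ball 0 r) (c * z) = (indicator (ball 0 r) z :: real)"
      by (simp_all add: gdens_def norm_mult c1 indicator_def)
    ultimately show ?thesis by (simp add: F_def mult.assoc scaleR_conv_of_real) 
  qed
  have "integral\<^sup>L lborel F = integral\<^sup>L (distr lborel borel (\<lambda>z. c * z)) F"
    by (simp add: lborel_distr_rotation[OF c1 Re])
  also have "\<dots> = integral\<^sup>L lborel (\<lambda>z. F (c * z))"
    by (intro integral_distr) auto
  also have "\<dots> = c ^ j * cnj c ^ k * integral\<^sup>L lborel F"
    by (simp add: rot)
  finally have "integral\<^sup>L lborel F = 0"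
    using q by simp
  then show ?thesis by (simp add: ipD_def set_lebesgue_integral_def F_def[abs_def])
qed

definition lam :: "nat \<Rightarrow> nat \<Rightarrow> real \<Rightarrow> real" where
  "lam a k r = set_lebesgue_integral lborel (ball 0 r) (\<lambda>w. gdens w * (cmod (phi a k w))\<^sup>2)"

lemma lam_nonneg: "lam a k r \<ge> 0"
  unfolding lam_def set_lebesgue_integral_def
  by (intro integral_nonneg_AE) (simp add: gdens_nonneg)

lemma ipD_phi: "ipD r (phi a j) (phi a k) = (if j = k then of_real (lam a k r) else 0)"
proof (cases "j = k")
  case True
  have "of_real (gdens w) * phi a k w * cnj (phi a k w) = of_real (gdens w * (cmod (phi a k w))\<^sup>2)" for w
    by (simp add: mult.assoc flip: complex_norm_square)
  then show ?thesis using True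
    by (simp add: ipD_def lam_def set_integral_complex_of_real del: of_real_mult of_real_power)
next
  case False
  then show ?thesis by (simp add: ipD_phi_orthogonal)
qed

text \<open>Pointwise the squares of all \<open>phi a k\<close> add up to exp (|w|^2), which is
  bounded on the disc. This is the trace class property, and it forces the masses to tend to
  0.\<close>

lemma summable_lam: "summable (\<lambda>k. lam a k r)"
proof (rule summableI_nonneg_bounded)
  fix n
  have i: "integrable lborel (\<lambda>w. indicator (ball 0 r) w *\<^sub>R (gdens w * (cmod (phi a k w))\<^sup>2))" for k
    using L2disc_phi[of r a k] by (simp add: L2disc_def set_integrable_def)
  have j: "integrable lborel (\<lambda>w. indicator (ball (0::complex) r) w *\<^sub>R exp (r\<^sup>2))"
    by (intro integrable_scaleR_left integrable_real_indicator emeasure_bounded_finite) auto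
  have "(\<Sum>k<n. lam a k r) = (\<integral>w. (\<Sum>k<n. indicator (ball 0 r) w *\<^sub>R (gdens w * (cmod (phi a k w))\<^sup>2)) \<partial>lborel)"
    unfolding lam_def set_lebesgue_integral_def using i by (subst Bochner_Integration.integral_sum) auto
  also have "\<dots> \<le> (\<integral>w. indicator (ball (0::complex) r) w *\<^sub>R exp (r\<^sup>2) \<partial>lborel)"
  proof (rule Bochner_Integration.integral_mono)
    fix w :: complex
    have "(\<Sum>k<n. indicator (ball 0 r) w *\<^sub>R (gdens w * (cmod (phi a k w))\<^sup>2)) =
        indicator (ball 0 r) w * (gdens w * (\<Sum>k<n. (cmod (phi a k w))\<^sup>2))"
      by (simp add: sum_distrib_left)
    also have "\<dots> \<le> indicator (ball 0 r) w *\<^sub>R exp (r\<^sup>2)"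
    proof (cases "w \<in> ball 0 r")
      case True
      have "(\<Sum>k<n. (cmod (phi a k w))\<^sup>2) \<le> exp ((cmod w)\<^sup>2)"
        using phi_sq_sums[of a w] by (intro sum_le_suminf[THEN order_trans[OF _ eq_refl]]) (auto simp: sums_iff)
      moreover have "exp ((cmod w)\<^sup>2) \<le> exp (r\<^sup>2)"
        using True by (auto intro!: power_mono)
      moreover have "gdens w * (\<Sum>k<n. (cmod (phi a k w))\<^sup>2) \<le> 1 * (\<Sum>k<n. (cmod (phi a k w))\<^sup>2)"
        by (intro mult_right_mono gdens_le_one sum_nonneg) auto
      ultimately have "gdens w * (\<Sum>k<n. (cmod (phi a k w))\<^sup>2) \<le> exp (r\<^sup>2)" by linarith
      then show ?thesis using True by simp
    qed simp
    finally show "(\<Sum>k<n. indicator (ball 0 r) w *\<^sub>R (gdens w * (cmod (phi a k w))\<^sup>2))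
        \<le> indicator (ball 0 r) w *\<^sub>R exp (r\<^sup>2)" .
  next
    show "integrable lborel (\<lambda>w. \<Sum>k<n. indicator (ball 0 r) w *\<^sub>R (gdens w * (cmod (phi a k w))\<^sup>2))"
      by (intro Bochner_Integration.integrable_sum i)
  qed (rule j)
  finally show "(\<Sum>k<n. lam a k r) \<le> (\<integral>w. indicator (ball (0::complex) r) w *\<^sub>R exp (r\<^sup>2) \<partial>lborel)" .
qed (rule lam_nonneg)

lemma finite_lam_fiber:
  assumes "l \<noteq> 0"
  shows "finite {k. lam a k r = l}"
proof -
  have "(\<lambda>k. lam a k r) \<longlonglongrightarrow> 0"
    by (rule summable_LIMSEQ_zero[OF summable_lam])
  then have "\<forall>\<^sub>F k in sequentially. lam a k r \<in> - {l}"
    using assms by (intro topological_tendstoD) auto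
  then obtain N where "\<And>k. k \<ge> N \<Longrightarrow> lam a k r \<noteq> l"
    by (auto simp: eventually_sequentially)
  then have "{k. lam a k r = l} \<subseteq> {..<N}"
    by (metis (mono_tags, lifting) lessThan_iff mem_Collect_eq not_le subsetI)
  then show ?thesis by (rule finite_subset) simp
qed

section \<open>Eigenfunctions of the integral operator\<close>

lemma L2disc_integrable:
  assumes "L2disc r g" "L2disc r h"
  shows "set_integrable lborel (ball 0 r) (\<lambda>w. of_real (gdens w) * g w * cnj (h w))"
proof -
  have [measurable]: "g \<in> borel_measurable borel" "h \<in> borel_measurable borel"
    using assms by (auto simp: L2disc_def)
  have "set_integrable lborel (ball 0 r) (\<lambda>w. gdens w * (cmod (g w))\<^sup>2 + gdens w * (cmod (h w))\<^sup>2)"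
    using assms by (auto simp: L2disc_def intro!: set_integral_add)
  then have i: "integrable lborel (\<lambda>w. indicator (ball 0 r) w *\<^sub>R (gdens w * (cmod (g w))\<^sup>2 + gdens w * (cmod (h w))\<^sup>2))"
    by (simp add: set_integrable_def)
  show ?thesis unfolding set_integrable_def
  proof (rule Bochner_Integration.integrable_bound[OF i])
    have "norm (of_real (gdens w) * g w * cnj (h w)) \<le> gdens w * (cmod (g w))\<^sup>2 + gdens w * (cmod (h w))\<^sup>2" for w
    proof -
      have "2 * (cmod (g w) * cmod (h w)) \<le> (cmod (g w))\<^sup>2 + (cmod (h w))\<^sup>2"
        using sum_squares_bound[of "cmod (g w)" "cmod (h w)"] by simp
      moreover have "0 \<le> cmod (g w) * cmod (h w)" by simp
      ultimately have "cmod (g w) * cmod (h w) \<le> (cmod (g w))\<^sup>2 + (cmod (h w))\<^sup>2" by linarith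
      from mult_left_mono[OF this gdens_nonneg[of w]] show ?thesis
        by (simp add: norm_mult gdens_nonneg distrib_left mult.assoc)
    qed
    then show "AE w in lborel. norm (indicator (ball 0 r) w *\<^sub>R (of_real (gdens w) * g w * cnj (h w)))
       \<le> norm (indicator (ball 0 r) w *\<^sub>R (gdens w * (cmod (g w))\<^sup>2 + gdens w * (cmod (h w))\<^sup>2))"
      by (intro always_eventually allI) (auto simp: indicator_def gdens_nonneg intro: order_trans[OF _ abs_ge_self])
  qed measurable
qed

lemma L2disc_const: "L2disc r (\<lambda>_. c)"
proof -
  have "set_integrable lborel (cball 0 r) (\<lambda>w. gdens w * (cmod c)\<^sup>2)"
    unfolding gdens_def set_integrable_def by (intro borel_integrable_compact continuous_intros) auto
  then have "set_integrable lborel (ball 0 r) (\<lambda>w. gdens w * (cmod c)\<^sup>2)"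
    by (rule set_integrable_subset) auto
  then show ?thesis by (simp add: L2disc_def)
qed

lemma L2disc_integrable_1:
  assumes "L2disc r g"
  shows "set_integrable lborel (ball 0 r) (\<lambda>w. of_real (gdens w) * g w)"
  using L2disc_integrable[OF assms L2disc_const[of r 1]] by simp

text \<open>The bound does not depend on n, so it dominates the partial sums of the kernel when
  limit and integral are exchanged in \<open>Kop_sums\<close>.\<close>

lemma norm_phi_kernel_sum_le:
  "norm (\<Sum>k<n. phi a k z * cnj (phi a k w)) \<le> exp ((cmod z)\<^sup>2) + exp ((cmod w)\<^sup>2)"
proof -
  have "norm (\<Sum>k<n. phi a k z * cnj (phi a k w)) \<le> (\<Sum>k<n. (cmod (phi a k z))\<^sup>2 + (cmod (phi a k w))\<^sup>2)"
  proof (rule order_trans[OF norm_sum], rule sum_mono)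
    fix k
    have "2 * (cmod (phi a k z) * cmod (phi a k w)) \<le> (cmod (phi a k z))\<^sup>2 + (cmod (phi a k w))\<^sup>2"
      using sum_squares_bound[of "cmod (phi a k z)" "cmod (phi a k w)"] by simp
    moreover have "0 \<le> cmod (phi a k z) * cmod (phi a k w)" by simp
    ultimately have "cmod (phi a k z) * cmod (phi a k w) \<le> (cmod (phi a k z))\<^sup>2 + (cmod (phi a k w))\<^sup>2"
      by linarith
    then show "norm (phi a k z * cnj (phi a k w)) \<le> (cmod (phi a k z))\<^sup>2 + (cmod (phi a k w))\<^sup>2"
      by (simp add: norm_mult)
  qed
  also have "\<dots> = (\<Sum>k<n. (cmod (phi a k z))\<^sup>2) + (\<Sum>k<n. (cmod (phi a k w))\<^sup>2)"
    by (rule sum.distrib)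
  also have "\<dots> \<le> exp ((cmod z)\<^sup>2) + exp ((cmod w)\<^sup>2)"
    using phi_sq_sums[of a z] phi_sq_sums[of a w]
    by (intro add_mono sum_le_suminf[THEN order_trans[OF _ eq_refl]]) (auto simp: sums_iff)
  finally show ?thesis .
qed

text \<open>The series comes from integrating the kernel expansion termwise. The uniform bound on
  its partial sums is what allows a second termwise integration, against \<open>phi a j\<close>, in
  \<open>eigfun_coeff\<close>.\<close>

lemma Kop_sums:
  assumes g: "L2disc r g"
  shows "(\<lambda>k. ipD r g (phi a k) * phi a k z) sums Kop a r g z"
    and "\<exists>C. \<forall>n. \<forall>z\<in>ball 0 r. norm (\<Sum>k<n. ipD r g (phi a k) * phi a k z) \<le> C"
proof -
  have [measurable]: "g \<in> borel_measurable borel"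
    using g by (auto simp: L2disc_def)
  define G where "G w = indicator (ball 0 r) w *\<^sub>R (of_real (gdens w) * g w)" for w
  have Gi: "integrable lborel G"
    using L2disc_integrable_1[OF g] by (simp add: set_integrable_def G_def[abs_def])
  have [measurable]: "G \<in> borel_measurable borel" unfolding G_def by measurable
  define s where "s n z w = (\<Sum>k<n. phi a k z * cnj (phi a k w)) * G w" for n z w
  have [measurable]: "s n z \<in> borel_measurable borel" for n z unfolding s_def by measurable
  have bound: "norm (s n z w) \<le> (exp ((cmod z)\<^sup>2) + exp (r\<^sup>2)) * norm (G w)" for n z w
  proof (cases "w \<in> ball 0 r")
    case True
    then have "exp ((cmod w)\<^sup>2) \<le> exp (r\<^sup>2)" by (auto intro!: power_mono)
    with norm_phi_kernel_sum_le[of a z w n]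
    have "norm (\<Sum>k<n. phi a k z * cnj (phi a k w)) \<le> exp ((cmod z)\<^sup>2) + exp (r\<^sup>2)"
      by linarith
    then show ?thesis
      by (auto simp: s_def norm_mult intro!: mult_right_mono)
  qed (simp add: s_def G_def)
  have dom: "integrable lborel (\<lambda>w. (exp ((cmod z)\<^sup>2) + exp (r\<^sup>2)) * norm (G w))" for z
    using Gi by auto
  have part: "(\<Sum>k<n. ipD r g (phi a k) * phi a k z) = (\<integral>w. s n z w \<partial>lborel)" for n z
  proof -
    have i: "integrable lborel (\<lambda>w. phi a k z * cnj (phi a k w) * G w)" for k
      using integrable_mult_right[OF L2disc_integrable[OF g L2disc_phi[of r a k], unfolded set_integrable_def], of "phi a k z"]
      by (simp add: G_def algebra_simps)
    have "ipD r g (phi a k) * phi a k z = (\<integral>w. phi a k z * cnj (phi a k w) * G w \<partial>lborel)" for k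
    proof -
      have "(\<integral>w. phi a k z * cnj (phi a k w) * G w \<partial>lborel) =
        (\<integral>w. (indicator (ball 0 r) w *\<^sub>R (of_real (gdens w) * g w * cnj (phi a k w))) * phi a k z \<partial>lborel)"
        by (intro Bochner_Integration.integral_cong) (auto simp: G_def)
      then show ?thesis by (simp only: ipD_def set_lebesgue_integral_def integral_mult_left_zero)
    qed
    then show ?thesis
      unfolding s_def sum_distrib_right using i by (simp add: Bochner_Integration.integral_sum)
  qed
  have "(\<lambda>n. \<integral>w. s n z w \<partial>lborel) \<longlonglongrightarrow> (\<integral>w. Kker a z w * G w \<partial>lborel)"
  proof (rule integral_dominated_convergence[OF _ _ dom])
    have "(\<lambda>n. s n z w) \<longlonglongrightarrow> Kker a z w * G w" for w
      unfolding s_def using Kker_sums[of a z w] by (intro tendsto_mult) (auto simp: sums_def)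
    then show "AE w in lborel. (\<lambda>n. s n z w) \<longlonglongrightarrow> Kker a z w * G w" by simp
    then show "(\<lambda>w. Kker a z w * G w) \<in> borel_measurable lborel"
      unfolding Kker_def Lag_def by measurable
  qed (use bound in auto)
  also have "(\<integral>w. Kker a z w * G w \<partial>lborel) = Kop a r g z"
    unfolding Kop_def set_lebesgue_integral_def by (intro Bochner_Integration.integral_cong) (auto simp: G_def)
  finally show "(\<lambda>k. ipD r g (phi a k) * phi a k z) sums Kop a r g z"
    by (simp add: sums_def part)
  show "\<exists>C. \<forall>n. \<forall>z\<in>ball 0 r. norm (\<Sum>k<n. ipD r g (phi a k) * phi a k z) \<le> C"
  proof (intro exI allI ballI)
    fix n and z :: complex assume "z \<in> ball 0 r"
    then have e: "exp ((cmod z)\<^sup>2) \<le> exp (r\<^sup>2)" by (auto intro!: power_mono)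
    have "norm (\<Sum>k<n. ipD r g (phi a k) * phi a k z) \<le> (\<integral>w. (exp ((cmod z)\<^sup>2) + exp (r\<^sup>2)) * norm (G w) \<partial>lborel)"
      unfolding part by (intro integral_norm_bound[THEN order_trans] Bochner_Integration.integral_mono' dom bound) auto
    also have "\<dots> \<le> (\<integral>w. (exp (r\<^sup>2) + exp (r\<^sup>2)) * norm (G w) \<partial>lborel)"
      using e Gi by (intro Bochner_Integration.integral_mono) (auto intro!: mult_right_mono)
    finally show "norm (\<Sum>k<n. ipD r g (phi a k) * phi a k z) \<le> (\<integral>w. (exp (r\<^sup>2) + exp (r\<^sup>2)) * norm (G w) \<partial>lborel)" .
  qed
qed

lemma is_eigfun_phi: "is_eigfun a r (lam a k r) (phi a k)"
proof -
  have "Kop a r (phi a k) z = of_real (lam a k r) * phi a k z" for z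
  proof -
    have "(\<lambda>j. if j = k then of_real (lam a j r) * phi a j z else 0) sums (of_real (lam a k r) * phi a k z)"
      by (rule sums_single)
    moreover have "(\<lambda>j. ipD r (phi a k) (phi a j) * phi a j z) = (\<lambda>j. if j = k then of_real (lam a j r) * phi a j z else 0)"
      by (auto simp: fun_eq_iff ipD_phi)
    ultimately show ?thesis
      using Kop_sums(1)[OF L2disc_phi[of r a k], of a z] by (auto simp: sums_iff)
  qed
  then show ?thesis by (simp add: is_eigfun_def L2disc_phi)
qed

lemma ipD_cong_AE:
  assumes "AE z in lborel. z \<in> ball 0 r \<longrightarrow> g z = g' z" "L2disc r h"
    "g \<in> borel_measurable borel" "g' \<in> borel_measurable borel"
  shows "ipD r g h = ipD r g' h"
proof -
  have [measurable]: "g \<in> borel_measurable borel" "g' \<in> borel_measurable borel" "h \<in> borel_measurable borel"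
    using assms by (auto simp: L2disc_def)
  show ?thesis
    unfolding ipD_def set_lebesgue_integral_def
  proof (rule integral_cong_AE)
    show "AE x in lborel. indicat_real (ball 0 r) x *\<^sub>R (of_real (gdens x) * g x * cnj (h x)) =
        indicat_real (ball 0 r) x *\<^sub>R (of_real (gdens x) * g' x * cnj (h x))"
      using assms(1) by eventually_elim (auto simp: indicator_def)
  qed measurable
qed

text \<open>Pairing the eigenvalue equation with \<open>phi a j\<close> leaves one term of the
  series. In consequence the coefficient vanishes whenever \<open>lam a j r\<close> differs from
  l.\<close>

lemma eigfun_coeff:
  assumes e: "is_eigfun a r l g"
  shows "of_real l * ipD r g (phi a j) = of_real (lam a j r) * ipD r g (phi a j)"
proof -
  have g: "L2disc r g" using e by (simp add: is_eigfun_def)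
  have [measurable]: "g \<in> borel_measurable borel"
    using g by (auto simp: L2disc_def)
  obtain C where C: "\<And>n z. z \<in> ball 0 r \<Longrightarrow> norm (\<Sum>k<n. ipD r g (phi a k) * phi a k z) \<le> C"
    using Kop_sums(2)[OF g, of a] by blast
  define s where "s n z = indicator (ball 0 r) z *\<^sub>R (of_real (gdens z) * (\<Sum>k<n. ipD r g (phi a k) * phi a k z) * cnj (phi a j z))" for n z
  have [measurable]: "s n \<in> borel_measurable borel" for n unfolding s_def by measurable
  have i: "integrable lborel (\<lambda>z. indicator (ball 0 r) z *\<^sub>R (of_real (gdens z) * phi a k z * cnj (phi a j z)))" for k
    using L2disc_integrable[OF L2disc_phi L2disc_phi] by (simp add: set_integrable_def)
  have sint: "integral\<^sup>L lborel (s n) = (\<Sum>k<n. ipD r g (phi a k) * ipD r (phi a k) (phi a j))" for n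
  proof -
    have "s n = (\<lambda>z. (\<Sum>k<n. ipD r g (phi a k) * (indicator (ball 0 r) z *\<^sub>R (of_real (gdens z) * phi a k z * cnj (phi a j z)))))"
      by (auto simp: fun_eq_iff s_def sum_distrib_left sum_distrib_right scaleR_sum_right algebra_simps)
    then show ?thesis
      by (simp only: integral_sum_cmult[OF i] ipD_def[of r "phi a _"] set_lebesgue_integral_def)
  qed
  have "(\<lambda>n. integral\<^sup>L lborel (s n)) \<longlonglongrightarrow> (\<integral>z. indicator (ball 0 r) z *\<^sub>R (of_real (gdens z) * (of_real l * g z) * cnj (phi a j z)) \<partial>lborel)"
  proof (rule integral_dominated_convergence[where w = "\<lambda>z. \<bar>C\<bar> * norm (indicator (ball 0 r) z *\<^sub>R (of_real (gdens z) * phi a j z))"])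
    show "integrable lborel (\<lambda>z. \<bar>C\<bar> * norm (indicator (ball 0 r) z *\<^sub>R (of_real (gdens z) * phi a j z)))"
      using L2disc_integrable_1[OF L2disc_phi] unfolding set_integrable_def
      by (intro integrable_mult_right integrable_norm)
    have "AE z in lborel. z \<in> ball 0 r \<longrightarrow> Kop a r g z = of_real l * g z"
      using e by (simp add: is_eigfun_def)
    then show "AE z in lborel. (\<lambda>n. s n z) \<longlonglongrightarrow> indicator (ball 0 r) z *\<^sub>R (of_real (gdens z) * (of_real l * g z) * cnj (phi a j z))"
    proof eventually_elim
      case (elim z)
      show ?case
      proof (cases "z \<in> ball 0 r")
        case True
        with elim Kop_sums(1)[OF g, of a z] have "(\<lambda>n. \<Sum>k<n. ipD r g (phi a k) * phi a k z) \<longlonglongrightarrow> of_real l * g z"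
          by (simp add: sums_def)
        then show ?thesis unfolding s_def by (intro tendsto_intros)
      qed (simp add: s_def)
    qed
    show "AE z in lborel. norm (s n z) \<le> \<bar>C\<bar> * norm (indicator (ball 0 r) z *\<^sub>R (of_real (gdens z) * phi a j z))" for n
    proof (intro always_eventually allI)
      fix z
      show "norm (s n z) \<le> \<bar>C\<bar> * norm (indicator (ball 0 r) z *\<^sub>R (of_real (gdens z) * phi a j z))"
      proof (cases "z \<in> ball 0 r")
        case True
        have "norm (\<Sum>k<n. ipD r g (phi a k) * phi a k z) \<le> \<bar>C\<bar>"
          using C[OF True, of n] by linarith
        from mult_right_mono[OF this, of "cmod (of_real (gdens z) * phi a j z)"] show ?thesis
          using True by (simp add: s_def norm_mult mult_ac)
      qed (simp add: s_def)
    qed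
  qed measurable
  also have "(\<integral>z. indicator (ball 0 r) z *\<^sub>R (of_real (gdens z) * (of_real l * g z) * cnj (phi a j z)) \<partial>lborel)
     = (\<integral>z. of_real l * (indicator (ball 0 r) z *\<^sub>R (of_real (gdens z) * g z * cnj (phi a j z))) \<partial>lborel)"
    by (intro Bochner_Integration.integral_cong) (auto simp: algebra_simps)
  also have "\<dots> = of_real l * ipD r g (phi a j)"
    by (simp only: ipD_def set_lebesgue_integral_def integral_mult_right_zero)
  finally have lim: "(\<lambda>k. ipD r g (phi a k) * ipD r (phi a k) (phi a j)) sums (of_real l * ipD r g (phi a j))"
    unfolding sint by (simp add: sums_def)
  have "(\<lambda>k. if k = j then ipD r g (phi a k) * of_real (lam a k r) else 0) sums (ipD r g (phi a j) * of_real (lam a j r))"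
    by (rule sums_single)
  moreover have "(\<lambda>k. ipD r g (phi a k) * ipD r (phi a k) (phi a j)) = (\<lambda>k. if k = j then ipD r g (phi a k) * of_real (lam a k r) else 0)"
    by (auto simp: fun_eq_iff ipD_phi)
  ultimately show ?thesis using lim by (auto simp: sums_iff mult.commute)
qed

text \<open>For nonzero l an eigenfunction is \<open>Kop a r g\<close> divided by l, and values of
  \<open>Kop\<close> are already series in the \<open>phi a k\<close>; this takes the place of a
  completeness argument. The series is finite because a nonzero value of \<open>lam\<close> is taken
  finitely often.\<close>

lemma eigfun_expansion:
  assumes e: "is_eigfun a r l g" and l: "l \<noteq> 0"
  shows "AE z in lborel. z \<in> ball 0 r \<longrightarrow> g z = (\<Sum>k\<in>{k. lam a k r = l}. ipD r g (phi a k) * phi a k z) / of_real l"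
proof -
  have g: "L2disc r g" using e by (simp add: is_eigfun_def)
  have zero: "ipD r g (phi a k) = 0" if "lam a k r \<noteq> l" for k
    using eigfun_coeff[OF e, of k] that by auto
  have "Kop a r g z = (\<Sum>k\<in>{k. lam a k r = l}. ipD r g (phi a k) * phi a k z)" for z
  proof -
    have "(\<lambda>k. ipD r g (phi a k) * phi a k z) sums (\<Sum>k\<in>{k. lam a k r = l}. ipD r g (phi a k) * phi a k z)"
      using zero by (intro sums_finite finite_lam_fiber l) auto
    then show ?thesis using Kop_sums(1)[OF g, of a z] by (auto simp: sums_iff)
  qed
  moreover have "AE z in lborel. z \<in> ball 0 r \<longrightarrow> Kop a r g z = of_real l * g z"
    using e by (simp add: is_eigfun_def)
  ultimately show ?thesis using l by (auto elim!: eventually_mono simp: field_simps)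
qed

text \<open>Double counting: the squared entries sum to n by rows, while Bessel's inequality bounds
  the sum over each column by 1.\<close>

lemma card_ge_orthonormal_rows:
  fixes c :: "nat \<Rightarrow> 'k \<Rightarrow> complex"
  assumes S: "finite S"
    and ortho: "\<And>i j. i < n \<Longrightarrow> j < n \<Longrightarrow> (\<Sum>k\<in>S. c i k * cnj (c j k)) = (if i = j then 1 else 0)"
  shows "n \<le> card S"
proof -
  have col: "(\<Sum>i<n. (cmod (c i m))\<^sup>2) \<le> 1" if m: "m \<in> S" for m
  proof -
    \<comment> \<open>The projection of the m-th unit vector onto the span of the rows. Its squared
      norm and its m-th entry both equal t, whence t^2 <= t.\<close>
    define b where "b k = (\<Sum>i<n. cnj (c i m) * c i k)" for k
    define t where "t = (\<Sum>i<n. (cmod (c i m))\<^sup>2)"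
    have bm: "b m = of_real t"
      unfolding b_def t_def of_real_sum complex_norm_square by (simp add: mult.commute)
    have "(\<Sum>k\<in>S. b k * cnj (b k)) = (\<Sum>k\<in>S. \<Sum>i<n. \<Sum>j<n. cnj (c i m) * c j m * (c i k * cnj (c j k)))"
      unfolding b_def by (simp add: sum_product algebra_simps)
    also have "\<dots> = (\<Sum>i<n. \<Sum>j<n. cnj (c i m) * c j m * (\<Sum>k\<in>S. c i k * cnj (c j k)))"
      unfolding sum_distrib_left by (subst sum.swap, rule sum.cong[OF refl], rule sum.swap)
    also have "\<dots> = (\<Sum>i<n. \<Sum>j<n. if j = i then cnj (c i m) * c j m else 0)"
      by (intro sum.cong) (auto simp: ortho)
    also have "\<dots> = of_real t"
      unfolding t_def of_real_sum complex_norm_square by (simp add: sum.delta mult.commute)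
    finally have bb: "(\<Sum>k\<in>S. (cmod (b k))\<^sup>2) = t"
      by (simp only: complex_norm_square[symmetric] of_real_sum[symmetric] of_real_eq_iff)
    have "(cmod (b m))\<^sup>2 \<le> (\<Sum>k\<in>S. (cmod (b k))\<^sup>2)"
      by (rule member_le_sum) (use S m in auto)
    then have "t\<^sup>2 \<le> t" unfolding bb bm by simp
    then have "t \<le> 1" by (cases "t \<le> 0") (auto simp: power2_eq_square)
    then show ?thesis by (simp add: t_def)
  qed
  have "real n = (\<Sum>i<n. \<Sum>k\<in>S. (cmod (c i k))\<^sup>2)"
  proof -
    have "(\<Sum>k\<in>S. (cmod (c i k))\<^sup>2) = 1" if "i < n" for i
    proof -
      have "of_real (\<Sum>k\<in>S. (cmod (c i k))\<^sup>2) = (1 :: complex)"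
        unfolding of_real_sum complex_norm_square using ortho[OF that that] by simp
      then show ?thesis by (simp only: of_real_eq_1_iff)
    qed
    then show ?thesis by simp
  qed
  also have "\<dots> = (\<Sum>k\<in>S. \<Sum>i<n. (cmod (c i k))\<^sup>2)" by (rule sum.swap)
  also have "\<dots> \<le> (\<Sum>k\<in>S. 1)" by (intro sum_mono col)
  finally show ?thesis by simp
qed

section \<open>Multiplicities and the trace as a series\<close>

lemma ipD_cnj: "ipD r g h = cnj (ipD r h g)"
  unfolding ipD_def set_lebesgue_integral_def
  by (subst Bochner_Integration.integral_cnj[symmetric]) (auto intro!: Bochner_Integration.integral_cong)

lemma eig_mult_eq:
  assumes l: "l \<noteq> 0"
  shows "eig_mult a r l = card {k. lam a k r = l}"
  unfolding eig_mult_def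
proof (rule cSup_eq_maximum)
  define S where "S = {k. lam a k r = l}"
  have S: "finite S" unfolding S_def by (rule finite_lam_fiber[OF l])
  have lpos: "l > 0" if "k \<in> S" for k
    using that l lam_nonneg[of a k r] by (auto simp: S_def)
  let ?X = "{n. \<exists>gs :: nat \<Rightarrow> complex \<Rightarrow> complex. (\<forall>i<n. is_eigfun a r l (gs i)) \<and>
      (\<forall>i<n. \<forall>j<n. ipD r (gs i) (gs j) = (if i = j then 1 else 0))}"
  show "card {k. lam a k r = l} \<in> ?X"
  proof -
    obtain h where h: "bij_betw h {0..<card S} S"
      using ex_bij_betw_nat_finite[OF S] by blast
    \<comment> \<open>On the disc \<open>phi a (h i)\<close> has squared norm equal to its
      eigenvalue l.\<close>
    define gs where "gs i z = of_real (1 / sqrt l) * phi a (h i) z" for i z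
    have hS: "h i \<in> S" if "i < card S" for i using h that by (auto simp: bij_betw_def)
    have "is_eigfun a r l (gs i)" if i: "i < card S" for i
    proof -
      have li: "lam a (h i) r = l" using hS[OF i] by (simp add: S_def)
      have e: "is_eigfun a r l (phi a (h i))" using is_eigfun_phi[of a r "h i"] li by simp
      have L: "L2disc r (gs i)"
      proof -
        have "set_integrable lborel (ball 0 r) (\<lambda>w. (1 / sqrt l)\<^sup>2 * (gdens w * (cmod (phi a (h i) w))\<^sup>2))"
          using L2disc_phi[of r a "h i"] by (auto simp: L2disc_def)
        then show ?thesis unfolding L2disc_def gs_def
          by (auto simp: norm_mult norm_divide power_mult_distrib power_divide mult_ac)
      qed
      have "Kop a r (gs i) z = of_real (1 / sqrt l) * Kop a r (phi a (h i)) z" for z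
        unfolding Kop_def gs_def set_lebesgue_integral_def
        by (subst integral_mult_right_zero[symmetric]) (auto intro!: Bochner_Integration.integral_cong)
      then show ?thesis using e L
        unfolding is_eigfun_def by (auto elim!: eventually_mono simp: gs_def)
    qed
    moreover have "ipD r (gs i) (gs j) = (if i = j then 1 else 0)" if i: "i < card S" and j: "j < card S" for i j
    proof -
      have p: "l > 0" using lpos hS[OF i] by auto
      have "ipD r (gs i) (gs j) = of_real (1 / l) * ipD r (phi a (h i)) (phi a (h j))"
      proof -
        have q: "complex_of_real (1 / sqrt l) * of_real (1 / sqrt l) = of_real (1 / l)"
          using p by (simp flip: of_real_mult)
        have "of_real (gdens w) * gs i w * cnj (gs j w) = of_real (1 / l) * (of_real (gdens w) * phi a (h i) w * cnj (phi a (h j) w))" for w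
          unfolding q[symmetric] gs_def by (simp add: mult_ac)
        then have "indicator (ball 0 r) w *\<^sub>R (of_real (gdens w) * gs i w * cnj (gs j w)) =
            of_real (1 / l) * (indicator (ball 0 r) w *\<^sub>R (of_real (gdens w) * phi a (h i) w * cnj (phi a (h j) w)))" for w
          by (simp only: mult_scaleR_right)
        then show ?thesis unfolding ipD_def set_lebesgue_integral_def
          by (simp only: integral_mult_right_zero)
      qed
      moreover have "h i = h j \<longleftrightarrow> i = j"
        using h i j by (auto simp: bij_betw_def inj_on_def)
      moreover have "lam a (h j) r = l" using hS[OF j] by (simp add: S_def)
      ultimately show ?thesis using p by (simp add: ipD_phi flip: of_real_mult)
    qed
    ultimately show ?thesis unfolding S_def[symmetric] by blast
  qed
  fix n assume "n \<in> ?X"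
  then obtain gs :: "nat \<Rightarrow> complex \<Rightarrow> complex" where e: "\<And>i. i < n \<Longrightarrow> is_eigfun a r l (gs i)"
    and o: "\<And>i j. i < n \<Longrightarrow> j < n \<Longrightarrow> ipD r (gs i) (gs j) = (if i = j then 1 else 0)"
    by auto
  \<comment> \<open>Coordinates with respect to the orthonormal family
    \<open>phi a k / sqrt l\<close>, so that inner products of the \<open>gs\<close> become inner
    products of rows.\<close>
  define c where "c i k = ipD r (gs i) (phi a k) / of_real (sqrt l)" for i k
  have "(\<Sum>k\<in>S. c i k * cnj (c j k)) = (if i = j then 1 else 0)" if i: "i < n" and j: "j < n" for i j
  proof -
    have L: "L2disc r (gs i)" "L2disc r (gs j)" using e[OF i] e[OF j] by (auto simp: is_eigfun_def)
    have [measurable]: "gs i \<in> borel_measurable borel" "gs j \<in> borel_measurable borel" using L by (auto simp: L2disc_def)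
    have "ipD r (gs i) (gs j) = ipD r (\<lambda>z. (\<Sum>k\<in>S. ipD r (gs i) (phi a k) * phi a k z) / of_real l) (gs j)"
      unfolding S_def by (intro ipD_cong_AE eigfun_expansion e i l L) measurable
    also have "\<dots> = (\<Sum>k\<in>S. ipD r (gs i) (phi a k) / of_real l * ipD r (phi a k) (gs j))"
    proof -
      have ii: "integrable lborel (\<lambda>w. indicator (ball 0 r) w *\<^sub>R (of_real (gdens w) * phi a k w * cnj (gs j w)))" for k
        using L2disc_integrable[OF L2disc_phi L(2)] by (simp add: set_integrable_def)
      have "indicator (ball 0 r) w *\<^sub>R (of_real (gdens w) * ((\<Sum>k\<in>S. ipD r (gs i) (phi a k) * phi a k w) / of_real l) * cnj (gs j w))
         = (\<Sum>k\<in>S. ipD r (gs i) (phi a k) / of_real l * (indicator (ball 0 r) w *\<^sub>R (of_real (gdens w) * phi a k w * cnj (gs j w))))" for w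
        by (simp add: sum_distrib_left sum_distrib_right sum_divide_distrib scaleR_sum_right algebra_simps)
      then show ?thesis unfolding ipD_def[of r _ "gs j"] set_lebesgue_integral_def
        by (simp only: integral_sum_cmult[OF ii])
    qed
    also have "\<dots> = (\<Sum>k\<in>S. c i k * cnj (c j k))"
    proof (rule sum.cong)
      fix k assume "k \<in> S"
      then have "l > 0" by (rule lpos)
      then have q: "complex_of_real (sqrt l) * of_real (sqrt l) = of_real l"
        by (simp flip: of_real_mult)
      show "ipD r (gs i) (phi a k) / of_real l * ipD r (phi a k) (gs j) = c i k * cnj (c j k)"
        unfolding c_def q[symmetric] ipD_cnj[of r "phi a k" "gs j"] by simp
    qed simp
    finally show ?thesis using o[OF i j] by simp
  qed
  from card_ge_orthonormal_rows[OF S this] show "n \<le> card {k. lam a k r = l}"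
    unfolding S_def .
qed

text \<open>Groups the indices k by the value of \<open>lam\<close>, a rearrangement that
  nonnegativity makes legitimate; by \<open>eig_mult_eq\<close> the group sizes are the
  multiplicities. Indices with value 0 contribute nothing because \<open>fbeta\<close> vanishes at
  0.\<close>

lemma Sab_eq_suminf:
  assumes s: "summable (\<lambda>k. fbeta b (lam a k r))" and nn: "\<And>k. fbeta b (lam a k r) \<ge> 0"
  shows "Sab a b r = (\<Sum>k. fbeta b (lam a k r))"
proof -
  define h where "h k = fbeta b (lam a k r)" for k
  define S where "S l = {k. lam a k r = l}" for l
  have h0: "h k = 0" if "lam a k r = 0" for k
    using that by (simp add: h_def fbeta_def)
  have so: "h summable_on UNIV"
    using s nn by (auto simp: h_def[abs_def] intro!: summable_nonneg_imp_summable_on)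
  have inf1: "infsum h UNIV = suminf h"
    using s nn by (intro infsumI norm_summable_imp_has_sum) (auto simp: h_def[abs_def] summable_sums)
  define X where "X = Sigma (UNIV - {0}) S"
  have bij: "bij_betw snd X {k. lam a k r \<noteq> 0}"
    unfolding X_def S_def by (rule bij_betwI[of _ _ _ "\<lambda>k. (lam a k r, k)"]) auto
  have "h summable_on {k. lam a k r \<noteq> 0}"
    using so by (rule summable_on_subset_banach) auto
  then have sX: "(\<lambda>p. h (snd p)) summable_on X"
    using summable_on_reindex_bij_betw[OF bij, of h] by simp
  have "infsum h UNIV = infsum h {k. lam a k r \<noteq> 0}"
    by (rule infsum_cong_neutral) (auto simp: h0)
  also have "\<dots> = infsum (\<lambda>p. h (snd p)) X"
    using infsum_reindex_bij_betw[OF bij, of h] by simp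
  also have "\<dots> = infsum (\<lambda>l. infsum h (S l)) (UNIV - {0})"
    using infsum_Sigma'_banach[of "\<lambda>_ k. h k" "UNIV - {0}" S] sX by (simp add: X_def case_prod_unfold)
  also have "\<dots> = infsum (\<lambda>l. real (eig_mult a r l) * fbeta b l) (UNIV - {0})"
  proof (rule infsum_cong)
    fix l :: real assume l: "l \<in> UNIV - {0}"
    then have f: "finite (S l)" unfolding S_def by (intro finite_lam_fiber) auto
    have "infsum h (S l) = (\<Sum>k\<in>S l. fbeta b l)"
      using f by (simp add: h_def S_def)
    then show "infsum h (S l) = real (eig_mult a r l) * fbeta b l"
      using l by (simp add: eig_mult_eq S_def)
  qed
  finally show ?thesis
    unfolding Sab_def using inf1 by (simp add: h_def[abs_def])
qed

section \<open>Radial reduction\<close>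

text \<open>Upper rays must have finite measure. For this reason the next changes of variable push
  forward along minus the square, which gives upper rays a bounded range of squares.\<close>

lemma measure_eqI_neg_rays:
  fixes M N :: "real measure"
  assumes "sets M = sets borel" "sets N = sets borel"
    "\<And>x. emeasure M {x<..} = emeasure N {x<..}" "\<And>x. emeasure N {x<..} \<noteq> \<infinity>"
  shows "M = N"
  using assms by (intro measure_eqI_lessThan) (auto simp: less_top)

lemma power2_less_iff_less_sqrt:
  fixes s :: real
  assumes "s \<ge> 0"
  shows "s\<^sup>2 < y \<longleftrightarrow> s < sqrt y"
proof -
  have "sqrt (s\<^sup>2) = s" using assms by simp
  then show ?thesis by (metis real_sqrt_less_iff)
qed

text \<open>Polar coordinates with the angle integrated out: the set where |z|^2 < y is a disc of
  area pi * y, and these values determine the push-forward.\<close>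

lemma nn_integral_cmod_sq:
  assumes [measurable]: "F \<in> borel_measurable borel"
  shows "(\<integral>\<^sup>+z. F ((cmod z)\<^sup>2) \<partial>lborel) = (\<integral>\<^sup>+t. ennreal pi * indicator {0..} t * F t \<partial>lborel)"
proof -
  have eq: "distr lborel borel (\<lambda>z::complex. - ((cmod z)\<^sup>2)) = density lborel (\<lambda>t. ennreal pi * indicator {..0} t)"
  proof (rule measure_eqI_neg_rays)
    fix x :: real
    have N: "emeasure (density lborel (\<lambda>t. ennreal pi * indicator {..0} t)) {x<..} = ennreal pi * ennreal (max 0 (- x))"
    proof -
      have "emeasure (density lborel (\<lambda>t. ennreal pi * indicator {..0} t)) {x<..} = (\<integral>\<^sup>+t. ennreal pi * indicator {x<..0} t \<partial>lborel)"
        by (subst emeasure_density) (auto intro!: nn_integral_cong split: split_indicator)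
      also have "\<dots> = ennreal pi * emeasure lborel {x<..0}"
        by (simp add: nn_integral_cmult)
      also have "emeasure lborel {x<..0} = ennreal (max 0 (- x))"
        by (cases "x \<le> 0") (auto simp: max_def)
      finally show ?thesis .
    qed
    have "emeasure (distr lborel borel (\<lambda>z::complex. - ((cmod z)\<^sup>2))) {x<..} = emeasure lborel {z::complex. (cmod z)\<^sup>2 < - x}"
      by (subst emeasure_distr) (auto intro!: arg_cong[where f = "emeasure lborel"])
    also have "\<dots> = ennreal pi * ennreal (max 0 (- x))"
    proof (cases "x < 0")
      case True
      have "{z::complex. (cmod z)\<^sup>2 < - x} = ball 0 (sqrt (- x))"
        by (auto simp: power2_less_iff_less_sqrt)
      also have "emeasure lborel (ball 0 (sqrt (- x)) :: complex set) = ennreal (unit_ball_vol 2 * sqrt (- x) ^ 2)"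
        using True by (subst emeasure_ball) auto
      finally show ?thesis using True by (simp add: unit_ball_vol_2 max_def flip: ennreal_mult')
    next
      case False
      then have "{z::complex. (cmod z)\<^sup>2 < - x} = {}"
        by (auto simp: not_less intro: order_trans[of _ 0])
      with False show ?thesis by (simp add: max_def)
    qed
    finally show "emeasure (distr lborel borel (\<lambda>z::complex. - ((cmod z)\<^sup>2))) {x<..} =
        emeasure (density lborel (\<lambda>t. ennreal pi * indicator {..0} t)) {x<..}"
      by (simp only: N)
    show "emeasure (density lborel (\<lambda>t. ennreal pi * indicator {..0} t)) {x<..} \<noteq> \<infinity>"
      unfolding N by (simp add: ennreal_mult_eq_top_iff)
  qed auto
  have "(\<integral>\<^sup>+z. F ((cmod z)\<^sup>2) \<partial>lborel) = (\<integral>\<^sup>+t. F (- t) \<partial>distr lborel borel (\<lambda>z::complex. - ((cmod z)\<^sup>2)))"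
    by (subst nn_integral_distr) auto
  also have "\<dots> = (\<integral>\<^sup>+t. ennreal pi * indicator {..0} t * F (- t) \<partial>lborel)"
    unfolding eq by (subst nn_integral_density) auto
  also have "\<dots> = (\<integral>\<^sup>+t. ennreal pi * indicator {0..} t * F t \<partial>lborel)"
    by (subst nn_integral_real_affine[where c = "-1" and t = 0]) (auto intro!: nn_integral_cong split: split_indicator)
  finally show ?thesis .
qed

text \<open>The substitution v = s^2 for all nonnegative measurable functions at once, again by
  comparing two measures on rays.\<close>

lemma nn_integral_square_substitution:
  fixes F :: "real \<Rightarrow> ennreal"
  assumes [measurable]: "F \<in> borel_measurable borel"
  shows "(\<integral>\<^sup>+v. indicator {0<..} v * F v \<partial>lborel) = (\<integral>\<^sup>+s. ennreal (2 * s) * indicator {0<..} s * F (s\<^sup>2) \<partial>lborel)"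
proof -
  have eq: "distr (density lborel (\<lambda>s. ennreal (2 * s) * indicator {0<..} s)) borel (\<lambda>s::real. - (s\<^sup>2)) = density lborel (\<lambda>t. indicator {..<0} t)"
  proof (rule measure_eqI_neg_rays)
    fix x :: real
    have N: "emeasure (density lborel (\<lambda>t. indicator {..<0} t)) {x<..} = ennreal (max 0 (- x))"
    proof -
      have "emeasure (density lborel (\<lambda>t. indicator {..<0} t)) {x<..} = (\<integral>\<^sup>+t. indicator {..<0} t * indicator {x<..} t \<partial>lborel)"
        by (rule emeasure_density) auto
      also have "\<dots> = (\<integral>\<^sup>+t. indicator {x<..<0} t \<partial>lborel)"
        by (rule nn_integral_cong) (auto split: split_indicator)
      also have "\<dots> = emeasure lborel {x<..<0}" by simp
      also have "emeasure lborel {x<..<0} = ennreal (max 0 (- x))"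
        by (cases "x \<le> 0") (auto simp: max_def)
      finally show ?thesis .
    qed
    have "emeasure (distr (density lborel (\<lambda>s. ennreal (2 * s) * indicator {0<..} s)) borel (\<lambda>s::real. - (s\<^sup>2))) {x<..}
       = (\<integral>\<^sup>+s. ennreal (2 * s) * indicator {0<..} s * indicator {s. s\<^sup>2 < - x} s \<partial>lborel)"
    proof -
      have "{s::real. x < - s\<^sup>2} = {s. s\<^sup>2 < - x}" by auto
      then show ?thesis by (subst emeasure_distr) (auto simp: emeasure_density vimage_def)
    qed
    also have "\<dots> = ennreal (max 0 (- x))"
    proof (cases "x < 0")
      case True
      have iff: "s\<^sup>2 < - x \<longleftrightarrow> s < sqrt (- x)" if "s > 0" for s
        using that by (simp add: power2_less_iff_less_sqrt)
      have "(\<integral>\<^sup>+s. ennreal (2 * s) * indicator {0<..} s * indicator {s. s\<^sup>2 < - x} s \<partial>lborel)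
         = (\<integral>\<^sup>+s. ennreal (2 * s) * indicator {0..sqrt (- x)} s \<partial>lborel)"
      proof (rule nn_integral_cong_AE)
        have "AE s in lborel. s \<noteq> sqrt (- x)" by (rule AE_lborel_singleton)
        then show "AE s in lborel. ennreal (2 * s) * indicator {0<..} s * indicator {s. s\<^sup>2 < - x} s = ennreal (2 * s) * indicator {0..sqrt (- x)} s"
          by eventually_elim (auto simp: indicator_def iff)
      qed
      also have "\<dots> = ennreal ((sqrt (- x))\<^sup>2 - 0\<^sup>2)"
        using True by (intro nn_integral_FTC_Icc) (auto intro!: derivative_eq_intros)
      finally show ?thesis using True by (simp add: max_def)
    next
      case False
      then have "\<not> s\<^sup>2 < - x" for s :: real
        by (auto simp: not_less intro: order_trans[of _ 0])
      with False show ?thesis by (simp add: max_def)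
    qed
    finally show "emeasure (distr (density lborel (\<lambda>s. ennreal (2 * s) * indicator {0<..} s)) borel (\<lambda>s::real. - (s\<^sup>2))) {x<..} =
        emeasure (density lborel (\<lambda>t. indicator {..<0} t)) {x<..}"
      by (simp only: N)
    show "emeasure (density lborel (\<lambda>t. indicator {..<0} t)) {x<..} \<noteq> \<infinity>"
      unfolding N by simp
  qed auto
  have "(\<integral>\<^sup>+v. indicator {0<..} v * F v \<partial>lborel) = (\<integral>\<^sup>+v. indicator {..<0} v * F (- v) \<partial>lborel)"
    by (subst nn_integral_real_affine[where c = "-1" and t = 0]) (auto intro!: nn_integral_cong split: split_indicator)
  also have "\<dots> = (\<integral>\<^sup>+v. F (- v) \<partial>(density lborel (\<lambda>t. indicator {..<0} t)))"
    by (subst nn_integral_density) auto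
  also have "\<dots> = (\<integral>\<^sup>+s. ennreal (2 * s) * indicator {0<..} s * F (s\<^sup>2) \<partial>lborel)"
    unfolding eq[symmetric] by (subst nn_integral_distr) (auto simp: nn_integral_density)
  finally show ?thesis .
qed

section \<open>Associated Laguerre polynomials and the radial density\<close>

fun lagm :: "nat \<Rightarrow> nat \<Rightarrow> real \<Rightarrow> real" where
  "lagm 0 a t = 1"
| "lagm (Suc n) a t = t * lagm n (Suc a) t - real (n + 1 + a) * lagm n a t"

text \<open>\<open>lagm n a\<close> is the monic multiple (-1)^n * n! of the associated Laguerre
  polynomial L_n^(a). Its recursion is that of \<open>cherm\<close> on the index pair (n, n + a),
  where lowering n raises the difference a.\<close>

lemma cherm_eq_lagm: "cherm n (n + a) z = z ^ a * of_real (lagm n a ((cmod z)\<^sup>2))"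
proof (induction n arbitrary: a)
  case (Suc n)
  have "cherm (Suc n) (Suc n + a) z = cnj z * cherm n (n + Suc a) z - of_nat (Suc n + a) * cherm n (n + a) z"
    by simp
  also have "\<dots> = (z * cnj z) * z ^ a * of_real (lagm n (Suc a) ((cmod z)\<^sup>2)) - of_nat (Suc n + a) * z ^ a * of_real (lagm n a ((cmod z)\<^sup>2))"
    unfolding Suc by (simp add: mult_ac)
  also have "\<dots> = z ^ a * of_real (lagm (Suc n) a ((cmod z)\<^sup>2))"
    unfolding complex_norm_square[symmetric] by (simp add: algebra_simps)
  finally show ?case .
qed simp

lemma lagm_Suc_param: "lagm n (Suc a) t = lagm n a t - real n * lagm (n - 1) (Suc a) t"
proof (induction n arbitrary: a)
  case (Suc n)
  have *: "real n * lagm n (Suc a) t = real n * (t * lagm (n - 1) (Suc (Suc a)) t - real (n + 1 + a) * lagm (n - 1) (Suc a) t)"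
    by (cases n) auto
  have "lagm (Suc n) (Suc a) t = t * lagm n (Suc (Suc a)) t - real (n + 2 + a) * lagm n (Suc a) t"
    by simp
  also have "\<dots> = t * (lagm n (Suc a) t - real n * lagm (n - 1) (Suc (Suc a)) t)
      - real (n + 1 + a) * (lagm n a t - real n * lagm (n - 1) (Suc a) t) - lagm n (Suc a) t"
    unfolding Suc[of "Suc a"] by (simp add: Suc[of a] algebra_simps)
  also have "\<dots> = lagm (Suc n) a t - real n * (t * lagm (n - 1) (Suc (Suc a)) t - real (n + 1 + a) * lagm (n - 1) (Suc a) t) - lagm n (Suc a) t"
    by (simp add: algebra_simps)
  also have "\<dots> = lagm (Suc n) a t - real (Suc n) * lagm (Suc n - 1) (Suc a) t"
    unfolding *[symmetric] by (simp add: algebra_simps)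
  finally show ?case .
qed simp

lemma lagm_deriv: "(lagm n a has_real_derivative real n * lagm (n - 1) (Suc a) t) (at t)"
proof (induction n arbitrary: a)
  case 0
  have "lagm 0 a = (\<lambda>_. 1)" by auto
  then show ?case by simp
next
  case (Suc n)
  have eq: "lagm (Suc n) a = (\<lambda>t. t * lagm n (Suc a) t - real (n + 1 + a) * lagm n a t)" by auto
  have *: "real n * lagm n (Suc a) t = real n * (t * lagm (n - 1) (Suc (Suc a)) t - real (n + 1 + a) * lagm (n - 1) (Suc a) t)"
    by (cases n) auto
  have "(lagm (Suc n) a has_real_derivative
      (lagm n (Suc a) t + t * (real n * lagm (n - 1) (Suc (Suc a)) t)) - real (n + 1 + a) * (real n * lagm (n - 1) (Suc a) t)) (at t)"
    unfolding eq by (auto intro!: derivative_eq_intros Suc)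
  moreover have "lagm n (Suc a) t + t * (real n * lagm (n - 1) (Suc (Suc a)) t) - real (n + 1 + a) * (real n * lagm (n - 1) (Suc a) t)
      = real (Suc n) * lagm (Suc n - 1) (Suc a) t"
    using * by (simp add: algebra_simps)
  ultimately show ?case by (simp only:)
qed

text \<open>A Rodrigues-type formula: it trades degree for parameter and so provides the integration
  by parts in \<open>lagm_primitive\<close>.\<close>

lemma lagm_weighted_deriv:
  "((\<lambda>t. t ^ Suc a * exp (- t) * lagm n (Suc a) t) has_real_derivative - (t ^ a * exp (- t) * lagm (Suc n) a t)) (at t)"
proof -
  have *: "real n * lagm n (Suc a) t = real n * (t * lagm (n - 1) (Suc (Suc a)) t - real (n + 1 + a) * lagm (n - 1) (Suc a) t)"
    by (cases n) auto
  have key: "real (Suc a) * lagm n (Suc a) t + t * (real n * lagm (n - 1) (Suc (Suc a)) t) = real (n + 1 + a) * lagm n a t"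
  proof -
    have "real (Suc a) * lagm n (Suc a) t + t * (real n * lagm (n - 1) (Suc (Suc a)) t)
       = real (n + 1 + a) * (lagm n (Suc a) t + real n * lagm (n - 1) (Suc a) t)"
      using * by (simp add: algebra_simps)
    moreover have "lagm n (Suc a) t + real n * lagm (n - 1) (Suc a) t = lagm n a t"
      using lagm_Suc_param[of n a t] by linarith
    ultimately show ?thesis by (simp only:)
  qed
  have "((\<lambda>t. t ^ Suc a * exp (- t)) has_real_derivative (real (Suc a) * t ^ a * exp (- t) - t ^ Suc a * exp (- t))) (at t)"
    by (rule derivative_eq_intros refl)+ simp
  from DERIV_mult[OF this lagm_deriv[of n "Suc a" t]]
  have "((\<lambda>t. t ^ Suc a * exp (- t) * lagm n (Suc a) t) has_real_derivative
     t ^ a * exp (- t) * ((real (Suc a) * lagm n (Suc a) t + t * (real n * lagm (n - 1) (Suc (Suc a)) t)) - t * lagm n (Suc a) t)) (at t)"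
    by (rule DERIV_cong) (simp add: algebra_simps del: lagm.simps)
  then show ?thesis unfolding key by (rule DERIV_cong) (simp add: algebra_simps)
qed

text \<open>Unlike in the defining recursion, the parameter a stays fixed. This is the form that can
  be rescaled to the Hermite recurrence with a tied to the scale.\<close>

lemma lagm_three_term:
  "lagm (Suc (Suc n)) a t = (t - real (2 * n + 3 + a)) * lagm (Suc n) a t - real (Suc n) * real (Suc n + a) * lagm n a t"
proof -
  have 1: "lagm (Suc n) (Suc a) t = lagm (Suc n) a t - real (Suc n) * lagm n (Suc a) t"
    using lagm_Suc_param[of "Suc n" a t] by simp
  have 2: "t * lagm n (Suc a) t = lagm (Suc n) a t + real (n + 1 + a) * lagm n a t"
    by simp
  have "lagm (Suc (Suc n)) a t = t * lagm (Suc n) (Suc a) t - real (Suc n + 1 + a) * lagm (Suc n) a t"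
    by (rule lagm.simps)
  also have "\<dots> = t * lagm (Suc n) a t - real (Suc n) * (t * lagm n (Suc a) t) - real (Suc n + 1 + a) * lagm (Suc n) a t"
    unfolding 1 by (simp add: algebra_simps del: lagm.simps)
  also have "\<dots> = (t - real (2 * n + 3 + a)) * lagm (Suc n) a t - real (Suc n) * real (Suc n + a) * lagm n a t"
    unfolding 2 by (simp add: algebra_simps del: lagm.simps)
  finally show ?thesis .
qed

lemma tendsto_lagm_weighted_0:
  assumes "\<And>m. ((\<lambda>t::real. t ^ m * exp (- t) * X t) \<longlongrightarrow> 0) at_top"
  shows "((\<lambda>t. t ^ m * exp (- t) * (lagm n a t * X t)) \<longlongrightarrow> 0) at_top"
proof (induction n arbitrary: a m)
  case 0
  then show ?case using assms[of m] by simp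
next
  case (Suc n)
  have "((\<lambda>t. t ^ Suc m * exp (- t) * (lagm n (Suc a) t * X t) - real (n + 1 + a) * (t ^ m * exp (- t) * (lagm n a t * X t))) \<longlongrightarrow> 0 - real (n + 1 + a) * 0) at_top"
    by (intro tendsto_diff tendsto_mult tendsto_const Suc)
  then show ?case by (simp add: algebra_simps)
qed

text \<open>The squared norm n! * (n + a)!, packaged as an antiderivative for the fundamental
  theorem on a half-line. One integration by parts replaces the pair (Suc n, a) by (n, Suc
  a).\<close>

lemma lagm_primitive:
  "\<exists>P. (\<forall>t. (P has_real_derivative t ^ a * exp (- t) * (lagm n a t)\<^sup>2) (at t)) \<and> P 0 = 0 \<and>
     (P \<longlongrightarrow> fact n * fact (n + a)) at_top"
proof (induction n arbitrary: a)
  case 0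
  have lim: "((\<lambda>t::real. t ^ m * exp (- t)) \<longlongrightarrow> 0) at_top" for m
    using tendsto_power_div_exp_0[of m] by (simp add: exp_minus divide_inverse)
  show ?case
  proof (induction a)
    case 0
    show ?case
    proof (intro exI conjI allI)
      show "((\<lambda>t. 1 - exp (- t)) has_real_derivative t ^ 0 * exp (- t) * (lagm 0 0 t)\<^sup>2) (at t)" for t
        by (auto intro!: derivative_eq_intros)
      have "((\<lambda>t::real. 1 - t ^ 0 * exp (- t)) \<longlongrightarrow> 1 - 0) at_top"
        by (intro tendsto_diff tendsto_const lim)
      then show "((\<lambda>t::real. 1 - exp (- t)) \<longlongrightarrow> fact 0 * fact (0 + 0)) at_top" by simp
    qed simp
  next
    case (Suc a)
    then obtain P where P: "\<And>t. (P has_real_derivative t ^ a * exp (- t)) (at t)" "P 0 = 0" "(P \<longlongrightarrow> fact a) at_top"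
      by auto
    show ?case
    proof (intro exI conjI allI)
      show "((\<lambda>t. real (Suc a) * P t - t ^ Suc a * exp (- t)) has_real_derivative t ^ Suc a * exp (- t) * (lagm 0 (Suc a) t)\<^sup>2) (at t)" for t
        by (rule derivative_eq_intros P(1) refl)+ (simp add: algebra_simps)
      have "((\<lambda>t::real. real (Suc a) * P t - t ^ Suc a * exp (- t)) \<longlongrightarrow> real (Suc a) * fact a - 0) at_top"
        by (intro tendsto_diff tendsto_mult tendsto_const lim P(3))
      then show "((\<lambda>t::real. real (Suc a) * P t - t ^ Suc a * exp (- t)) \<longlongrightarrow> fact 0 * fact (0 + Suc a)) at_top"
        by simp
    qed (simp add: P(2))
  qed
next
  case (Suc n)
  obtain P where P: "\<And>t. (P has_real_derivative t ^ Suc a * exp (- t) * (lagm n (Suc a) t)\<^sup>2) (at t)" "P 0 = 0"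
     "(P \<longlongrightarrow> fact n * fact (n + Suc a)) at_top"
    using Suc[of "Suc a"] by auto
  \<comment> \<open>The boundary term of the integration by parts; it vanishes at 0 and at
    infinity.\<close>
  define G where "G t = t ^ Suc a * exp (- t) * lagm n (Suc a) t * lagm (Suc n) a t" for t
  have G': "(G has_real_derivative - (t ^ a * exp (- t) * lagm (Suc n) a t) * lagm (Suc n) a t
      + real (Suc n) * lagm n (Suc a) t * (t ^ Suc a * exp (- t) * lagm n (Suc a) t)) (at t)" for t
    using DERIV_mult[OF lagm_weighted_deriv[of a n t] lagm_deriv[of "Suc n" a t]]
    unfolding G_def[abs_def] diff_Suc_1 by simp
  have lim: "((\<lambda>t::real. t ^ m * exp (- t)) \<longlongrightarrow> 0) at_top" for m
    using tendsto_power_div_exp_0[of m] by (simp add: exp_minus divide_inverse)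
  have "((\<lambda>t. t ^ Suc a * exp (- t) * (lagm n (Suc a) t * (lagm (Suc n) a t * 1))) \<longlongrightarrow> 0) at_top"
    by (intro tendsto_lagm_weighted_0) (use lim in simp)
  then have Glim: "(G \<longlongrightarrow> 0) at_top"
    unfolding G_def[abs_def] by (simp add: mult.assoc del: lagm.simps)
  show ?case
  proof (intro exI conjI allI)
    fix t
    have "((\<lambda>t. real (Suc n) * P t - G t) has_real_derivative
      real (Suc n) * (t ^ Suc a * exp (- t) * (lagm n (Suc a) t)\<^sup>2) - (- (t ^ a * exp (- t) * lagm (Suc n) a t) * lagm (Suc n) a t
      + real (Suc n) * lagm n (Suc a) t * (t ^ Suc a * exp (- t) * lagm n (Suc a) t))) (at t)"
      by (intro DERIV_diff DERIV_cmult P G')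
    then show "((\<lambda>t. real (Suc n) * P t - G t) has_real_derivative t ^ a * exp (- t) * (lagm (Suc n) a t)\<^sup>2) (at t)"
      by (rule DERIV_cong) (simp add: power2_eq_square algebra_simps del: lagm.simps)
    have "((\<lambda>t. real (Suc n) * P t - G t) \<longlongrightarrow> real (Suc n) * (fact n * fact (n + Suc a)) - 0) at_top"
      by (intro tendsto_diff tendsto_mult tendsto_const P Glim)
    then show "((\<lambda>t. real (Suc n) * P t - G t) \<longlongrightarrow> fact (Suc n) * fact (Suc n + a)) at_top"
      by (simp add: algebra_simps)
  qed (simp add: P(2) G_def)
qed

lemma continuous_lagm: "continuous_on S (lagm n a)"
  using DERIV_isCont[OF lagm_deriv] by (auto intro: continuous_at_imp_continuous_on)

lemma borel_measurable_lagm[measurable]: "lagm n a \<in> borel_measurable borel"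
  by (intro borel_measurable_continuous_onI continuous_lagm)

text \<open>The probability density of |z|^2 when z has density \<open>gdens\<close> times the
  square of |\<open>phi n (n + a)\<close>|.\<close>

definition pdens :: "nat \<Rightarrow> nat \<Rightarrow> real \<Rightarrow> real" where
  "pdens n a t = t ^ a * exp (- t) * (lagm n a t)\<^sup>2 / (fact n * fact (n + a))"

lemma borel_measurable_pdens[measurable]: "pdens n a \<in> borel_measurable borel"
  unfolding pdens_def by measurable

lemma pdens_nonneg: "t \<ge> 0 \<Longrightarrow> pdens n a t \<ge> 0"
  by (simp add: pdens_def)

lemma nn_integral_pdens: "(\<integral>\<^sup>+t. ennreal (pdens n a t) * indicator {0..} t \<partial>lborel) = 1"
proof -
  obtain P where P: "\<And>t. (P has_real_derivative t ^ a * exp (- t) * (lagm n a t)\<^sup>2) (at t)" "P 0 = 0"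
     "(P \<longlongrightarrow> fact n * fact (n + a)) at_top"
    using lagm_primitive by metis
  let ?c = "fact n * fact (n + a) :: real"
  have "(\<integral>\<^sup>+t. ennreal (pdens n a t) * indicator {0..} t \<partial>lborel) = ennreal (1 - P 0 / ?c)"
  proof (rule nn_integral_FTC_atLeast)
    show "((\<lambda>t. P t / ?c) has_real_derivative pdens n a t) (at t)" for t
      unfolding pdens_def by (intro DERIV_cdivide P)
    have "((\<lambda>t. P t / ?c) \<longlongrightarrow> ?c / ?c) at_top"
      by (intro tendsto_divide P tendsto_const) simp
    then show "((\<lambda>t. P t / ?c) \<longlongrightarrow> 1) at_top" by simp
  qed (auto intro: pdens_nonneg)
  then show ?thesis by (simp add: P(2))
qed

text \<open>Through this symmetry the eigenvalues with second index below the first are reduced to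
  the pairs (n, n + a).\<close>

lemma cmod_phi_swap: "cmod (phi a k z) = cmod (phi k a z)"
  by (simp add: phi_def cherm_swap[of a k] norm_divide mult.commute)

lemma lam_swap: "lam a k r = lam k a r"
  by (simp add: lam_def cmod_phi_swap[of a k])

lemma lam_eq_nn_integral:
  assumes "r \<ge> 0"
  shows "ennreal (lam n (n + a) r) = (\<integral>\<^sup>+t. ennreal (pdens n a t) * indicator {0..<r\<^sup>2} t \<partial>lborel)"
proof -
  have sq: "(cmod (phi n (n + a) z))\<^sup>2 * gdens z = pdens n a ((cmod z)\<^sup>2) / pi" for z
  proof -
    have "(cmod (phi n (n + a) z))\<^sup>2 = ((cmod z)\<^sup>2) ^ a * (lagm n a ((cmod z)\<^sup>2))\<^sup>2 / (fact n * fact (n + a))"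
      by (simp add: phi_def cherm_eq_lagm norm_divide norm_mult norm_power power_divide power_mult_distrib
          flip: power_mult) (simp add: mult.commute)
    then show ?thesis by (simp add: pdens_def gdens_def)
  qed
  have ball: "indicator (ball 0 r) z = (indicator {..<r\<^sup>2} ((cmod z)\<^sup>2) :: real)" for z :: complex
    using assms by (simp add: indicator_def power2_less_iff_less_sqrt)
  have "ennreal (lam n (n + a) r) = (\<integral>\<^sup>+w. ennreal (indicator (ball 0 r) w *\<^sub>R (gdens w * (cmod (phi n (n + a) w))\<^sup>2)) \<partial>lborel)"
    unfolding lam_def set_lebesgue_integral_def
    using L2disc_phi[of r n "n + a"]
    by (intro nn_integral_eq_integral[symmetric]) (auto simp: L2disc_def set_integrable_def gdens_nonneg)
  also have "\<dots> = (\<integral>\<^sup>+w. (\<lambda>t. ennreal (indicator {..<r\<^sup>2} t * (pdens n a t / pi))) ((cmod w)\<^sup>2) \<partial>lborel)"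
    by (intro nn_integral_cong) (simp add: ball sq[symmetric] mult.commute)
  also have "\<dots> = (\<integral>\<^sup>+t. ennreal pi * indicator {0..} t * ennreal (indicator {..<r\<^sup>2} t * (pdens n a t / pi)) \<partial>lborel)"
    by (rule nn_integral_cmod_sq) measurable
  also have "\<dots> = (\<integral>\<^sup>+t. ennreal (pdens n a t) * indicator {0..<r\<^sup>2} t \<partial>lborel)"
    by (intro nn_integral_cong) (auto split: split_indicator simp: pdens_nonneg simp flip: ennreal_mult')
  finally show ?thesis .
qed

text \<open>For e = 1 / \<open>kap a\<close> this is (1 - e * u / 2)^(2a + 1) * exp
  (\<open>kap a\<close> * u - u^2 / 4), the radial weight normalised to 1 at u = 0, since 2 / e^2 =
  2a + 1. The value at e = 0 is its limit, and e * u >= 2 means a nonpositive radius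
  \<open>kap a - u / 2\<close>.\<close>

definition hw :: "real \<Rightarrow> real \<Rightarrow> real" where
  "hw e u = (if e = 0 then exp (- (u\<^sup>2) / 2)
     else if e * u < 2 then exp (2 / e\<^sup>2 * ln (1 - e * u / 2) + u / e - u\<^sup>2 / 4) else 0)"

text \<open>The polynomial \<open>lagm n a\<close> at (\<open>kap a\<close> - u / 2)^2 divided by (-
  \<open>kap a\<close>)^n, written in u and e = 1 / \<open>kap a\<close>. At e = 0 the recursion is
  that of \<open>He\<close>.\<close>

fun lq :: "nat \<Rightarrow> real \<Rightarrow> real \<Rightarrow> real" where
  "lq 0 e u = 1"
| "lq (Suc 0) e u = u + e * (1/2 - u\<^sup>2 / 4)"
| "lq (Suc (Suc n)) e u = (u + e * (2 * real (Suc n) + 1/2 - u\<^sup>2 / 4)) * lq (Suc n) e u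
     - real (Suc n) * (1 + e\<^sup>2 * (real n + 1/2)) * lq n e u"

definition wt :: "nat \<Rightarrow> real \<Rightarrow> real \<Rightarrow> real" where
  "wt n e u = hw e u * (lq n e u)\<^sup>2"

text \<open>The shift 1/2 absorbs the radial Jacobian: the total power 2a + 1 of the radius equals 2
  * kap^2, so the weight depends on a through 1 / kap alone. It also makes kap^2 the midpoint of the
  cell between a and a + 1.\<close>

definition kap :: "nat \<Rightarrow> real" where
  "kap a = sqrt (real a + 1/2)"

lemma kap_pos: "kap a > 0"
  by (simp add: kap_def)

lemma kap_sq: "(kap a)\<^sup>2 = real a + 1/2"
  by (simp add: kap_def)

lemma hw_nonneg: "hw e u \<ge> 0"
  by (simp add: hw_def)

lemma wt_nonneg: "wt n e u \<ge> 0"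
  by (simp add: wt_def hw_nonneg)

lemma lagm_eq_lq: "lagm n a ((kap a - u / 2)\<^sup>2) = (- kap a) ^ n * lq n (1 / kap a) u"
proof (induction n rule: induct_nat_012)
  case 0
  show ?case by simp
next
  case 1
  have "(kap a - u / 2)\<^sup>2 - real (Suc a) = - kap a * (u + 1 / kap a * (1/2 - u\<^sup>2 / 4))"
  proof -
    have "- kap a * (u + 1 / kap a * (1/2 - u\<^sup>2 / 4)) = - kap a * u - (1/2 - u\<^sup>2 / 4)"
      using kap_pos[of a] by (simp add: field_simps)
    then show ?thesis by (simp add: power2_diff kap_sq power_divide)
  qed
  then show ?case by simp
next
  case (ge2 n)
  define k where "k = kap a"
  have k: "k > 0" "k\<^sup>2 = real a + 1/2" by (simp_all add: k_def kap_pos kap_sq)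
  have c1: "(k - u / 2)\<^sup>2 - real (2 * n + 3 + a) = - k * (u + 1 / k * (2 * real (Suc n) + 1/2 - u\<^sup>2 / 4))"
  proof -
    have "- k * (u + 1 / k * (2 * real (Suc n) + 1/2 - u\<^sup>2 / 4)) = - k * u - (2 * real (Suc n) + 1/2 - u\<^sup>2 / 4)"
      using k(1) by (simp add: field_simps)
    then show ?thesis by (simp add: power2_diff k(2) power_divide)
  qed
  have c2: "real (Suc n + a) = k\<^sup>2 * (1 + (1 / k)\<^sup>2 * (real n + 1/2))"
  proof -
    have "k\<^sup>2 * (1 + (1 / k)\<^sup>2 * (real n + 1/2)) = k\<^sup>2 + (real n + 1/2)"
      using k(1) by (simp add: field_simps power2_eq_square)
    then show ?thesis by (simp add: k(2))
  qed
  have "lagm (Suc (Suc n)) a ((k - u / 2)\<^sup>2) = (- k * (u + 1 / k * (2 * real (Suc n) + 1/2 - u\<^sup>2 / 4))) * ((- k) ^ Suc n * lq (Suc n) (1 / k) u)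
     - real (Suc n) * (k\<^sup>2 * (1 + (1 / k)\<^sup>2 * (real n + 1/2))) * ((- k) ^ n * lq n (1 / k) u)"
    unfolding lagm_three_term c1 c2 using ge2 unfolding k_def by (simp only:)
  also have "\<dots> = (- k) ^ Suc (Suc n) * lq (Suc (Suc n)) (1 / k) u"
  proof -
    have "(- k * A) * ((- k) ^ Suc n * X) - m * (k\<^sup>2 * B) * ((- k) ^ n * Y) = (- k) ^ Suc (Suc n) * (A * X - m * B * Y)" for A B X Y m :: real
      by (simp add: algebra_simps power2_eq_square)
    then show ?thesis unfolding lq.simps .
  qed
  finally show ?case unfolding k_def .
qed

lemma borel_measurable_lq[measurable]: "lq n e \<in> borel_measurable borel"
  by (induction n rule: induct_nat_012) (auto intro!: borel_measurable_continuous_onI continuous_intros, measurable)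

lemma borel_measurable_hw[measurable]: "hw e \<in> borel_measurable borel"
  unfolding hw_def by measurable

lemma borel_measurable_wt[measurable]: "wt n e \<in> borel_measurable borel"
  unfolding wt_def by measurable

text \<open>All factors independent of u. By \<open>integral_wt\<close> it is the reciprocal of the
  total mass of \<open>wt\<close>, so quotients of \<open>wt\<close> integrals take the place of
  Stirling asymptotics.\<close>

definition wnorm :: "nat \<Rightarrow> nat \<Rightarrow> real" where
  "wnorm n a = kap a ^ (2 * a + 1) * kap a ^ (2 * n) * exp (- ((kap a)\<^sup>2)) / (fact n * fact (n + a))"

text \<open>The factor \<open>kap a - u / 2\<close> is the Jacobian, up to sign, of t =
  (\<open>kap a\<close> - u / 2)^2; the hypothesis says that this radius is positive.\<close>

lemma pdens_eq_wt:
  assumes "u < 2 * kap a"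
  shows "(kap a - u / 2) * pdens n a ((kap a - u / 2)\<^sup>2) = wnorm n a * wt n (1 / kap a) u"
proof -
  define k where "k = kap a"
  have k: "k > 0" "k\<^sup>2 = real a + 1/2" by (simp_all add: k_def kap_pos kap_sq)
  have pos: "1 - u / (2 * k) > 0" using assms k by (simp add: k_def[symmetric] field_simps)
  have hw: "hw (1 / k) u = (1 - u / (2 * k)) ^ (2 * a + 1) * exp (k * u - u\<^sup>2 / 4)"
  proof -
    have "hw (1 / k) u = exp (2 * k\<^sup>2 * ln (1 - u / (2 * k)) + (k * u - u\<^sup>2 / 4))"
      using k assms by (simp add: hw_def k_def[symmetric] field_simps)
    also have "2 * k\<^sup>2 = real (2 * a + 1)" by (simp add: k(2))
    also have "exp (real (2 * a + 1) * ln (1 - u / (2 * k)) + (k * u - u\<^sup>2 / 4)) = exp (ln (1 - u / (2 * k))) ^ (2 * a + 1) * exp (k * u - u\<^sup>2 / 4)"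
      unfolding exp_add exp_of_nat_mult ..
    finally show ?thesis using pos by simp
  qed
  have "(k - u / 2) * ((k - u / 2)\<^sup>2) ^ a = (k - u / 2) ^ (2 * a + 1)"
    by (simp add: power_mult)
  also have "\<dots> = (k * (1 - u / (2 * k))) ^ (2 * a + 1)"
    by (rule arg_cong[where f = "\<lambda>x. x ^ (2 * a + 1)"]) (use k in \<open>simp add: field_simps\<close>)
  also have "\<dots> = k ^ (2 * a + 1) * (1 - u / (2 * k)) ^ (2 * a + 1)"
    by (rule power_mult_distrib)
  finally have p: "(k - u / 2) * ((k - u / 2)\<^sup>2) ^ a = k ^ (2 * a + 1) * (1 - u / (2 * k)) ^ (2 * a + 1)" .
  have e: "exp (- ((k - u / 2)\<^sup>2)) = exp (- (k\<^sup>2)) * exp (k * u - u\<^sup>2 / 4)"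
    by (simp add: exp_add[symmetric] power2_diff power_divide)
  have "(k - u / 2) * pdens n a ((k - u / 2)\<^sup>2) =
     ((k - u / 2) * ((k - u / 2)\<^sup>2) ^ a) * exp (- ((k - u / 2)\<^sup>2)) * ((- k) ^ n * lq n (1 / k) u)\<^sup>2 / (fact n * fact (n + a))"
    unfolding pdens_def lagm_eq_lq[of n a u, folded k_def] by simp
  also have "((- k) ^ n * lq n (1 / k) u)\<^sup>2 = k ^ (2 * n) * (lq n (1 / k) u)\<^sup>2"
    by (simp add: power_mult_distrib flip: power_mult) (simp add: mult.commute[of n 2])
  finally show ?thesis
    unfolding p e k_def[symmetric] wnorm_def wt_def hw by (simp add: mult_ac)
qed

lemma wnorm_pos: "wnorm n a > 0"
  using kap_pos[of a] by (simp add: wnorm_def)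

lemma nn_integral_pdens_eq_wt:
  fixes I :: "real \<Rightarrow> ennreal"
  assumes [measurable]: "I \<in> borel_measurable borel"
  shows "(\<integral>\<^sup>+t. ennreal (pdens n a t) * indicator {0<..} t * I t \<partial>lborel)
     = (\<integral>\<^sup>+u. ennreal (wnorm n a * wt n (1 / kap a) u) * I ((kap a - u / 2)\<^sup>2) \<partial>lborel)"
proof -
  have "(\<integral>\<^sup>+t. ennreal (pdens n a t) * indicator {0<..} t * I t \<partial>lborel) =
     (\<integral>\<^sup>+t. indicator {0<..} t * (ennreal (pdens n a t) * I t) \<partial>lborel)"
    by (simp add: mult_ac)
  also have "\<dots> = (\<integral>\<^sup>+s. ennreal (2 * s) * indicator {0<..} s * (ennreal (pdens n a (s\<^sup>2)) * I (s\<^sup>2)) \<partial>lborel)"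
    by (rule nn_integral_square_substitution) measurable
  also have "\<dots> = ennreal \<bar>- 1 / 2\<bar> * (\<integral>\<^sup>+u. ennreal (2 * (kap a + (- 1/2) * u)) * indicator {0<..} (kap a + (- 1/2) * u) *
       (ennreal (pdens n a ((kap a + (- 1/2) * u)\<^sup>2)) * I ((kap a + (- 1/2) * u)\<^sup>2)) \<partial>lborel)"
    by (rule nn_integral_real_affine) auto
  also have "\<dots> = (\<integral>\<^sup>+u. ennreal (1 / 2) * (ennreal (2 * (kap a + (- 1/2) * u)) * indicator {0<..} (kap a + (- 1/2) * u) *
       (ennreal (pdens n a ((kap a + (- 1/2) * u)\<^sup>2)) * I ((kap a + (- 1/2) * u)\<^sup>2))) \<partial>lborel)"
    by (subst nn_integral_cmult) auto
  also have "\<dots> = (\<integral>\<^sup>+u. ennreal (wnorm n a * wt n (1 / kap a) u) * I ((kap a - u / 2)\<^sup>2) \<partial>lborel)"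
  proof (rule nn_integral_cong)
    fix u
    have s: "kap a + (- 1/2) * u = kap a - u / 2" by simp
    show "ennreal (1 / 2) * (ennreal (2 * (kap a + (- 1/2) * u)) * indicator {0<..} (kap a + (- 1/2) * u) *
       (ennreal (pdens n a ((kap a + (- 1/2) * u)\<^sup>2)) * I ((kap a + (- 1/2) * u)\<^sup>2)))
       = ennreal (wnorm n a * wt n (1 / kap a) u) * I ((kap a - u / 2)\<^sup>2)"
    proof (cases "u < 2 * kap a")
      case True
      have "ennreal (1 / 2) * (ennreal (2 * (kap a - u / 2)) * ennreal (pdens n a ((kap a - u / 2)\<^sup>2)))
         = ennreal (wnorm n a * wt n (1 / kap a) u)"
      proof -
        have "(kap a - u / 2) * pdens n a ((kap a - u / 2)\<^sup>2) = (1 / 2) * ((2 * (kap a - u / 2)) * pdens n a ((kap a - u / 2)\<^sup>2))"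
          by simp
        moreover have "ennreal \<dots> = ennreal (1 / 2) * (ennreal (2 * (kap a - u / 2)) * ennreal (pdens n a ((kap a - u / 2)\<^sup>2)))"
        proof -
          have nn: "0 \<le> (1 / 2 :: real)" "0 \<le> 2 * (kap a - u / 2)" using True by auto
          show ?thesis by (simp only: ennreal_mult'[OF nn(1)] ennreal_mult'[OF nn(2)])
        qed
        ultimately show ?thesis unfolding pdens_eq_wt[OF True, symmetric] by (simp only:)
      qed
      note h = this
      have ind: "indicator {0<..} (kap a - u / 2) = (1 :: ennreal)" using True by simp
      show ?thesis unfolding s ind h[symmetric] by (simp only: mult_ac mult_1_right mult_1_left)
    next
      case False
      then have "wt n (1 / kap a) u = 0" using kap_pos[of a] by (simp add: wt_def hw_def field_simps)
      then show ?thesis unfolding s using False by simp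
    qed
  qed
  finally show ?thesis .
qed

lemma AE_indicator_Ioi_0:
  "AE t::real in lborel. ennreal (f t) * indicator ({0..} \<inter> A) t = ennreal (f t) * indicator {0<..} t * indicator A t"
proof -
  have "AE t::real in lborel. t \<noteq> 0" by (rule AE_lborel_singleton)
  then show ?thesis by eventually_elim (auto split: split_indicator)
qed

text \<open>With |z| = \<open>kap a - u / 2\<close> the disc becomes the ray u > 2 *
  (\<open>kap a\<close> - r), and the eigenvalue becomes the fraction of the mass of
  \<open>wt\<close> on that ray.\<close>

lemma
  shows integrable_wt: "integrable lborel (wt n (1 / kap a))"
    and integral_wt: "wnorm n a * (\<integral>u. wt n (1 / kap a) u \<partial>lborel) = 1"
    and lam_eq_wt: "r \<ge> 0 \<Longrightarrow> lam n (n + a) r = (\<integral>u. indicator {2 * (kap a - r)<..} u * wt n (1 / kap a) u \<partial>lborel)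
        / (\<integral>u. wt n (1 / kap a) u \<partial>lborel)"
proof -
  have tot: "(\<integral>\<^sup>+u. ennreal (wnorm n a * wt n (1 / kap a) u) \<partial>lborel) = 1"
  proof -
    have "(\<integral>\<^sup>+t. ennreal (pdens n a t) * indicator {0..} t \<partial>lborel) = (\<integral>\<^sup>+t. ennreal (pdens n a t) * indicator {0<..} t * 1 \<partial>lborel)"
      by (rule nn_integral_cong_AE) (use AE_indicator_Ioi_0[of "pdens n a" UNIV] in simp)
    then show ?thesis using nn_integral_pdens[of n a] nn_integral_pdens_eq_wt[of "\<lambda>_. 1" n a] by simp
  qed
  have i: "integrable lborel (\<lambda>u. wnorm n a * wt n (1 / kap a) u)"
    using tot wt_nonneg wnorm_pos[of n a] by (intro integrableI_nonneg) (auto simp: less_imp_le)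
  then show iw: "integrable lborel (wt n (1 / kap a))"
    using wnorm_pos[of n a] by simp
  have "ennreal (\<integral>u. wnorm n a * wt n (1 / kap a) u \<partial>lborel) = 1"
    using tot nn_integral_eq_integral[OF i] wt_nonneg wnorm_pos[of n a] by (simp add: less_imp_le)
  then show 1: "wnorm n a * (\<integral>u. wt n (1 / kap a) u \<partial>lborel) = 1"
    by simp
  assume r: "r \<ge> 0"
  have "ennreal (lam n (n + a) r) = (\<integral>\<^sup>+t. ennreal (pdens n a t) * indicator {0..<r\<^sup>2} t \<partial>lborel)"
    by (rule lam_eq_nn_integral[OF r])
  also have "{0..<r\<^sup>2} = {0..} \<inter> {..<r\<^sup>2}" by auto
  also have "(\<integral>\<^sup>+t. ennreal (pdens n a t) * indicator ({0..} \<inter> {..<r\<^sup>2}) t \<partial>lborel)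
     = (\<integral>\<^sup>+t. ennreal (pdens n a t) * indicator {0<..} t * indicator {..<r\<^sup>2} t \<partial>lborel)"
    by (rule nn_integral_cong_AE[OF AE_indicator_Ioi_0])
  also have "\<dots> = (\<integral>\<^sup>+u. ennreal (wnorm n a * wt n (1 / kap a) u) * indicator {..<r\<^sup>2} ((kap a - u / 2)\<^sup>2) \<partial>lborel)"
    by (rule nn_integral_pdens_eq_wt) measurable
  also have "\<dots> = (\<integral>\<^sup>+u. ennreal (wnorm n a * (indicator {2 * (kap a - r)<..} u * wt n (1 / kap a) u)) \<partial>lborel)"
  proof (rule nn_integral_cong)
    fix u
    show "ennreal (wnorm n a * wt n (1 / kap a) u) * indicator {..<r\<^sup>2} ((kap a - u / 2)\<^sup>2) =
      ennreal (wnorm n a * (indicator {2 * (kap a - r)<..} u * wt n (1 / kap a) u))"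
    proof (cases "u < 2 * kap a")
      case True
      then have "(kap a - u / 2)\<^sup>2 < r\<^sup>2 \<longleftrightarrow> kap a - u / 2 < r"
        using r by (simp add: power2_less_iff_less_sqrt)
      then show ?thesis by (auto split: split_indicator)
    next
      case False
      then have "wt n (1 / kap a) u = 0" using kap_pos[of a] by (simp add: wt_def hw_def field_simps)
      then show ?thesis by simp
    qed
  qed
  also have "\<dots> = ennreal (\<integral>u. wnorm n a * (indicator {2 * (kap a - r)<..} u * wt n (1 / kap a) u) \<partial>lborel)"
    using wnorm_pos[of n a] wt_nonneg integrable_mult_indicator[OF _ iw, of "{2 * (kap a - r)<..}"]
    by (intro nn_integral_eq_integral) (auto simp: less_imp_le)
  finally have "lam n (n + a) r = wnorm n a * (\<integral>u. indicator {2 * (kap a - r)<..} u * wt n (1 / kap a) u \<partial>lborel)"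
    using lam_nonneg[of n "n + a" r] wnorm_pos[of n a] wt_nonneg
    by (subst (asm) ennreal_inj) (auto intro!: mult_nonneg_nonneg Bochner_Integration.integral_nonneg)
  moreover have "(\<integral>u. wt n (1 / kap a) u \<partial>lborel) = 1 / wnorm n a"
    using 1 wnorm_pos[of n a] by (simp add: field_simps)
  ultimately show "lam n (n + a) r = (\<integral>u. indicator {2 * (kap a - r)<..} u * wt n (1 / kap a) u \<partial>lborel)
        / (\<integral>u. wt n (1 / kap a) u \<partial>lborel)"
    by (simp add: mult.commute)
qed

section \<open>The density near the edge\<close>

lemma lq_0: "lq n 0 u = He n u"
  by (induction n rule: induct_nat_012) auto

lemma lq_parity: "lq n (- e) (- u) = (- 1) ^ n * lq n e u"
proof (induction n rule: induct_nat_012)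
  case (ge2 n)
  show ?case unfolding lq.simps ge2 by (simp add: algebra_simps)
qed auto

text \<open>Growth slower than every Gaussian, uniformly in the parameter in \<open>[0, 2]\<close>: polynomials in
  both variables satisfy this, and no degrees need to be tracked.\<close>

definition subgauss :: "(real \<Rightarrow> real \<Rightarrow> real) \<Rightarrow> bool" where
  "subgauss X \<longleftrightarrow> (\<forall>\<eta>>0. \<exists>C\<ge>0. \<forall>e u. 0 \<le> e \<longrightarrow> e \<le> 2 \<longrightarrow> \<bar>X e u\<bar> \<le> C * exp (\<eta> * u\<^sup>2))"

lemma subgaussD:
  assumes "subgauss X" "\<eta> > 0"
  obtains C where "C \<ge> 0" "\<And>e u. 0 \<le> e \<Longrightarrow> e \<le> 2 \<Longrightarrow> \<bar>X e u\<bar> \<le> C * exp (\<eta> * u\<^sup>2)"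
  using assms unfolding subgauss_def by blast

lemma subgauss_const: "subgauss (\<lambda>e u. c)"
  unfolding subgauss_def
proof (intro allI impI exI[of _ "\<bar>c\<bar>"] conjI)
  fix \<eta> e u :: real assume "\<eta> > 0"
  then have "1 \<le> exp (\<eta> * u\<^sup>2)" by simp
  from mult_left_mono[OF this, of "\<bar>c\<bar>"] show "\<bar>c\<bar> \<le> \<bar>c\<bar> * exp (\<eta> * u\<^sup>2)" by simp
qed simp

lemma subgauss_param: "subgauss (\<lambda>e u. e)"
  unfolding subgauss_def
proof (intro allI impI exI[of _ 2] conjI)
  fix \<eta> e u :: real assume "\<eta> > 0" "0 \<le> e" "e \<le> 2"
  moreover from this have "1 \<le> exp (\<eta> * u\<^sup>2)" by simp
  ultimately show "\<bar>e\<bar> \<le> 2 * exp (\<eta> * u\<^sup>2)" by linarith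
qed simp

lemma subgauss_id: "subgauss (\<lambda>e u. u)"
  unfolding subgauss_def
proof (intro allI impI)
  fix \<eta> :: real assume n: "\<eta> > 0"
  show "\<exists>C\<ge>0. \<forall>e u. 0 \<le> e \<longrightarrow> e \<le> 2 \<longrightarrow> \<bar>u\<bar> \<le> C * exp (\<eta> * u\<^sup>2)"
  proof (intro allI impI exI[of _ "1 + 1 / \<eta>"] conjI)
    fix e u :: real
    have "\<bar>u\<bar> \<le> 1 + u\<^sup>2"
    proof -
      have "0 \<le> (\<bar>u\<bar> - 1/2)\<^sup>2" by simp
      then have "\<bar>u\<bar> \<le> u\<^sup>2 + (1 / 2)\<^sup>2" by (simp add: power2_diff)
      moreover have "(1 / 2 :: real)\<^sup>2 \<le> 1" by (simp add: power2_eq_square)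
      ultimately show ?thesis by linarith
    qed
    also have "\<dots> \<le> (1 + 1 / \<eta>) * (1 + \<eta> * u\<^sup>2)"
      using n by (simp add: field_simps)
    also have "\<dots> \<le> (1 + 1 / \<eta>) * exp (\<eta> * u\<^sup>2)"
      using n by (intro mult_left_mono exp_ge_add_one_self) auto
    finally show "\<bar>u\<bar> \<le> (1 + 1 / \<eta>) * exp (\<eta> * u\<^sup>2)" .
  qed (use n in auto)
qed

lemma subgauss_add:
  assumes "subgauss X" "subgauss Y"
  shows "subgauss (\<lambda>e u. X e u + Y e u)"
  unfolding subgauss_def
proof (intro allI impI)
  fix \<eta> :: real assume n: "\<eta> > 0"
  obtain C where C: "C \<ge> 0" "\<And>e u. 0 \<le> e \<Longrightarrow> e \<le> 2 \<Longrightarrow> \<bar>X e u\<bar> \<le> C * exp (\<eta> * u\<^sup>2)"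
    using subgaussD[OF assms(1) n] by blast
  obtain D where D: "D \<ge> 0" "\<And>e u. 0 \<le> e \<Longrightarrow> e \<le> 2 \<Longrightarrow> \<bar>Y e u\<bar> \<le> D * exp (\<eta> * u\<^sup>2)"
    using subgaussD[OF assms(2) n] by blast
  show "\<exists>C\<ge>0. \<forall>e u. 0 \<le> e \<longrightarrow> e \<le> 2 \<longrightarrow> \<bar>X e u + Y e u\<bar> \<le> C * exp (\<eta> * u\<^sup>2)"
  proof (intro exI[of _ "C + D"] conjI allI impI)
    fix e u :: real assume "0 \<le> e" "e \<le> 2"
    with C(2)[of e u] D(2)[of e u] show "\<bar>X e u + Y e u\<bar> \<le> (C + D) * exp (\<eta> * u\<^sup>2)"
      by (simp add: distrib_right)
  qed (use C D in auto)
qed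

lemma subgauss_mult:
  assumes "subgauss X" "subgauss Y"
  shows "subgauss (\<lambda>e u. X e u * Y e u)"
  unfolding subgauss_def
proof (intro allI impI)
  fix \<eta> :: real assume "\<eta> > 0"
  then have n: "\<eta> / 2 > 0" by simp
  obtain C where C: "C \<ge> 0" "\<And>e u. 0 \<le> e \<Longrightarrow> e \<le> 2 \<Longrightarrow> \<bar>X e u\<bar> \<le> C * exp (\<eta> / 2 * u\<^sup>2)"
    using subgaussD[OF assms(1) n] by blast
  obtain D where D: "D \<ge> 0" "\<And>e u. 0 \<le> e \<Longrightarrow> e \<le> 2 \<Longrightarrow> \<bar>Y e u\<bar> \<le> D * exp (\<eta> / 2 * u\<^sup>2)"
    using subgaussD[OF assms(2) n] by blast
  show "\<exists>C\<ge>0. \<forall>e u. 0 \<le> e \<longrightarrow> e \<le> 2 \<longrightarrow> \<bar>X e u * Y e u\<bar> \<le> C * exp (\<eta> * u\<^sup>2)"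
  proof (intro exI[of _ "C * D"] conjI allI impI)
    fix e u :: real assume e: "0 \<le> e" "e \<le> 2"
    have "\<bar>X e u\<bar> * \<bar>Y e u\<bar> \<le> (C * exp (\<eta> / 2 * u\<^sup>2)) * (D * exp (\<eta> / 2 * u\<^sup>2))"
      using C D e by (intro mult_mono) auto
    also have "\<dots> = C * D * (exp (\<eta> / 2 * u\<^sup>2) * exp (\<eta> / 2 * u\<^sup>2))" by (simp add: mult_ac)
    also have "exp (\<eta> / 2 * u\<^sup>2) * exp (\<eta> / 2 * u\<^sup>2) = exp (\<eta> * u\<^sup>2)"
      by (simp add: exp_add[symmetric])
    finally show "\<bar>X e u * Y e u\<bar> \<le> C * D * exp (\<eta> * u\<^sup>2)" by (simp add: abs_mult)
  qed (use C D in auto)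
qed

lemma subgauss_minus: "subgauss X \<Longrightarrow> subgauss (\<lambda>e u. - X e u)"
  by (simp add: subgauss_def)

lemma subgauss_diff: "subgauss X \<Longrightarrow> subgauss Y \<Longrightarrow> subgauss (\<lambda>e u. X e u - Y e u)"
  using subgauss_add[OF _ subgauss_minus, of X Y] by simp

lemma subgauss_power: "subgauss X \<Longrightarrow> subgauss (\<lambda>e u. X e u ^ n)"
  by (induction n) (auto intro: subgauss_const subgauss_mult)

lemma subgauss_abs: "subgauss X \<Longrightarrow> subgauss (\<lambda>e u. \<bar>X e u\<bar>)"
  by (simp add: subgauss_def)

lemma subgauss_divide: "subgauss X \<Longrightarrow> subgauss (\<lambda>e u. X e u / c)"
  using subgauss_mult[OF _ subgauss_const[of "1 / c"], of X] by simp

lemmas subgauss_intros = subgauss_const subgauss_param subgauss_id subgauss_add subgauss_mult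
  subgauss_diff subgauss_power subgauss_divide subgauss_abs

lemma subgauss_lq: "subgauss (lq n)"
proof -
  have "subgauss (\<lambda>e u. lq n e u)"
    by (induction n rule: induct_nat_012) (auto intro!: subgauss_intros)
  then show ?thesis by simp
qed

lemma subgauss_lq_0: "subgauss (\<lambda>e u. lq n 0 u)"
  using subgauss_lq[of n] unfolding subgauss_def by (meson order_refl zero_le_numeral)

text \<open>D is the divided difference in e, again of polynomial growth. It supplies the Lipschitz
  bound in e that \<open>wt_diff_le\<close> needs at a subgaussian cost in u.\<close>

lemma lq_divided_difference:
  "\<exists>D. subgauss D \<and> (\<forall>e u. lq n e u = lq n 0 u + e * D e u)"
proof (induction n rule: induct_nat_012)
  case 0
  show ?case by (intro exI[of _ "\<lambda>_ _. 0"]) (auto intro: subgauss_const)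
next
  case 1
  show ?case by (intro exI[of _ "\<lambda>_ u. 1/2 - u\<^sup>2 / 4"]) (auto intro!: subgauss_intros)
next
  case (ge2 n)
  obtain D0 where D0: "subgauss D0" "\<And>e u. lq n e u = lq n 0 u + e * D0 e u" using ge2(1) by blast
  obtain D1 where D1: "subgauss D1" "\<And>e u. lq (Suc n) e u = lq (Suc n) 0 u + e * D1 e u" using ge2(2) by blast
  \<comment> \<open>The recursion at e minus the recursion at 0, divided by e.\<close>
  define D where "D e u = u * D1 e u + (2 * real (Suc n) + 1/2 - u\<^sup>2 / 4) * lq (Suc n) e u
      - real (Suc n) * D0 e u - real (Suc n) * (e * (real n + 1/2) * lq n e u)" for e u
  have "subgauss (\<lambda>e u. D e u)"
    unfolding D_def by (intro subgauss_intros D0 D1 subgauss_lq)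
  moreover have "lq (Suc (Suc n)) e u = lq (Suc (Suc n)) 0 u + e * D e u" for e u
  proof -
    have a: "u * lq (Suc n) e u = u * lq (Suc n) 0 u + e * (u * D1 e u)"
      by (subst D1(2)) (simp add: algebra_simps)
    have b: "real (Suc n) * lq n e u = real (Suc n) * lq n 0 u + e * (real (Suc n) * D0 e u)"
      by (subst D0(2)) (simp add: algebra_simps)
    have "lq (Suc (Suc n)) e u = u * lq (Suc n) e u - real (Suc n) * lq n e u + e * ((2 * real (Suc n) + 1/2 - u\<^sup>2 / 4) * lq (Suc n) e u)
       - e * (real (Suc n) * (e * (real n + 1/2) * lq n e u))"
      unfolding lq.simps by (simp add: algebra_simps power2_eq_square)
    also have "\<dots> = (u * lq (Suc n) 0 u - real (Suc n) * lq n 0 u) + e * D e u"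
      unfolding a b D_def by (simp add: algebra_simps)
    also have "u * lq (Suc n) 0 u - real (Suc n) * lq n 0 u = lq (Suc (Suc n)) 0 u" by simp
    finally show ?thesis .
  qed
  ultimately show ?case by auto
qed

text \<open>The condition \<open>x \<le> max 0 v\<close> keeps the intermediate point nonpositive
  when v is negative, so that 1 - x stays away from 0 even for v far below 0, as
  \<open>ln_taylor2_bound\<close> requires.\<close>

lemma MVT_from_0:
  fixes F :: "real \<Rightarrow> real"
  assumes "\<And>x. \<bar>x\<bar> \<le> \<bar>v\<bar> \<Longrightarrow> x \<le> max 0 v \<Longrightarrow> (F has_real_derivative F' x) (at x)" "F 0 = 0"
  obtains x where "\<bar>x\<bar> \<le> \<bar>v\<bar>" "x \<le> max 0 v" "F v = v * F' x"
proof -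
  consider "v = 0" | "v > 0" | "v < 0" by linarith
  then have "\<exists>x. \<bar>x\<bar> \<le> \<bar>v\<bar> \<and> x \<le> max 0 v \<and> F v = v * F' x"
  proof cases
    case 1
    then show ?thesis using assms(2) by auto
  next
    case 2
    have "\<exists>z. 0 < z \<and> z < v \<and> F v - F 0 = (v - 0) * F' z"
      by (rule MVT2) (use 2 assms(1) in auto)
    then obtain z where "0 < z" "z < v" "F v = v * F' z" using assms(2) by auto
    then show ?thesis by (intro exI[of _ z]) auto
  next
    case 3
    have "\<exists>z. v < z \<and> z < 0 \<and> F 0 - F v = (0 - v) * F' z"
      by (rule MVT2) (use 3 assms(1) in auto)
    then obtain z where "v < z" "z < 0" "F v = v * F' z" using assms(2) by auto
    then show ?thesis by (intro exI[of _ z]) auto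
  qed
  then show ?thesis using that by blast
qed

lemma ln_taylor2_bound:
  fixes v :: real
  assumes "v \<le> 1/2"
  shows "\<bar>ln (1 - v) + v + v\<^sup>2 / 2\<bar> \<le> 2 * \<bar>v\<bar> ^ 3"
proof -
  define F where "F x = ln (1 - x) + x + x\<^sup>2 / 2" for x :: real
  obtain x where x: "\<bar>x\<bar> \<le> \<bar>v\<bar>" "x \<le> max 0 v" "F v = v * (- (x\<^sup>2) / (1 - x))"
  proof (rule MVT_from_0[of v F "\<lambda>x. - (x\<^sup>2) / (1 - x)"])
    fix x :: real assume "x \<le> max 0 v"
    with assms have "x \<le> 1/2" by linarith
    then show "(F has_real_derivative - (x\<^sup>2) / (1 - x)) (at x)"
      unfolding F_def by (auto intro!: derivative_eq_intros simp: field_simps power2_eq_square)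
  qed (auto simp: F_def)
  have x2: "x \<le> 1/2" using x(2) assms by linarith
  have "\<bar>- (x\<^sup>2) / (1 - x)\<bar> \<le> 2 * x\<^sup>2"
  proof -
    have "\<bar>- (x\<^sup>2) / (1 - x)\<bar> = x\<^sup>2 / (1 - x)" using x2 by (simp add: abs_divide)
    also have "\<dots> \<le> x\<^sup>2 / (1/2)" using x2 by (intro divide_left_mono) auto
    finally show ?thesis by simp
  qed
  also have "x\<^sup>2 \<le> v\<^sup>2" using x(1) by (simp add: abs_le_square_iff)
  finally have "\<bar>- (x\<^sup>2) / (1 - x)\<bar> \<le> 2 * v\<^sup>2" by simp
  then have "\<bar>v\<bar> * \<bar>- (x\<^sup>2) / (1 - x)\<bar> \<le> \<bar>v\<bar> * (2 * v\<^sup>2)"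
    by (intro mult_left_mono) auto
  also have "\<dots> = 2 * \<bar>v\<bar> ^ 3" by (simp add: power3_eq_cube power2_eq_square)
  finally show ?thesis using x(3) by (simp add: F_def[symmetric] abs_mult)
qed

lemma ln_taylor3_bound:
  fixes v :: real
  assumes "\<bar>v\<bar> \<le> 1/2"
  shows "\<bar>ln (1 - v) + v + v\<^sup>2 / 2 + v ^ 3 / 3\<bar> \<le> 2 * v ^ 4"
proof -
  define F where "F x = ln (1 - x) + x + x\<^sup>2 / 2 + x ^ 3 / 3" for x :: real
  obtain x where x: "\<bar>x\<bar> \<le> \<bar>v\<bar>" "F v = v * (- (x ^ 3) / (1 - x))"
  proof (rule MVT_from_0[of v F "\<lambda>x. - (x ^ 3) / (1 - x)"])
    fix x :: real assume "\<bar>x\<bar> \<le> \<bar>v\<bar>"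
    with assms have "x \<le> 1/2" by linarith
    then show "(F has_real_derivative - (x ^ 3) / (1 - x)) (at x)"
      unfolding F_def by (auto intro!: derivative_eq_intros simp: field_simps power2_eq_square power3_eq_cube)
  qed (auto simp: F_def)
  have x2: "1 - x \<ge> 1/2" using x(1) assms by linarith
  have "\<bar>- (x ^ 3) / (1 - x)\<bar> = \<bar>x\<bar> ^ 3 / (1 - x)"
    using x2 by (simp add: abs_divide power_abs)
  also have "\<dots> \<le> \<bar>x\<bar> ^ 3 / (1/2)"
    using x2 by (intro divide_left_mono) auto
  also have "\<dots> \<le> 2 * \<bar>v\<bar> ^ 3" using power_mono[OF x(1), of 3] by simp
  finally have "\<bar>v\<bar> * \<bar>- (x ^ 3) / (1 - x)\<bar> \<le> \<bar>v\<bar> * (2 * \<bar>v\<bar> ^ 3)"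
    by (intro mult_left_mono) auto
  also have "\<dots> = 2 * \<bar>v\<bar> ^ 4" by (simp add: eval_nat_numeral)
  also have "\<bar>v\<bar> ^ 4 = v ^ 4" by simp
  finally show ?thesis using x(2) by (simp add: F_def[symmetric] abs_mult)
qed

text \<open>From ln (1 - v) <= - v only, uniformly in e. Half of the limiting exponent is lost here,
  which is the source of the rate 1/4 in the error bounds below.\<close>

lemma hw_le: "hw e u \<le> exp (- (u\<^sup>2) / 4)" if "e \<ge> 0"
proof (cases "e > 0 \<and> e * u < 2")
  case True
  then have e: "e > 0" "e * u < 2" by auto
  have "ln (1 + (- (e * u / 2))) \<le> - (e * u / 2)"
    using e by (intro ln_add_one_self_le_self2) auto
  then have "2 / e\<^sup>2 * ln (1 - e * u / 2) \<le> 2 / e\<^sup>2 * (- (e * u / 2))"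
    using e by (intro mult_left_mono) auto
  also have "\<dots> = - (u / e)" using e by (simp add: power2_eq_square)
  finally show ?thesis using e by (simp add: hw_def)
qed (use that in \<open>auto simp: hw_def\<close>)

lemma abs_exp_diff_le: "\<bar>exp a - exp b\<bar> \<le> \<bar>a - b\<bar> * exp (max a b)" for a b :: real
proof -
  have *: "exp x - exp y \<le> (x - y) * exp x" if "y \<le> x" for x y :: real
  proof -
    have "1 + (y - x) \<le> exp (y - x)" by (rule exp_ge_add_one_self)
    then have "exp x * (1 + (y - x)) \<le> exp x * exp (y - x)" by simp
    also have "\<dots> = exp y" by (simp add: exp_add[symmetric])
    finally show ?thesis by (simp add: algebra_simps)
  qed
  show ?thesis using *[of a b] *[of b a] by (cases "a \<le> b") (auto simp: max_def)
qed

text \<open>The cube comes from the Taylor remainder of the logarithm when e * u <= 1. The summand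
  |u| covers e * u > 1, where e * |u| >= 1 alone outweighs the trivial bound.\<close>

lemma hw_diff_le:
  assumes e: "e > 0"
  shows "\<bar>hw e u - hw 0 u\<bar> \<le> e * (\<bar>u\<bar> + \<bar>u\<bar> ^ 3) * exp (- (u\<^sup>2) / 4)"
proof (cases "e * u \<le> 1")
  case True
  define v where "v = e * u / 2"
  define A where "A = 2 / e\<^sup>2 * ln (1 - e * u / 2) + u / e - u\<^sup>2 / 4"
  have v: "v \<le> 1/2" using True by (simp add: v_def)
  have AB: "A - (- (u\<^sup>2) / 2) = 2 / e\<^sup>2 * (ln (1 - v) + v + v\<^sup>2 / 2)"
    using e by (simp add: A_def v_def field_simps power2_eq_square)
  have "\<bar>A - (- (u\<^sup>2) / 2)\<bar> = 2 / e\<^sup>2 * \<bar>ln (1 - v) + v + v\<^sup>2 / 2\<bar>"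
    unfolding AB abs_mult by simp
  also have "\<dots> \<le> 2 / e\<^sup>2 * (2 * \<bar>v\<bar> ^ 3)"
    using v by (intro mult_left_mono ln_taylor2_bound) auto
  also have "\<dots> = e * \<bar>u\<bar> ^ 3 / 2"
    using e by (simp add: v_def abs_mult field_simps eval_nat_numeral)
  also have "\<dots> \<le> e * (\<bar>u\<bar> + \<bar>u\<bar> ^ 3)" using e by (simp add: field_simps)
  finally have d: "\<bar>A - (- (u\<^sup>2) / 2)\<bar> \<le> e * (\<bar>u\<bar> + \<bar>u\<bar> ^ 3)" .
  have hA: "hw e u = exp A" using e True by (simp add: hw_def A_def)
  then have A: "A \<le> - (u\<^sup>2) / 4" using hw_le[of e u] e by simp
  have "\<bar>hw e u - hw 0 u\<bar> \<le> \<bar>A - (- (u\<^sup>2) / 2)\<bar> * exp (max A (- (u\<^sup>2) / 2))"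
    unfolding hA by (simp add: hw_def) (rule order_trans[OF abs_exp_diff_le], simp)
  also have "\<dots> \<le> e * (\<bar>u\<bar> + \<bar>u\<bar> ^ 3) * exp (- (u\<^sup>2) / 4)"
    using A e by (intro mult_mono d) auto
  finally show ?thesis .
next
  case False
  have "\<bar>hw e u - hw 0 u\<bar> \<le> exp (- (u\<^sup>2) / 4)"
    using hw_le[of e u] hw_le[of 0 u] hw_nonneg[of e u] hw_nonneg[of 0 u] e by linarith
  also have "\<dots> \<le> (e * (\<bar>u\<bar> + \<bar>u\<bar> ^ 3)) * exp (- (u\<^sup>2) / 4)"
  proof -
    have "e * u \<le> e * \<bar>u\<bar>" using e by (intro mult_left_mono) auto
    then have "1 \<le> e * \<bar>u\<bar>" using False by linarith
    also have "\<dots> \<le> e * (\<bar>u\<bar> + \<bar>u\<bar> ^ 3)" using e by simp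
    finally show ?thesis by simp
  qed
  finally show ?thesis .
qed

text \<open>Product rule: the weight changes by \<open>hw_diff_le\<close>, the polynomial by its
  divided difference. The loss \<eta> in the rate absorbs every polynomial factor.\<close>

lemma wt_diff_le:
  assumes "\<eta> > 0"
  obtains C where "C \<ge> 0" "\<And>e u. 0 < e \<Longrightarrow> e \<le> 2 \<Longrightarrow> \<bar>wt n e u - wt n 0 u\<bar> \<le> e * (C * exp (- ((1/4 - \<eta>) * u\<^sup>2)))"
proof -
  obtain D where D: "subgauss D" "\<And>e u. lq n e u = lq n 0 u + e * D e u"
    using lq_divided_difference by metis
  define X where "X e u = (\<bar>u\<bar> + \<bar>u\<bar> ^ 3) * (lq n e u)\<^sup>2 + \<bar>D e u * (lq n e u + lq n 0 u)\<bar>" for e u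
  have "subgauss (\<lambda>e u. X e u)"
    unfolding X_def by (intro subgauss_intros D subgauss_lq subgauss_lq_0)
  then obtain C where C: "C \<ge> 0" "\<And>e u. 0 \<le> e \<Longrightarrow> e \<le> 2 \<Longrightarrow> \<bar>X e u\<bar> \<le> C * exp (\<eta> * u\<^sup>2)"
    using subgaussD[OF _ assms] by blast
  have "\<bar>wt n e u - wt n 0 u\<bar> \<le> e * (C * exp (- ((1/4 - \<eta>) * u\<^sup>2)))" if e: "0 < e" "e \<le> 2" for e u
  proof -
    have sq: "(lq n e u)\<^sup>2 - (lq n 0 u)\<^sup>2 = e * (D e u * (lq n e u + lq n 0 u))"
    proof -
      have ed: "e * D e u = lq n e u - lq n 0 u" using D(2)[of e u] by simp
      show ?thesis unfolding mult.assoc[symmetric] ed by (simp add: power2_eq_square algebra_simps)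
    qed
    have "wt n e u - wt n 0 u = (hw e u - hw 0 u) * (lq n e u)\<^sup>2 + hw 0 u * ((lq n e u)\<^sup>2 - (lq n 0 u)\<^sup>2)"
      by (simp add: wt_def algebra_simps)
    then have "\<bar>wt n e u - wt n 0 u\<bar> \<le> \<bar>hw e u - hw 0 u\<bar> * (lq n e u)\<^sup>2 + hw 0 u * (e * \<bar>D e u * (lq n e u + lq n 0 u)\<bar>)"
      unfolding sq using abs_triangle_ineq[of "(hw e u - hw 0 u) * (lq n e u)\<^sup>2" "hw 0 u * (e * (D e u * (lq n e u + lq n 0 u)))"] e
      by (simp add: abs_mult hw_nonneg)
    also have "\<dots> \<le> (e * (\<bar>u\<bar> + \<bar>u\<bar> ^ 3) * exp (- (u\<^sup>2) / 4)) * (lq n e u)\<^sup>2 + exp (- (u\<^sup>2) / 4) * (e * \<bar>D e u * (lq n e u + lq n 0 u)\<bar>)"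
      using e by (intro add_mono mult_right_mono hw_diff_le hw_le) auto
    also have "\<dots> = e * (X e u * exp (- (u\<^sup>2) / 4))"
      by (simp add: X_def algebra_simps)
    also have "\<dots> \<le> e * ((C * exp (\<eta> * u\<^sup>2)) * exp (- (u\<^sup>2) / 4))"
      using C(2)[of e u] e by (intro mult_left_mono mult_right_mono) auto
    also have "(C * exp (\<eta> * u\<^sup>2)) * exp (- (u\<^sup>2) / 4) = C * exp (- ((1/4 - \<eta>) * u\<^sup>2))"
      by (simp add: mult.assoc exp_add[symmetric] algebra_simps)
    finally show ?thesis .
  qed
  with C(1) that show ?thesis by blast
qed

lemma wt_0_le:
  assumes "\<eta> > 0"
  obtains C where "C \<ge> 0" "\<And>u. wt n 0 u \<le> C * exp (- ((1/2 - \<eta>) * u\<^sup>2))"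
proof -
  have "subgauss (\<lambda>e u. (lq n 0 u)\<^sup>2)" by (intro subgauss_intros subgauss_lq_0)
  then obtain C where C: "C \<ge> 0" "\<And>e u. 0 \<le> (e::real) \<Longrightarrow> e \<le> 2 \<Longrightarrow> \<bar>(lq n 0 u)\<^sup>2\<bar> \<le> C * exp (\<eta> * u\<^sup>2)"
    using subgaussD[OF _ assms] by blast
  have "wt n 0 u \<le> C * exp (- ((1/2 - \<eta>) * u\<^sup>2))" for u
  proof -
    have "wt n 0 u \<le> exp (- (u\<^sup>2) / 2) * (C * exp (\<eta> * u\<^sup>2))"
      unfolding wt_def using C(2)[of 1 u] by (intro mult_mono) (auto simp: hw_def)
    also have "\<dots> = C * exp (- ((1/2 - \<eta>) * u\<^sup>2))"
      by (simp add: mult.left_commute exp_add[symmetric] algebra_simps)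
    finally show ?thesis .
  qed
  with C(1) that show ?thesis by blast
qed

lemma hw_right_derivative: "((\<lambda>e. (hw e u - hw 0 u) / e) \<longlongrightarrow> - (u ^ 3) / 12 * exp (- (u\<^sup>2) / 2)) (at_right 0)"
proof -
  \<comment> \<open>For small e > 0 the logarithm of \<open>hw e u / hw 0 u\<close> is e * h e. The
    limit - u^3 / 12 of h is the cubic Taylor term of the logarithm.\<close>
  define h where "h e = 2 / e ^ 3 * (ln (1 - e * u / 2) + e * u / 2 + (e * u / 2)\<^sup>2 / 2)" for e
  have ev: "\<forall>\<^sub>F e in at_right 0. 0 < e \<and> \<bar>e * u / 2\<bar> \<le> 1/2"
  proof -
    have "\<forall>\<^sub>F e in at_right (0::real). e \<in> {0<..<1 / (1 + \<bar>u\<bar>)}"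
      by (rule eventually_at_right_real) simp
    then show ?thesis
    proof eventually_elim
      case (elim e)
      then have "e * (1 + \<bar>u\<bar>) < 1" "e > 0" by (auto simp: field_simps)
      then show ?case by (simp add: abs_mult algebra_simps)
    qed
  qed
  have h: "(h \<longlongrightarrow> - (u ^ 3) / 12) (at_right 0)"
  proof (rule tendsto_sandwich[where f = "\<lambda>e. - (u ^ 3) / 12 - e * (u ^ 4 / 4)" and h = "\<lambda>e. - (u ^ 3) / 12 + e * (u ^ 4 / 4)"])
    have b: "\<forall>\<^sub>F e in at_right 0. \<bar>h e - - (u ^ 3) / 12\<bar> \<le> e * (u ^ 4 / 4)"
      using ev
    proof eventually_elim
      case (elim e)
      define v where "v = e * u / 2"
      have "h e - - (u ^ 3) / 12 = 2 / e ^ 3 * (ln (1 - v) + v + v\<^sup>2 / 2 + v ^ 3 / 3)"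
        using elim by (simp add: h_def v_def field_simps eval_nat_numeral)
      then have "\<bar>h e - - (u ^ 3) / 12\<bar> = 2 / e ^ 3 * \<bar>ln (1 - v) + v + v\<^sup>2 / 2 + v ^ 3 / 3\<bar>"
        using elim by (simp only: abs_mult) simp
      also have "\<dots> \<le> 2 / e ^ 3 * (2 * v ^ 4)"
        using elim by (intro mult_left_mono ln_taylor3_bound) (auto simp: v_def)
      also have "\<dots> = e * (u ^ 4 / 4)" using elim by (simp add: v_def field_simps eval_nat_numeral)
      finally show ?case .
    qed
    then show "\<forall>\<^sub>F e in at_right 0. - (u ^ 3) / 12 - e * (u ^ 4 / 4) \<le> h e"
      by eventually_elim linarith
    from b show "\<forall>\<^sub>F e in at_right 0. h e \<le> - (u ^ 3) / 12 + e * (u ^ 4 / 4)"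
      by eventually_elim linarith
    show "((\<lambda>e. - (u ^ 3) / 12 - e * (u ^ 4 / 4)) \<longlongrightarrow> - (u ^ 3) / 12) (at_right 0)"
      by (auto intro!: tendsto_eq_intros)
    show "((\<lambda>e. - (u ^ 3) / 12 + e * (u ^ 4 / 4)) \<longlongrightarrow> - (u ^ 3) / 12) (at_right 0)"
      by (auto intro!: tendsto_eq_intros)
  qed
  \<comment> \<open>The continuous extension of (exp x - 1) / x, so that points with h e = 0 need no
    separate treatment.\<close>
  define G where "G x = (if x = 0 then 1 else (exp x - 1) / x)" for x :: real
  have "((\<lambda>x::real. (exp x - 1) / x) \<longlongrightarrow> 1) (at 0)"
    using DERIV_exp[of "0::real"] by (simp add: has_field_derivative_iff)
  then have "(G \<longlongrightarrow> 1) (at 0)"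
    by (rule Lim_transform_eventually) (auto simp: G_def eventually_at_filter)
  then have "isCont G 0" by (simp add: isCont_def G_def)
  moreover have "((\<lambda>e. e * h e) \<longlongrightarrow> 0 * (- (u ^ 3) / 12)) (at_right 0)"
    by (intro tendsto_mult h) simp
  ultimately have "((\<lambda>e. G (e * h e)) \<longlongrightarrow> G 0) (at_right 0)"
    by (intro isCont_tendsto_compose[of 0 G]) simp_all
  then have "((\<lambda>e. h e * exp (- (u\<^sup>2) / 2) * G (e * h e)) \<longlongrightarrow> - (u ^ 3) / 12 * exp (- (u\<^sup>2) / 2) * 1) (at_right 0)"
    by (intro tendsto_mult h tendsto_const) (simp add: G_def)
  then have lim: "((\<lambda>e. h e * exp (- (u\<^sup>2) / 2) * G (e * h e)) \<longlongrightarrow> - (u ^ 3) / 12 * exp (- (u\<^sup>2) / 2)) (at_right 0)"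
    by simp
  have "\<forall>\<^sub>F e in at_right 0. h e * exp (- (u\<^sup>2) / 2) * G (e * h e) = (hw e u - hw 0 u) / e"
    using ev
  proof eventually_elim
    case (elim e)
    then have e: "e > 0" "e * u < 2" by (auto simp: abs_if split: if_splits)
    have "2 / e\<^sup>2 * ln (1 - e * u / 2) + u / e - u\<^sup>2 / 4 = - (u\<^sup>2) / 2 + e * h e"
      using e by (simp add: h_def field_simps eval_nat_numeral)
    then have "hw e u = exp (- (u\<^sup>2) / 2) * exp (e * h e)"
      unfolding exp_add[symmetric] using e by (simp add: hw_def)
    then have "(hw e u - hw 0 u) / e = exp (- (u\<^sup>2) / 2) * ((exp (e * h e) - 1) / e)"
      by (simp add: hw_def algebra_simps)
    also have "(exp (e * h e) - 1) / e = h e * G (e * h e)"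
      using e by (simp add: G_def)
    finally show ?case by simp
  qed
  with lim show ?thesis by (rule Lim_transform_eventually)
qed

text \<open>The coefficient of first order in e of \<open>wt n e u\<close>. The polynomial part is
  left as a \<open>deriv\<close>, because what matters later is its parity and that it is the limit
  of difference quotients.\<close>

definition wt1 :: "nat \<Rightarrow> real \<Rightarrow> real" where
  "wt1 n u = - (u ^ 3) / 12 * exp (- (u\<^sup>2) / 2) * (lq n 0 u)\<^sup>2 + exp (- (u\<^sup>2) / 2) * deriv (\<lambda>e. (lq n e u)\<^sup>2) 0"

lemma lq_differentiable: "(\<lambda>e. lq n e u) field_differentiable (at x)"
  by (induction n rule: induct_nat_012)
     (auto intro!: derivative_intros field_differentiable_mult field_differentiable_diff field_differentiable_add)

lemma lq_sq_deriv: "((\<lambda>e. (lq n e u)\<^sup>2) has_real_derivative deriv (\<lambda>e. (lq n e u)\<^sup>2) 0) (at 0)"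
proof -
  have "(\<lambda>e. lq n e u * lq n e u) field_differentiable (at 0)"
    by (intro field_differentiable_mult lq_differentiable)
  then show ?thesis by (simp add: power2_eq_square field_differentiable_derivI)
qed

lemma wt_right_derivative: "((\<lambda>e. (wt n e u - wt n 0 u) / e) \<longlongrightarrow> wt1 n u) (at_right 0)"
proof -
  define s where "s e = (lq n e u)\<^sup>2" for e
  have d: "(s has_real_derivative deriv s 0) (at 0)"
    unfolding s_def[abs_def] by (rule lq_sq_deriv)
  have "((\<lambda>e. (s e - s 0) / e) \<longlongrightarrow> deriv s 0) (at 0)"
    using d by (simp add: has_field_derivative_iff)
  then have q: "((\<lambda>e. (s e - s 0) / e) \<longlongrightarrow> deriv s 0) (at_right 0)"
    by (rule tendsto_mono[rotated]) (simp add: at_within_le_at)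
  have c: "(s \<longlongrightarrow> s 0) (at_right 0)"
    using DERIV_isCont[OF d] by (auto simp: isCont_def intro: tendsto_mono[OF at_within_le_at])
  have "((\<lambda>e. (hw e u - hw 0 u) / e * s e + hw 0 u * ((s e - s 0) / e)) \<longlongrightarrow> - (u ^ 3) / 12 * exp (- (u\<^sup>2) / 2) * s 0 + hw 0 u * deriv s 0) (at_right 0)"
    by (intro tendsto_add tendsto_mult tendsto_const hw_right_derivative q c)
  moreover have "- (u ^ 3) / 12 * exp (- (u\<^sup>2) / 2) * s 0 + hw 0 u * deriv s 0 = wt1 n u"
    by (simp add: wt1_def s_def[abs_def] hw_def)
  moreover have "(hw e u - hw 0 u) / e * s e + hw 0 u * ((s e - s 0) / e) = (wt n e u - wt n 0 u) / e" for e
    by (simp add: wt_def s_def diff_divide_distrib algebra_simps)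
  ultimately show ?thesis by simp
qed

text \<open>By \<open>lq_parity\<close> the squares satisfy (lq n e (-u))^2 = (lq n (-e) u)^2;
  differentiating at e = 0 reverses the sign. The part coming from \<open>hw\<close> is odd through
  u^3.\<close>

lemma wt1_odd: "wt1 n (- u) = - wt1 n u"
proof -
  define s where "s u e = (lq n e u)\<^sup>2" for e u
  have d: "(s u has_real_derivative deriv (s u) 0) (at 0)" for u
    unfolding s_def[abs_def] by (rule lq_sq_deriv)
  have flip: "s (- u) e = s u (- e)" for e
    using lq_parity[of n "- e" u] by (simp add: s_def power_mult_distrib flip: power_mult)
  have "((\<lambda>e. s u (- e)) has_real_derivative deriv (s u) 0 * (- 1)) (at 0)"
    by (rule DERIV_chain2[where f = "s u"]) (use d[of u] in \<open>auto intro!: derivative_eq_intros\<close>)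
  then have "(s (- u) has_real_derivative - deriv (s u) 0) (at 0)"
    unfolding flip[abs_def, symmetric] by simp
  then have "deriv (s (- u)) 0 = - deriv (s u) 0" by (rule DERIV_imp_deriv)
  moreover have "lq n 0 (- u) = (- 1) ^ n * lq n 0 u" using lq_parity[of n 0 u] by simp
  ultimately show ?thesis
    by (simp add: wt1_def s_def[abs_def] power_mult_distrib flip: power_mult)
qed

section \<open>Comparison with the Hermite profile\<close>

lemma integrable_gauss:
  assumes "c > 0"
  shows "integrable lborel (\<lambda>u::real. exp (- (c * u\<^sup>2)))"
proof -
  define s where "s = 1 / sqrt (2 * c)"
  have s: "s > 0" "2 * s\<^sup>2 = 1 / c" using assms by (auto simp: s_def power_divide)
  have "integrable lborel (\<lambda>u. sqrt (2 * pi * s\<^sup>2) * normal_density 0 s u)"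
    using s by (intro integrable_mult_right integrable_normal_density)
  moreover have "sqrt (2 * pi * s\<^sup>2) * normal_density 0 s u = exp (- (c * u\<^sup>2))" for u
    unfolding normal_density_def s(2) using s(1) by (simp add: mult.commute)
  ultimately show ?thesis by simp
qed

lemma integrable_gauss_bound:
  fixes f :: "real \<Rightarrow> real"
  assumes "c > 0" "f \<in> borel_measurable borel" "\<And>u. \<bar>f u\<bar> \<le> C * exp (- (c * u\<^sup>2))"
  shows "integrable lborel f"
proof (rule Bochner_Integration.integrable_bound)
  show "integrable lborel (\<lambda>u::real. C * exp (- (c * u\<^sup>2)))"
    using integrable_gauss[OF assms(1)] by (rule integrable_mult_right)
  show "AE u in lborel. norm (f u) \<le> norm (C * exp (- (c * u\<^sup>2)))"
    using assms(3) by (intro AE_I2) (auto intro: order_trans[OF _ abs_ge_self])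
qed (use assms(2) in simp)

text \<open>The rate p is evaluated at the boundary x, and the rate q is kept to make the integral
  converge. The set A may be a tail on either side of 0, or any set when x = 0.\<close>

lemma integral_gauss_tail_le:
  fixes f :: "real \<Rightarrow> real"
  assumes [measurable]: "f \<in> borel_measurable borel" "A \<in> sets borel" and p: "p \<ge> 0" and q: "q > 0"
    and f: "\<And>u. \<bar>f u\<bar> \<le> C * exp (- ((p + q) * u\<^sup>2))" and A: "\<And>u. u \<in> A \<Longrightarrow> \<bar>x\<bar> \<le> \<bar>u\<bar>"
  shows "\<bar>\<integral>u. indicator A u * f u \<partial>lborel\<bar> \<le> C * (\<integral>u. exp (- (q * u\<^sup>2)) \<partial>lborel) * exp (- (p * x\<^sup>2))"
proof -
  have C: "C \<ge> 0" using order_trans[OF abs_ge_zero f[of 0]] by simp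
  have b: "\<bar>indicator A u * f u\<bar> \<le> (C * exp (- (p * x\<^sup>2))) * exp (- (q * u\<^sup>2))" for u
  proof (cases "u \<in> A")
    case True
    have "p * x\<^sup>2 \<le> p * u\<^sup>2" using A[OF True] p by (intro mult_left_mono) (simp_all add: abs_le_square_iff)
    then have "exp (- ((p + q) * u\<^sup>2)) \<le> exp (- (p * x\<^sup>2)) * exp (- (q * u\<^sup>2))"
      unfolding exp_add[symmetric] by (simp add: distrib_right)
    from order_trans[OF f mult_left_mono[OF this C]] show ?thesis using True by (simp add: mult.assoc)
  qed (use C in simp)
  have "\<bar>\<integral>u. indicator A u * f u \<partial>lborel\<bar> \<le> (\<integral>u. \<bar>indicator A u * f u\<bar> \<partial>lborel)"
    by (rule integral_abs_bound)
  also have "\<dots> \<le> (\<integral>u. (C * exp (- (p * x\<^sup>2))) * exp (- (q * u\<^sup>2)) \<partial>lborel)"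
  proof (rule Bochner_Integration.integral_mono)
    show "integrable lborel (\<lambda>u. \<bar>indicator A u * f u\<bar>)"
      by (rule integrable_gauss_bound[OF q]) (use b in auto)
  qed (use b integrable_gauss[OF q] in auto)
  finally show ?thesis by (simp add: mult_ac)
qed

lemma integral_gauss: "(\<integral>u. exp (- (u\<^sup>2) / 2) \<partial>lborel) = sqrt (2 * pi)"
proof -
  have "(\<integral>u. normal_density 0 1 u \<partial>lborel) = 1" by simp
  then have "1 / sqrt (2 * pi) * (\<integral>u. exp (- (u\<^sup>2) / 2) \<partial>lborel) = 1"
    unfolding std_normal_density_def by (simp only: integral_mult_right_zero)
  then have "(\<integral>u. exp (- (u\<^sup>2) / 2) \<partial>lborel) / sqrt (2 * pi) = 1"
    by (simp only: times_divide_eq_left mult_1_left)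
  then show ?thesis by (metis divide_eq_1_iff)
qed

lemma He_Suc: "He (Suc n) u = u * He n u - real n * He (n - 1) u"
  by (cases n) auto

lemma He_deriv: "(He n has_real_derivative real n * He (n - 1) u) (at u)"
proof (induction n rule: induct_nat_012)
  case 0
  have "He 0 = (\<lambda>_. 1)" by auto
  then show ?case by simp
next
  case 1
  have "He (Suc 0) = (\<lambda>u. u)" by auto
  then show ?case by simp
next
  case (ge2 n)
  have eq: "He (Suc (Suc n)) = (\<lambda>u. u * He (Suc n) u - real (Suc n) * He n u)" by auto
  have "(He (Suc (Suc n)) has_real_derivative
      (1 * He (Suc n) u + real (Suc n) * He (Suc n - 1) u * u) - real (Suc n) * (real n * He (n - 1) u)) (at u)"
    unfolding eq by (intro DERIV_diff DERIV_mult DERIV_cmult DERIV_ident ge2)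
  moreover have "(1 * He (Suc n) u + real (Suc n) * He (Suc n - 1) u * u) - real (Suc n) * (real n * He (n - 1) u)
     = real (Suc (Suc n)) * He (Suc (Suc n) - 1) u"
  proof -
    have "(1 * He (Suc n) u + real (Suc n) * He (Suc n - 1) u * u) - real (Suc n) * (real n * He (n - 1) u)
       = He (Suc n) u + real (Suc n) * (u * He n u - real n * He (n - 1) u)"
      by (simp add: algebra_simps)
    also have "\<dots> = real (Suc (Suc n)) * He (Suc (Suc n) - 1) u"
      unfolding He_Suc[symmetric] by (simp add: algebra_simps)
    finally show ?thesis .
  qed
  ultimately show ?case by (simp only:)
qed

lemma wt_0: "wt n 0 u = exp (- (u\<^sup>2) / 2) * (He n u)\<^sup>2"
  by (simp add: wt_def hw_def lq_0)

lemma integrable_wt_0: "integrable lborel (wt n 0)"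
proof -
  obtain C where C: "C \<ge> 0" "\<And>u. wt n 0 u \<le> C * exp (- ((1/2 - 1/4) * u\<^sup>2))"
    using wt_0_le[of "1/4" n] by auto
  show ?thesis
    by (rule integrable_gauss_bound[of "1/2 - 1/4" _ C]) (use C(2) wt_nonneg in auto)
qed

text \<open>The function G in the proof has as derivative the difference of the two integrands and
  vanishes at both ends of the line.\<close>

lemma integral_wt_0_Suc: "(\<integral>u. wt (Suc n) 0 u \<partial>lborel) = real (Suc n) * (\<integral>u. wt n 0 u \<partial>lborel)"
proof -
  define G where "G u = exp (- (u\<^sup>2) / 2) * He n u * He (Suc n) u" for u
  define g where "g u = real (Suc n) * wt n 0 u - wt (Suc n) 0 u" for u
  have G': "(G has_real_derivative g u) (at u)" for u
  proof -
    have e: "((\<lambda>u. exp (- (u\<^sup>2) / 2)) has_real_derivative exp (- (u\<^sup>2) / 2) * (- u)) (at u)"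
      by (auto intro!: derivative_eq_intros)
    have "(G has_real_derivative (exp (- (u\<^sup>2) / 2) * (- u) * He n u + real n * He (n - 1) u * exp (- (u\<^sup>2) / 2)) * He (Suc n) u
       + real (Suc n) * He (Suc n - 1) u * (exp (- (u\<^sup>2) / 2) * He n u)) (at u)"
      unfolding G_def[abs_def] by (intro DERIV_mult e He_deriv)
    moreover have "exp (- (u\<^sup>2) / 2) * (- u) * He n u + real n * He (n - 1) u * exp (- (u\<^sup>2) / 2) = - (exp (- (u\<^sup>2) / 2) * He (Suc n) u)"
      unfolding He_Suc by (simp add: algebra_simps)
    ultimately have "(G has_real_derivative - (exp (- (u\<^sup>2) / 2) * He (Suc n) u) * He (Suc n) u
       + real (Suc n) * He (Suc n - 1) u * (exp (- (u\<^sup>2) / 2) * He n u)) (at u)" by (simp only:)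
    then show ?thesis by (rule DERIV_cong) (simp add: g_def wt_0 power2_eq_square algebra_simps)
  qed
  have cHe: "isCont (He m) u" for m u by (rule DERIV_isCont[OF He_deriv])
  have cg: "isCont g u" for u
    unfolding g_def wt_0 by (intro continuous_intros cHe) auto
  have gi: "integrable lborel g"
    unfolding g_def[abs_def] by (intro Bochner_Integration.integrable_diff integrable_mult_right integrable_wt_0)
  have "subgauss (\<lambda>e u. lq n 0 u * lq (Suc n) 0 u)" by (intro subgauss_intros subgauss_lq_0)
  then obtain C where C: "C \<ge> 0" "\<And>e u. 0 \<le> (e::real) \<Longrightarrow> e \<le> 2 \<Longrightarrow> \<bar>lq n 0 u * lq (Suc n) 0 u\<bar> \<le> C * exp (1/4 * u\<^sup>2)"
    using subgaussD[of _ "1/4"] by auto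
  have Gb: "\<bar>G u\<bar> \<le> C * exp (- (u\<^sup>2) / 4)" for u
  proof -
    have "\<bar>G u\<bar> = exp (- (u\<^sup>2) / 2) * \<bar>lq n 0 u * lq (Suc n) 0 u\<bar>"
      by (simp add: G_def lq_0 abs_mult del: lq.simps He.simps)
    also have "\<dots> \<le> exp (- (u\<^sup>2) / 2) * (C * exp (1/4 * u\<^sup>2))"
      using C(2)[of 0 u] by (intro mult_left_mono) auto
    also have "\<dots> = C * exp (- (u\<^sup>2) / 4)"
      by (simp add: mult.left_commute exp_add[symmetric])
    finally show ?thesis .
  qed
  have lim: "(G \<longlongrightarrow> 0) F" if F: "filterlim (\<lambda>u::real. u\<^sup>2) at_top F" for F
  proof -
    have "filterlim (\<lambda>u::real. - (u\<^sup>2) / 4) at_bot F"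
      using filterlim_tendsto_pos_mult_at_top[OF tendsto_const[of "1/4"] _ F]
      by (simp add: filterlim_uminus_at_bot)
    from filterlim_compose[OF exp_at_bot this] have "((\<lambda>u. C * exp (- (u\<^sup>2) / 4)) \<longlongrightarrow> C * 0) F"
      by (intro tendsto_mult tendsto_const)
    then have l: "((\<lambda>u. C * exp (- (u\<^sup>2) / 4)) \<longlongrightarrow> 0) F" by simp
    have "((\<lambda>u. \<bar>G u\<bar>) \<longlongrightarrow> 0) F"
    proof (rule tendsto_sandwich[OF _ _ tendsto_const l])
      show "\<forall>\<^sub>F u in F. \<bar>G u\<bar> \<le> C * exp (- (u\<^sup>2) / 4)" by (intro always_eventually allI Gb)
    qed simp
    then show ?thesis by (rule tendsto_rabs_zero_cancel)
  qed
  have top: "filterlim (\<lambda>u::real. u\<^sup>2) at_top at_top"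
    by (intro filterlim_pow_at_top filterlim_ident) simp
  have bot: "filterlim (\<lambda>u::real. u\<^sup>2) at_top at_bot"
    using filterlim_compose[OF top filterlim_uminus_at_top_at_bot] by simp
  have "(LBINT u=-\<infinity>..\<infinity>. g u) = 0 - 0"
  proof (rule interval_integral_FTC_integrable[where F = G])
    show "(G has_vector_derivative g x) (at x)" for x
      using G' by (simp add: has_real_derivative_iff_has_vector_derivative)
    show "set_integrable lborel (einterval (-\<infinity>) \<infinity>) g"
      using gi by (simp add: set_integrable_def)
    show "((G \<circ> real_of_ereal) \<longlongrightarrow> 0) (at_right (-\<infinity>))" "((G \<circ> real_of_ereal) \<longlongrightarrow> 0) (at_left \<infinity>)"
      unfolding ereal_tendsto_simps using lim[OF top] lim[OF bot] by auto
  qed (use cg in auto)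
  then have "(\<integral>u. g u \<partial>lborel) = 0"
    by (simp add: interval_lebesgue_integral_def set_lebesgue_integral_def)
  then show ?thesis
    unfolding g_def using integrable_wt_0 by simp
qed

lemma integral_wt_0: "(\<integral>u. wt n 0 u \<partial>lborel) = fact n * sqrt (2 * pi)"
proof (induction n)
  case 0
  show ?case using integral_gauss by (simp add: wt_0)
next
  case (Suc n)
  then show ?case by (simp add: integral_wt_0_Suc)
qed

lemma integral_wt_0_pos: "(\<integral>u. wt n 0 u \<partial>lborel) > 0"
  by (simp add: integral_wt_0)

lemma hsq_eq: "hsq n u = wt n 0 u / (\<integral>u. wt n 0 u \<partial>lborel)"
  unfolding integral_wt_0 by (simp add: hsq_def Herm_def wt_0 power_divide)

text \<open>Gives \<open>Phi\<close> the shape of \<open>lam_eq_wt\<close> with parameter 0, so that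
  comparing \<open>lam\<close> with \<open>Phi\<close> becomes comparing \<open>wt\<close> at 1 /
  \<open>kap a\<close> and at 0.\<close>

lemma Phi_eq: "Phi n x = (\<integral>u. indicator {x<..} u * wt n 0 u \<partial>lborel) / (\<integral>u. wt n 0 u \<partial>lborel)"
proof -
  have "Phi n x = (\<integral>u. indicator {x<..} u * wt n 0 u / (\<integral>u. wt n 0 u \<partial>lborel) \<partial>lborel)"
    unfolding Phi_def set_lebesgue_integral_def
  proof (rule integral_cong_AE)
    have "AE u in lborel. u \<noteq> x" by (rule AE_lborel_singleton)
    then show "AE u in lborel. indicat_real {x..} u *\<^sub>R hsq n u = indicat_real {x<..} u * wt n 0 u / (\<integral>u. wt n 0 u \<partial>lborel)"
      by eventually_elim (auto simp: hsq_eq split: split_indicator)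
  qed (simp_all add: hsq_eq[abs_def])
  then show ?thesis by simp
qed

text \<open>A crude bound that places 1 / \<open>kap a\<close> in the parameter range [0, 2] of
  \<open>subgauss\<close>.\<close>

lemma kap_ge: "kap a \<ge> 1/2"
proof -
  have "(1/2 :: real) = sqrt ((1/2)\<^sup>2)" by simp
  also have "\<dots> \<le> kap a" unfolding kap_def by (intro real_sqrt_le_mono) (simp add: power2_eq_square)
  finally show ?thesis .
qed

lemma inverse_kap: "0 < 1 / kap a" "1 / kap a \<le> 2"
  using kap_ge[of a] kap_pos[of a] by (auto simp: field_simps)

lemma kap_at_top: "filterlim kap at_top at_top"
  unfolding kap_def[abs_def]
  using filterlim_tendsto_add_at_top[OF tendsto_const filterlim_real_sequentially, of "1/2"]
  by (intro filterlim_compose[OF sqrt_at_top]) (simp add: add.commute)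

lemma inverse_kap_at_right: "filterlim (\<lambda>a. 1 / kap a) (at_right 0) at_top"
  using filterlim_compose[OF filterlim_inverse_at_right_top kap_at_top]
  by (simp add: inverse_eq_divide)

text \<open>A general A covers right tails, left tails and, with x = 0, the whole line for the
  normalising constants. Half of \<eta> pays for the polynomial factors, the other half for
  convergence.\<close>

lemma integral_wt_set_diff_le:
  assumes \<eta>: "\<eta> > 0"
  obtains C where "C \<ge> 0" "\<And>a A x. A \<in> sets borel \<Longrightarrow> (\<And>u. u \<in> A \<Longrightarrow> \<bar>x\<bar> \<le> \<bar>u\<bar>) \<Longrightarrow> \<eta> \<le> 1/4 \<Longrightarrow>
    \<bar>(\<integral>u. indicator A u * wt n (1 / kap a) u \<partial>lborel) - (\<integral>u. indicator A u * wt n 0 u \<partial>lborel)\<bar>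
      \<le> 1 / kap a * (C * exp (- ((1/4 - \<eta>) * x\<^sup>2)))"
proof -
  have n2: "\<eta> / 2 > 0" using \<eta> by simp
  obtain C where C: "C \<ge> 0" "\<And>e u. 0 < e \<Longrightarrow> e \<le> 2 \<Longrightarrow> \<bar>wt n e u - wt n 0 u\<bar> \<le> e * (C * exp (- ((1/4 - \<eta> / 2) * u\<^sup>2)))"
    using wt_diff_le[OF n2, of n] by blast
  define I where "I = (\<integral>u. exp (- (\<eta> / 2 * u\<^sup>2)) \<partial>lborel)"
  have I0: "I \<ge> 0" unfolding I_def by (intro Bochner_Integration.integral_nonneg) simp
  show ?thesis
  proof (rule that[of "C * I"])
    show "C * I \<ge> 0" using C I0 by simp
    fix a A and x :: real
    assume A: "A \<in> sets borel" and Ax: "\<And>u. u \<in> A \<Longrightarrow> \<bar>x\<bar> \<le> \<bar>u\<bar>" and \<eta>4: "\<eta> \<le> 1/4"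
    let ?e = "1 / kap a"
    have ie: "integrable lborel (\<lambda>u. indicator A u * wt n ?e u)" and i0: "integrable lborel (\<lambda>u. indicator A u * wt n 0 u)"
      using integrable_mult_indicator[OF _ integrable_wt[of n a], of A] integrable_mult_indicator[OF _ integrable_wt_0[of n], of A] A by auto
    have "(\<integral>u. indicator A u * wt n ?e u \<partial>lborel) - (\<integral>u. indicator A u * wt n 0 u \<partial>lborel)
       = (\<integral>u. indicator A u * (wt n ?e u - wt n 0 u) \<partial>lborel)"
      unfolding right_diff_distrib using ie i0 by simp
    moreover have "\<bar>\<integral>u. indicator A u * (wt n ?e u - wt n 0 u) \<partial>lborel\<bar> \<le> ?e * C * I * exp (- ((1/4 - \<eta>) * x\<^sup>2))"
      unfolding I_def
    proof (rule integral_gauss_tail_le[OF _ A])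
      show "\<bar>wt n ?e u - wt n 0 u\<bar> \<le> ?e * C * exp (- ((1/4 - \<eta> + \<eta> / 2) * u\<^sup>2))" for u
        using C(2)[OF inverse_kap, of a u] by (simp add: algebra_simps)
    qed (use \<eta> \<eta>4 Ax in auto)
    ultimately show "\<bar>(\<integral>u. indicator A u * wt n ?e u \<partial>lborel) - (\<integral>u. indicator A u * wt n 0 u \<partial>lborel)\<bar>
        \<le> ?e * (C * I * exp (- ((1/4 - \<eta>) * x\<^sup>2)))"
      by (simp only: mult.assoc)
  qed
qed

lemma integral_wt_tendsto: "(\<lambda>a. \<integral>u. wt n (1 / kap a) u \<partial>lborel) \<longlonglongrightarrow> (\<integral>u. wt n 0 u \<partial>lborel)"
proof -
  have p: "(1/8::real) > 0" by simp
  obtain C where C: "C \<ge> 0" "\<And>a A x. A \<in> sets borel \<Longrightarrow> (\<And>u. u \<in> A \<Longrightarrow> \<bar>x\<bar> \<le> \<bar>u\<bar>) \<Longrightarrow> (1/8::real) \<le> 1/4 \<Longrightarrow>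
    \<bar>(\<integral>u. indicator A u * wt n (1 / kap a) u \<partial>lborel) - (\<integral>u. indicator A u * wt n 0 u \<partial>lborel)\<bar>
      \<le> 1 / kap a * (C * exp (- ((1/4 - 1/8) * x\<^sup>2)))"
    using integral_wt_set_diff_le[OF p, of n] by blast
  have b: "\<bar>(\<integral>u. wt n (1 / kap a) u \<partial>lborel) - (\<integral>u. wt n 0 u \<partial>lborel)\<bar> \<le> 1 / kap a * C" for a
    using C(2)[of UNIV 0 a] by simp
  have "(\<lambda>a. 1 / kap a) \<longlonglongrightarrow> 0"
    using inverse_kap_at_right by (simp add: filterlim_at)
  then have "(\<lambda>a. 1 / kap a * C) \<longlonglongrightarrow> 0 * C" by (intro tendsto_mult tendsto_const)
  then have l: "(\<lambda>a. 1 / kap a * C) \<longlonglongrightarrow> 0" by simp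
  have "(\<lambda>a. \<bar>(\<integral>u. wt n (1 / kap a) u \<partial>lborel) - (\<integral>u. wt n 0 u \<partial>lborel)\<bar>) \<longlonglongrightarrow> 0"
    by (rule tendsto_sandwich[OF _ _ tendsto_const l]) (use b in \<open>auto intro: always_eventually\<close>)
  then show ?thesis
    by (rule LIM_zero_cancel[OF tendsto_rabs_zero_cancel])
qed

lemma integral_wt_pos: "(\<integral>u. wt n (1 / kap a) u \<partial>lborel) > 0"
proof -
  have "(\<integral>u. wt n (1 / kap a) u \<partial>lborel) = 1 / wnorm n a"
    using integral_wt[of n a] wnorm_pos[of n a] by (simp add: field_simps)
  then show ?thesis using wnorm_pos[of n a] by simp
qed

lemma inverse_integral_wt_bounded:
  obtains B where "B > 0" "\<And>a. 1 / (\<integral>u. wt n (1 / kap a) u \<partial>lborel) \<le> B"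
proof -
  have "(\<lambda>a. 1 / (\<integral>u. wt n (1 / kap a) u \<partial>lborel)) \<longlonglongrightarrow> 1 / (\<integral>u. wt n 0 u \<partial>lborel)"
    using integral_wt_0_pos[of n] by (intro tendsto_divide integral_wt_tendsto tendsto_const) auto
  then have "Bseq (\<lambda>a. 1 / (\<integral>u. wt n (1 / kap a) u \<partial>lborel))"
    by (intro convergent_imp_Bseq) (auto simp: convergent_def)
  then obtain B where "B > 0" "\<And>a. norm (1 / (\<integral>u. wt n (1 / kap a) u \<partial>lborel)) \<le> B"
    by (auto simp: Bseq_def)
  then show ?thesis using that by (metis abs_le_D1 real_norm_def)
qed

lemma integral_wt_compl:
  assumes "integrable lborel (wt n e)"
  shows "(\<integral>u. indicator {..x} u * wt n e u \<partial>lborel) = (\<integral>u. wt n e u \<partial>lborel) - (\<integral>u. indicator {x<..} u * wt n e u \<partial>lborel)"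
proof -
  have i: "integrable lborel (\<lambda>u. indicator {x<..} u * wt n e u)" "integrable lborel (\<lambda>u. indicator {..x} u * wt n e u)"
    using integrable_mult_indicator[OF _ assms, of "{x<..}"] integrable_mult_indicator[OF _ assms, of "{..x}"] by auto
  have "(\<integral>u. wt n e u \<partial>lborel) = (\<integral>u. indicator {x<..} u * wt n e u + indicator {..x} u * wt n e u \<partial>lborel)"
    by (intro Bochner_Integration.integral_cong) (auto split: split_indicator)
  then show ?thesis using i by simp
qed

lemma lam_Phi_diff_le:
  assumes \<eta>: "0 < \<eta>" "\<eta> \<le> 1/4"
  obtains C where "C \<ge> 0" "\<And>a r. r \<ge> 0 \<Longrightarrow>
    \<bar>lam n (n + a) r - Phi n (2 * (kap a - r))\<bar> \<le> 1 / kap a * (C * exp (- ((1/4 - \<eta>) * (2 * (kap a - r))\<^sup>2)))"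
proof -
  obtain C where C: "C \<ge> 0" "\<And>a A x. A \<in> sets borel \<Longrightarrow> (\<And>u. u \<in> A \<Longrightarrow> \<bar>x\<bar> \<le> \<bar>u\<bar>) \<Longrightarrow> \<eta> \<le> 1/4 \<Longrightarrow>
    \<bar>(\<integral>u. indicator A u * wt n (1 / kap a) u \<partial>lborel) - (\<integral>u. indicator A u * wt n 0 u \<partial>lborel)\<bar>
      \<le> 1 / kap a * (C * exp (- ((1/4 - \<eta>) * x\<^sup>2)))"
    using integral_wt_set_diff_le[OF \<eta>(1), of n] by blast
  obtain B where B: "B > 0" "\<And>a. 1 / (\<integral>u. wt n (1 / kap a) u \<partial>lborel) \<le> B"
    using inverse_integral_wt_bounded by blast
  \<comment> \<open>The rate 3/8 exceeds 1/4 - \<eta> by 1/8 + \<eta>, which is what makes the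
    integral in I converge.\<close>
  obtain D where D: "D \<ge> 0" "\<And>u. wt n 0 u \<le> D * exp (- ((1/2 - 1/8) * u\<^sup>2))"
    using wt_0_le[of "1/8" n] by auto
  define Z0 where "Z0 = (\<integral>u. wt n 0 u \<partial>lborel)"
  define I where "I = D * (\<integral>u. exp (- ((1/8 + \<eta>) * u\<^sup>2)) \<partial>lborel)"
  have I0: "I \<ge> 0" unfolding I_def using D(1) by (intro mult_nonneg_nonneg Bochner_Integration.integral_nonneg) auto
  have Z0: "Z0 > 0" unfolding Z0_def by (rule integral_wt_0_pos)
  have tail: "(\<integral>u. indicator A u * wt n 0 u \<partial>lborel) \<le> I * exp (- ((1/4 - \<eta>) * x\<^sup>2))"
    if A: "A \<in> sets borel" and Ax: "\<And>u. u \<in> A \<Longrightarrow> \<bar>x\<bar> \<le> \<bar>u\<bar>" for A x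
  proof -
    have "\<bar>\<integral>u. indicator A u * wt n 0 u \<partial>lborel\<bar> \<le> I * exp (- ((1/4 - \<eta>) * x\<^sup>2))"
      unfolding I_def
    proof (rule integral_gauss_tail_le[OF _ A])
      show "\<bar>wt n 0 u\<bar> \<le> D * exp (- ((1/4 - \<eta> + (1/8 + \<eta>)) * u\<^sup>2))" for u
        using D(2)[of u] wt_nonneg[of n 0 u] by simp
    qed (use \<eta> Ax in auto)
    then show ?thesis by linarith
  qed
  have main: "\<bar>(\<integral>u. indicator A u * wt n (1 / kap a) u \<partial>lborel) / (\<integral>u. wt n (1 / kap a) u \<partial>lborel)
      - (\<integral>u. indicator A u * wt n 0 u \<partial>lborel) / Z0\<bar> \<le> 1 / kap a * ((B * C + I / Z0 * (B * C)) * exp (- ((1/4 - \<eta>) * x\<^sup>2)))"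
    if A: "A \<in> sets borel" and Ax: "\<And>u. u \<in> A \<Longrightarrow> \<bar>x\<bar> \<le> \<bar>u\<bar>" for A x a
  proof -
    let ?E = "exp (- ((1/4 - \<eta>) * x\<^sup>2))"
    define Te where "Te = (\<integral>u. indicator A u * wt n (1 / kap a) u \<partial>lborel)"
    define T0 where "T0 = (\<integral>u. indicator A u * wt n 0 u \<partial>lborel)"
    define Ze where "Ze = (\<integral>u. wt n (1 / kap a) u \<partial>lborel)"
    have Ze: "Ze > 0" unfolding Ze_def by (rule integral_wt_pos)
    have T0: "T0 \<ge> 0" unfolding T0_def by (intro Bochner_Integration.integral_nonneg) (auto simp: wt_nonneg)
    have ZB: "1 / Ze \<le> B" unfolding Ze_def by (rule B)
    have d1: "\<bar>Te - T0\<bar> \<le> 1 / kap a * (C * ?E)" unfolding Te_def T0_def by (rule C(2)[OF A Ax \<eta>(2)])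
    have d2: "\<bar>Ze - Z0\<bar> \<le> 1 / kap a * C" unfolding Ze_def Z0_def using C(2)[of UNIV 0 a] \<eta> by simp
    \<comment> \<open>Separates the change of the tail from that of the normalising constant. The
      latter has no Gaussian factor in x; it is supplied by T0, a tail of
      \<open>wt n 0\<close>.\<close>
    have "Te / Ze - T0 / Z0 = (Te - T0) * (1 / Ze) + T0 / Z0 * ((Z0 - Ze) * (1 / Ze))"
      using Ze Z0 by (simp add: field_simps)
    then have "\<bar>Te / Ze - T0 / Z0\<bar> \<le> \<bar>(Te - T0) * (1 / Ze)\<bar> + \<bar>T0 / Z0 * ((Z0 - Ze) * (1 / Ze))\<bar>"
      by (metis abs_triangle_ineq)
    also have "\<dots> = \<bar>Te - T0\<bar> * (1 / Ze) + T0 / Z0 * (\<bar>Ze - Z0\<bar> * (1 / Ze))"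
      using Ze Z0 T0 by (simp add: abs_mult abs_minus_commute)
    also have "\<dots> \<le> (1 / kap a * (C * ?E)) * B + (I * ?E) / Z0 * ((1 / kap a * C) * B)"
      using Ze Z0 T0 C(1) B(1) I0 kap_pos[of a] tail[OF A Ax, folded T0_def]
      by (intro add_mono mult_mono d1 d2 ZB divide_right_mono mult_nonneg_nonneg divide_nonneg_nonneg) (auto intro: less_imp_le)
    also have "\<dots> = 1 / kap a * ((B * C + I / Z0 * (B * C)) * ?E)"
      by (simp add: algebra_simps)
    finally show ?thesis unfolding Te_def T0_def Ze_def .
  qed
  show ?thesis
  proof (rule that[of "B * C + I / Z0 * (B * C)"])
    show "B * C + I / Z0 * (B * C) \<ge> 0" using B C I0 Z0 by simp
    fix a and r :: real assume r: "r \<ge> 0"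
    define x where "x = 2 * (kap a - r)"
    have le: "lam n (n + a) r = (\<integral>u. indicator {x<..} u * wt n (1 / kap a) u \<partial>lborel) / (\<integral>u. wt n (1 / kap a) u \<partial>lborel)"
      unfolding x_def by (rule lam_eq_wt[OF r])
    have ph: "Phi n x = (\<integral>u. indicator {x<..} u * wt n 0 u \<partial>lborel) / Z0"
      unfolding Z0_def by (rule Phi_eq)
    show "\<bar>lam n (n + a) r - Phi n (2 * (kap a - r))\<bar> \<le> 1 / kap a * ((B * C + I / Z0 * (B * C)) * exp (- ((1/4 - \<eta>) * (2 * (kap a - r))\<^sup>2)))"
      unfolding x_def[symmetric]
    proof (cases "x \<ge> 0")
      case True
      show "\<bar>lam n (n + a) r - Phi n x\<bar> \<le> 1 / kap a * ((B * C + I / Z0 * (B * C)) * exp (- ((1/4 - \<eta>) * x\<^sup>2)))"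
        unfolding le ph by (rule main) (use True in auto)
    next
      case False
      \<comment> \<open>For negative x the ray beyond x contains 0 and its mass is not small; the
        complements are left tails, where the same bound applies.\<close>
      have "\<bar>lam n (n + a) r - Phi n x\<bar> = \<bar>(1 - lam n (n + a) r) - (1 - Phi n x)\<bar>" by simp
      also have "1 - lam n (n + a) r = (\<integral>u. indicator {..x} u * wt n (1 / kap a) u \<partial>lborel) / (\<integral>u. wt n (1 / kap a) u \<partial>lborel)"
        unfolding le integral_wt_compl[OF integrable_wt] using integral_wt_pos[of n a] by (simp add: field_simps)
      also have "1 - Phi n x = (\<integral>u. indicator {..x} u * wt n 0 u \<partial>lborel) / Z0"
        unfolding ph integral_wt_compl[OF integrable_wt_0] using Z0 by (simp add: Z0_def[symmetric] field_simps)
      finally show "\<bar>lam n (n + a) r - Phi n x\<bar> \<le> 1 / kap a * ((B * C + I / Z0 * (B * C)) * exp (- ((1/4 - \<eta>) * x\<^sup>2)))"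
        using main[of "{..x}" x a] False by simp
    qed
  qed
qed

lemma wt_scaled_diff_tendsto: "(\<lambda>a. (wt n (1 / kap a) u - wt n 0 u) * kap a) \<longlonglongrightarrow> wt1 n u"
  using filterlim_compose[OF wt_right_derivative[of n u] inverse_kap_at_right] by simp

lemma borel_measurable_wt1[measurable]: "wt1 n \<in> borel_measurable borel"
  by (rule borel_measurable_LIMSEQ_metric[OF _ wt_scaled_diff_tendsto]) measurable

lemma wt_scaled_diff_dominated:
  obtains C where "C \<ge> 0" "\<And>a u. \<bar>(wt n (1 / kap a) u - wt n 0 u) * kap a\<bar> \<le> C * exp (- (1/8 * u\<^sup>2))"
proof -
  obtain C where C: "C \<ge> 0" "\<And>e u. 0 < e \<Longrightarrow> e \<le> 2 \<Longrightarrow> \<bar>wt n e u - wt n 0 u\<bar> \<le> e * (C * exp (- ((1/4 - 1/8) * u\<^sup>2)))"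
    using wt_diff_le[of "1/8" n] by auto
  have "\<bar>(wt n (1 / kap a) u - wt n 0 u) * kap a\<bar> \<le> C * exp (- (1/8 * u\<^sup>2))" for a u
  proof -
    have "\<bar>(wt n (1 / kap a) u - wt n 0 u) * kap a\<bar> = \<bar>wt n (1 / kap a) u - wt n 0 u\<bar> * kap a"
      using kap_pos[of a] by (simp add: abs_mult)
    also have "\<dots> \<le> (1 / kap a * (C * exp (- ((1/4 - 1/8) * u\<^sup>2)))) * kap a"
      using kap_pos[of a] by (intro mult_right_mono C(2) inverse_kap) auto
    finally show ?thesis using kap_pos[of a] by simp
  qed
  with C(1) that show ?thesis by blast
qed

lemma integrable_wt1: "integrable lborel (wt1 n)"
proof -
  obtain C where C: "C \<ge> 0" "\<And>a u. \<bar>(wt n (1 / kap a) u - wt n 0 u) * kap a\<bar> \<le> C * exp (- (1/8 * u\<^sup>2))"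
    using wt_scaled_diff_dominated by blast
  show ?thesis
    by (rule integrable_dominated_convergence[where s = "\<lambda>a u. (wt n (1 / kap a) u - wt n 0 u) * kap a" and w = "\<lambda>u. C * exp (- (1/8 * u\<^sup>2))"])
       (use C integrable_gauss[of "1/8"] wt_scaled_diff_tendsto in auto)
qed

text \<open>Hence the normalising constants of \<open>wt\<close> have no correction of first order
  in 1 / kap.\<close>

lemma integral_wt1: "(\<integral>u. wt1 n u \<partial>lborel) = 0"
proof -
  have "(\<integral>u. wt1 n u \<partial>lborel) = (\<integral>u. wt1 n (- u) \<partial>lborel)"
    using lborel_integral_real_affine[of "-1" "wt1 n" 0] by simp
  then show ?thesis by (simp add: wt1_odd)
qed

text \<open>The coefficient of 1 / kap in \<open>lam\<close> at fixed x. The denominator adds no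
  term because of \<open>integral_wt1\<close>.\<close>

definition corr :: "nat \<Rightarrow> real \<Rightarrow> real" where
  "corr n x = (\<integral>u. indicator {x<..} u * wt1 n u \<partial>lborel) / (\<integral>u. wt n 0 u \<partial>lborel)"

text \<open>Oddness of \<open>wt1\<close> turns the tail beyond -x into minus the integral up to x;
  that equals the tail beyond x because the total is 0.\<close>

lemma corr_even: "corr n (- x) = corr n x"
proof -
  have i: "integrable lborel (\<lambda>u. indicator {x<..} u * wt1 n u)" "integrable lborel (\<lambda>u. indicator {..x} u * wt1 n u)"
    using integrable_mult_indicator[OF _ integrable_wt1, of "{x<..}"] integrable_mult_indicator[OF _ integrable_wt1, of "{..x}"] by auto
  have "(\<integral>u. indicator {- x<..} u * wt1 n u \<partial>lborel) = (\<integral>u. indicator {- x<..} (- u) * wt1 n (- u) \<partial>lborel)"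
    using lborel_integral_real_affine[of "-1" "\<lambda>u. indicator {- x<..} u * wt1 n u" 0] by simp
  also have "\<dots> = (\<integral>u. - (indicator {..x} u * wt1 n u) \<partial>lborel)"
  proof (rule integral_cong_AE)
    have "AE u in lborel. u \<noteq> x" by (rule AE_lborel_singleton)
    then show "AE u in lborel. indicat_real {- x<..} (- u) * wt1 n (- u) = - (indicator {..x} u * wt1 n u)"
      by eventually_elim (auto simp: wt1_odd split: split_indicator)
  qed simp_all
  also have "\<dots> = (\<integral>u. indicator {x<..} u * wt1 n u \<partial>lborel)"
  proof -
    have "(\<integral>u. wt1 n u \<partial>lborel) = (\<integral>u. indicator {x<..} u * wt1 n u + indicator {..x} u * wt1 n u \<partial>lborel)"
      by (intro Bochner_Integration.integral_cong) (auto split: split_indicator)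
    then show ?thesis using i integral_wt1[of n] by simp
  qed
  finally show ?thesis by (simp add: corr_def)
qed

text \<open>The index K r and the sets A r move with r because the cell attached to a fixed u, and
  with it the end of the ray, changes with r.\<close>

lemma integral_wt_set_diff_tendsto:
  fixes A :: "real \<Rightarrow> real set" and A' :: "real set"
  assumes K: "filterlim K at_top at_top" and [measurable]: "\<And>r. A r \<in> sets borel" "A' \<in> sets borel"
    and lim: "AE y in lborel. \<forall>\<^sub>F r in at_top. (y \<in> A r \<longleftrightarrow> y \<in> A')"
  shows "((\<lambda>r. ((\<integral>u. indicator (A r) u * wt n (1 / kap (K r)) u \<partial>lborel) - (\<integral>u. indicator (A r) u * wt n 0 u \<partial>lborel)) * kap (K r))
     \<longlongrightarrow> (\<integral>u. indicator A' u * wt1 n u \<partial>lborel)) at_top"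
proof -
  obtain C where C: "C \<ge> 0" "\<And>a u. \<bar>(wt n (1 / kap a) u - wt n 0 u) * kap a\<bar> \<le> C * exp (- (1/8 * u\<^sup>2))"
    using wt_scaled_diff_dominated by blast
  define s where "s r u = indicator (A r) u * ((wt n (1 / kap (K r)) u - wt n 0 u) * kap (K r))" for r u
  have "((\<lambda>r. \<integral>u. s r u \<partial>lborel) \<longlongrightarrow> (\<integral>u. indicator A' u * wt1 n u \<partial>lborel)) at_top"
  proof (rule integral_dominated_convergence_at_top[where w = "\<lambda>u. C * exp (- (1/8 * u\<^sup>2))"])
    show "s r \<in> borel_measurable lborel" for r unfolding s_def by measurable
    show "integrable lborel (\<lambda>u. C * exp (- (1/8 * u\<^sup>2)))" using integrable_gauss[of "1/8"] by auto
    show "AE u in lborel. ((\<lambda>r. s r u) \<longlongrightarrow> indicator A' u * wt1 n u) at_top"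
      using lim
    proof eventually_elim
      case (elim u)
      have "((\<lambda>r. indicator A' u * ((wt n (1 / kap (K r)) u - wt n 0 u) * kap (K r))) \<longlongrightarrow> indicator A' u * wt1 n u) at_top"
        by (intro tendsto_mult tendsto_const filterlim_compose[OF wt_scaled_diff_tendsto K])
      moreover have "\<forall>\<^sub>F r in at_top. indicator A' u * ((wt n (1 / kap (K r)) u - wt n 0 u) * kap (K r)) = s r u"
        using elim by eventually_elim (auto simp: s_def indicator_def)
      ultimately show ?case by (rule Lim_transform_eventually)
    qed
    show "\<forall>\<^sub>F r in at_top. AE u in lborel. norm (s r u) \<le> C * exp (- (1/8 * u\<^sup>2))"
      using C by (intro always_eventually allI AE_I2) (auto simp: s_def indicator_def)
  qed measurable
  moreover have "(\<integral>u. s r u \<partial>lborel) = ((\<integral>u. indicator (A r) u * wt n (1 / kap (K r)) u \<partial>lborel) - (\<integral>u. indicator (A r) u * wt n 0 u \<partial>lborel)) * kap (K r)" for r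
  proof -
    have i: "integrable lborel (\<lambda>u. indicator (A r) u * wt n (1 / kap (K r)) u)" "integrable lborel (\<lambda>u. indicator (A r) u * wt n 0 u)"
      using integrable_mult_indicator[OF _ integrable_wt[of n "K r"], of "A r"] integrable_mult_indicator[OF _ integrable_wt_0[of n], of "A r"] by auto
    have "(\<integral>u. s r u \<partial>lborel) = (\<integral>u. (indicator (A r) u * wt n (1 / kap (K r)) u - indicator (A r) u * wt n 0 u) * kap (K r) \<partial>lborel)"
      by (simp add: s_def algebra_simps)
    then show ?thesis using i by simp
  qed
  ultimately show ?thesis by simp
qed

lemma lam_Phi_diff_tendsto:
  assumes K: "filterlim K at_top at_top" and X: "((\<lambda>r. 2 * (kap (K r) - r)) \<longlongrightarrow> x) at_top"
  shows "((\<lambda>r. (lam n (n + K r) r - Phi n (2 * (kap (K r) - r))) * kap (K r)) \<longlongrightarrow> corr n x) at_top"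
proof -
  define X where "X r = 2 * (kap (K r) - r)" for r
  define Z0 where "Z0 = (\<integral>u. wt n 0 u \<partial>lborel)"
  define Z where "Z r = (\<integral>u. wt n (1 / kap (K r)) u \<partial>lborel)" for r
  define T where "T r = (\<integral>u. indicator {X r<..} u * wt n (1 / kap (K r)) u \<partial>lborel)" for r
  define T0 where "T0 r = (\<integral>u. indicator {X r<..} u * wt n 0 u \<partial>lborel)" for r
  have Z0: "Z0 > 0" unfolding Z0_def by (rule integral_wt_0_pos)
  have Zp: "Z r > 0" for r unfolding Z_def by (rule integral_wt_pos)
  have Xl: "(X \<longlongrightarrow> x) at_top" using X by (simp add: X_def[abs_def])
  have tT: "((\<lambda>r. (T r - T0 r) * kap (K r)) \<longlongrightarrow> (\<integral>u. indicator {x<..} u * wt1 n u \<partial>lborel)) at_top"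
    unfolding T_def T0_def
  proof (rule integral_wt_set_diff_tendsto[OF K])
    have "AE y in lborel. y \<noteq> x" by (rule AE_lborel_singleton)
    then show "AE y in lborel. \<forall>\<^sub>F r in at_top. (y \<in> {X r<..}) = (y \<in> {x<..})"
    proof eventually_elim
      case (elim y)
      then consider "y < x" | "x < y" by linarith
      then show ?case
      proof cases
        case 1
        then have "\<forall>\<^sub>F r in at_top. y < X r" using order_tendstoD(1)[OF Xl] by blast
        then show ?thesis by eventually_elim (use 1 in auto)
      next
        case 2
        then have "\<forall>\<^sub>F r in at_top. X r < y" using order_tendstoD(2)[OF Xl] by blast
        then show ?thesis by eventually_elim (use 2 in auto)
      qed
    qed
  qed auto
  have tZ: "((\<lambda>r. (Z r - Z0) * kap (K r)) \<longlongrightarrow> 0) at_top"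
    using integral_wt_set_diff_tendsto[OF K, of "\<lambda>_. UNIV" UNIV n] by (simp add: Z_def Z0_def integral_wt1)
  have lZ: "(Z \<longlongrightarrow> Z0) at_top"
    unfolding Z_def[abs_def] Z0_def by (rule filterlim_compose[OF integral_wt_tendsto K])
  have T01: "0 \<le> T0 r / Z0" "T0 r / Z0 \<le> 1" for r
  proof -
    have i: "integrable lborel (\<lambda>u. indicator {X r<..} u * wt n 0 u)"
      using integrable_mult_indicator[OF _ integrable_wt_0[of n], of "{X r<..}"] by auto
    have "T0 r \<le> Z0" unfolding T0_def Z0_def
      by (rule Bochner_Integration.integral_mono) (use i integrable_wt_0 wt_nonneg in \<open>auto simp: indicator_def\<close>)
    then show "T0 r / Z0 \<le> 1" using Z0 by simp
    have "T0 r \<ge> 0" unfolding T0_def by (intro Bochner_Integration.integral_nonneg) (auto simp: wt_nonneg)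
    then show "0 \<le> T0 r / Z0" using Z0 by simp
  qed
  \<comment> \<open>The change of the normalising constant is o(1 / kap), and it is multiplied by a
    factor between 0 and 1.\<close>
  have "((\<lambda>r. T0 r / Z0 * ((Z r - Z0) * kap (K r))) \<longlongrightarrow> 0) at_top"
  proof (rule tendsto_rabs_zero_cancel[OF tendsto_sandwich[of "\<lambda>_. 0" _ _ "\<lambda>r. \<bar>(Z r - Z0) * kap (K r)\<bar>"]])
    show "((\<lambda>r. \<bar>(Z r - Z0) * kap (K r)\<bar>) \<longlongrightarrow> 0) at_top" using tZ by (rule tendsto_rabs_zero)
    show "\<forall>\<^sub>F r in at_top. \<bar>T0 r / Z0 * ((Z r - Z0) * kap (K r))\<bar> \<le> \<bar>(Z r - Z0) * kap (K r)\<bar>"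
    proof (intro always_eventually allI)
      fix r
      have "\<bar>T0 r / Z0\<bar> * \<bar>(Z r - Z0) * kap (K r)\<bar> \<le> 1 * \<bar>(Z r - Z0) * kap (K r)\<bar>"
        using T01[of r] by (intro mult_right_mono) auto
      then show "\<bar>T0 r / Z0 * ((Z r - Z0) * kap (K r))\<bar> \<le> \<bar>(Z r - Z0) * kap (K r)\<bar>"
        by (simp only: abs_mult mult_1_left)
    qed
  qed auto
  then have "((\<lambda>r. ((T r - T0 r) * kap (K r) - T0 r / Z0 * ((Z r - Z0) * kap (K r))) / Z r) \<longlongrightarrow>
      ((\<integral>u. indicator {x<..} u * wt1 n u \<partial>lborel) - 0) / Z0) at_top"
    using Z0 by (intro tendsto_divide tendsto_diff tT lZ) auto
  then have "((\<lambda>r. ((T r - T0 r) * kap (K r) - T0 r / Z0 * ((Z r - Z0) * kap (K r))) / Z r) \<longlongrightarrow> corr n x) at_top"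
    by (simp add: corr_def Z0_def)
  moreover have "\<forall>\<^sub>F r in at_top. ((T r - T0 r) * kap (K r) - T0 r / Z0 * ((Z r - Z0) * kap (K r))) / Z r
      = (lam n (n + K r) r - Phi n (2 * (kap (K r) - r))) * kap (K r)"
    using eventually_ge_at_top[of 0]
  proof eventually_elim
    case (elim r)
    have "lam n (n + K r) r = T r / Z r" unfolding lam_eq_wt[OF elim] T_def Z_def X_def ..
    moreover have "Phi n (2 * (kap (K r) - r)) = T0 r / Z0" unfolding Phi_eq T0_def Z0_def X_def ..
    ultimately show ?case using Zp[of r] Z0 by (simp add: field_simps)
  qed
  ultimately show ?thesis by (rule Lim_transform_eventually)
qed

section \<open>Smoothness, symmetry and lower bounds of \<open>Phi\<close>\<close>

lemma continuous_He: "continuous_on S (He n)"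
  using DERIV_isCont[OF He_deriv] by (auto intro: continuous_at_imp_continuous_on)

lemma continuous_hsq: "continuous_on S (hsq n)"
  unfolding hsq_def Herm_def by (intro continuous_intros continuous_He) auto

lemma borel_measurable_hsq[measurable]: "hsq n \<in> borel_measurable borel"
  by (intro borel_measurable_continuous_onI continuous_hsq)

lemma integrable_hsq: "integrable lborel (hsq n)"
  unfolding hsq_eq[abs_def] by (intro integrable_divide integrable_wt_0)

lemma hsq_nonneg: "hsq n u \<ge> 0"
  by (simp add: hsq_def)

lemma hsq_le:
  assumes "\<eta> > 0"
  obtains C where "C \<ge> 0" "\<And>u. hsq n u \<le> C * exp (- ((1/2 - \<eta>) * u\<^sup>2))"
proof -
  obtain C where C: "C \<ge> 0" "\<And>u. wt n 0 u \<le> C * exp (- ((1/2 - \<eta>) * u\<^sup>2))"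
    using wt_0_le[OF assms] by blast
  let ?Z = "\<integral>u. wt n 0 u \<partial>lborel"
  show ?thesis
  proof (rule that[of "C / ?Z"])
    show "C / ?Z \<ge> 0" using C(1) integral_wt_0_pos[of n] by simp
    show "hsq n u \<le> C / ?Z * exp (- ((1/2 - \<eta>) * u\<^sup>2))" for u
      using divide_right_mono[OF C(2)[of u], of ?Z] integral_wt_0_pos[of n] by (simp add: hsq_eq)
  qed
qed

lemma Phi_eq_integral: "Phi n x = (\<integral>u. indicator {x<..} u * hsq n u \<partial>lborel)"
  by (simp add: Phi_eq hsq_eq)

lemma wt_0_even: "wt n 0 (- u) = wt n 0 u"
proof -
  have "lq n 0 (- u) = (- 1) ^ n * lq n 0 u" using lq_parity[of n 0 u] by simp
  then show ?thesis by (simp add: wt_def hw_def power_mult_distrib flip: power_mult)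
qed

lemma Phi_minus: "Phi n (- x) = 1 - Phi n x"
proof -
  let ?Z = "\<integral>u. wt n 0 u \<partial>lborel"
  have "(\<integral>u. indicator {- x<..} u * wt n 0 u \<partial>lborel) = (\<integral>u. indicator {- x<..} (- u) * wt n 0 (- u) \<partial>lborel)"
    using lborel_integral_real_affine[of "-1" "\<lambda>u. indicator {- x<..} u * wt n 0 u" 0] by simp
  also have "\<dots> = (\<integral>u. indicator {..x} u * wt n 0 u \<partial>lborel)"
  proof (rule integral_cong_AE)
    have "AE u in lborel. u \<noteq> x" by (rule AE_lborel_singleton)
    then show "AE u in lborel. indicat_real {- x<..} (- u) * wt n 0 (- u) = indicator {..x} u * wt n 0 u"
      by eventually_elim (auto simp: wt_0_even split: split_indicator)
  qed simp_all
  also have "\<dots> = ?Z - (\<integral>u. indicator {x<..} u * wt n 0 u \<partial>lborel)"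
    by (rule integral_wt_compl[OF integrable_wt_0])
  finally show ?thesis unfolding Phi_eq using integral_wt_0_pos[of n] by (simp add: diff_divide_distrib)
qed

lemma Phi_diff:
  assumes "x \<le> y"
  shows "Phi n x - Phi n y = integral {x..y} (hsq n)"
proof -
  have i: "integrable lborel (\<lambda>u. indicator {z<..} u * hsq n u)" for z
    using integrable_mult_indicator[OF _ integrable_hsq, of "{z<..}" n] by auto
  have "Phi n x - Phi n y = (\<integral>u. indicator {x<..} u * hsq n u - indicator {y<..} u * hsq n u \<partial>lborel)"
    unfolding Phi_eq_integral using i by simp
  also have "\<dots> = (\<integral>u. indicator {x..y} u *\<^sub>R hsq n u \<partial>lborel)"
  proof (rule integral_cong_AE)
    have "AE u in lborel. u \<noteq> x" by (rule AE_lborel_singleton)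
    then show "AE u in lborel. indicator {x<..} u * hsq n u - indicator {y<..} u * hsq n u = indicator {x..y} u *\<^sub>R hsq n u"
      by eventually_elim (use assms in \<open>auto split: split_indicator\<close>)
  qed measurable
  also have "\<dots> = integral {x..y} (hsq n)"
    using set_borel_integral_eq_integral(2)[of "{x..y}" "hsq n"] integrable_mult_indicator[OF _ integrable_hsq, of "{x..y}" n]
    by (simp add: set_lebesgue_integral_def set_integrable_def)
  finally show ?thesis .
qed

lemma Phi_deriv: "(Phi n has_real_derivative - hsq n x) (at x)"
proof -
  have "((\<lambda>y. integral {x - 1..y} (hsq n)) has_real_derivative hsq n x) (at x within {x - 1..x + 1})"
    by (rule integral_has_real_derivative) (auto intro: continuous_hsq)
  then have "((\<lambda>y. integral {x - 1..y} (hsq n)) has_real_derivative hsq n x) (at x)"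
    by (simp add: at_within_Icc_at)
  then have "((\<lambda>y. Phi n (x - 1) - integral {x - 1..y} (hsq n)) has_real_derivative 0 - hsq n x) (at x)"
    by (intro DERIV_diff DERIV_const)
  then have "((\<lambda>y. Phi n (x - 1) - integral {x - 1..y} (hsq n)) has_real_derivative - hsq n x) (at x)" by simp
  then show ?thesis
  proof (rule DERIV_cong_ev[THEN iffD1, rotated 3])
    have "\<forall>\<^sub>F y in nhds x. y > x - 1" by (rule eventually_nhds_in_open[of "{x - 1<..}", simplified]) auto
    then show "\<forall>\<^sub>F y in nhds x. Phi n (x - 1) - integral {x - 1..y} (hsq n) = Phi n y"
      by eventually_elim (use Phi_diff[of "x - 1" _ n] in \<open>simp add: algebra_simps\<close>)
  qed auto
qed

lemma continuous_Phi: "continuous_on S (Phi n)"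
  using DERIV_isCont[OF Phi_deriv] by (auto intro: continuous_at_imp_continuous_on)

lemma borel_measurable_Phi[measurable]: "Phi n \<in> borel_measurable borel"
  by (intro borel_measurable_continuous_onI continuous_Phi)

lemma Phi_antimono: "x \<le> y \<Longrightarrow> Phi n y \<le> Phi n x"
  using Phi_diff[of x y n] integral_nonneg[OF integrable_continuous_real[OF continuous_hsq], of x y n] hsq_nonneg[of n]
  by simp

text \<open>Joint induction with monotonicity in n: for such u the factor u in the recursion
  outweighs the subtracted term.\<close>

lemma He_ge_1: "u \<ge> real n + 1 \<Longrightarrow> He n u \<ge> 1"
proof -
  have "u \<ge> real n + 1 \<Longrightarrow> He n u \<ge> 1 \<and> He (Suc n) u \<ge> He n u"
  proof (induction n)
    case 0
    then show ?case by simp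
  next
    case (Suc n)
    then have IH: "He n u \<ge> 1" "He (Suc n) u \<ge> He n u" by auto
    have "real (Suc n) * He n u \<le> real (Suc n) * He (Suc n) u" using IH by (intro mult_left_mono) auto
    moreover have "(real (Suc n) + 1) * He (Suc n) u \<le> u * He (Suc n) u"
      using Suc.prems IH by (intro mult_right_mono) auto
    ultimately have "He (Suc (Suc n)) u \<ge> He (Suc n) u" by (simp add: algebra_simps)
    then show ?case using IH by linarith
  qed
  then show "u \<ge> real n + 1 \<Longrightarrow> He n u \<ge> 1" by blast
qed

text \<open>Only the mass of a unit interval starting at |x| + n + 1 is kept, where
  \<open>He\<close> is at least 1. Since \<open>Phi\<close> decreases, starting from |x| serves both
  signs of x.\<close>

lemma Phi_lower:
  obtains c Y where "c > 0" "Y \<ge> 0" "\<And>x. Phi n x \<ge> c * exp (- ((\<bar>x\<bar> + Y)\<^sup>2 / 2))"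
proof -
  define Z where "Z = (\<integral>u. wt n 0 u \<partial>lborel)"
  have Z: "Z > 0" unfolding Z_def by (rule integral_wt_0_pos)
  show ?thesis
  proof (rule that[of "1 / Z" "real n + 2"])
    fix x :: real
    define m where "m = \<bar>x\<bar> + (real n + 1)"
    have "exp (- ((\<bar>x\<bar> + (real n + 2))\<^sup>2 / 2)) = integral {m..m + 1} (\<lambda>_. exp (- ((\<bar>x\<bar> + (real n + 2))\<^sup>2 / 2)))"
      by simp
    also have "\<dots> \<le> integral {m..m + 1} (\<lambda>u. Z * hsq n u)"
    proof (rule integral_le)
      show "(\<lambda>u. Z * hsq n u) integrable_on {m..m + 1}"
        by (intro integrable_continuous_real continuous_intros continuous_hsq)
      fix u assume u: "u \<in> {m..m + 1}"
      then have u1: "u \<ge> real n + 1" "0 \<le> u" "u \<le> \<bar>x\<bar> + (real n + 2)" by (auto simp: m_def)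
      have "u\<^sup>2 \<le> (\<bar>x\<bar> + (real n + 2))\<^sup>2" using u1 by (intro power_mono) auto
      then have e: "exp (- ((\<bar>x\<bar> + (real n + 2))\<^sup>2 / 2)) \<le> exp (- (u\<^sup>2) / 2)" by simp
      have "1 \<le> (He n u)\<^sup>2" using He_ge_1[OF u1(1)] by (simp add: one_le_power)
      then have "exp (- (u\<^sup>2) / 2) * 1 \<le> exp (- (u\<^sup>2) / 2) * (He n u)\<^sup>2" by (intro mult_left_mono) auto
      also have "\<dots> = Z * hsq n u" unfolding wt_0[symmetric] hsq_eq Z_def[symmetric] using Z by simp
      finally have "exp (- (u\<^sup>2) / 2) \<le> Z * hsq n u" by simp
      then show "exp (- ((\<bar>x\<bar> + (real n + 2))\<^sup>2 / 2)) \<le> Z * hsq n u" by (rule order_trans[OF e])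
    qed (intro integrable_continuous_real continuous_on_const)
    also have "\<dots> = Z * (Phi n m - Phi n (m + 1))"
      by (simp add: Phi_diff)
    also have "\<dots> \<le> Z * Phi n x"
    proof -
      have "Phi n (m + 1) \<ge> 0" unfolding Phi_eq_integral
        by (intro Bochner_Integration.integral_nonneg) (auto simp: hsq_nonneg)
      moreover have "Phi n m \<le> Phi n x" by (rule Phi_antimono) (simp add: m_def)
      ultimately show ?thesis using Z by simp
    qed
    finally show "1 / Z * exp (- ((\<bar>x\<bar> + (real n + 2))\<^sup>2 / 2)) \<le> Phi n x"
      using Z by (simp add: field_simps)
  qed (use Z in auto)
qed

lemma Phi_pos: "Phi n x > 0"
proof -
  obtain c Y where "c > 0" "Phi n x \<ge> c * exp (- ((\<bar>x\<bar> + Y)\<^sup>2 / 2))"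
    using Phi_lower[of n] by metis
  then show ?thesis by (meson exp_gt_zero less_le_trans mult_pos_pos)
qed

lemma Phi_less_1: "Phi n x < 1"
  using Phi_pos[of n "- x"] Phi_minus[of n x] by simp

text \<open>Young's inequality: a bounded shift inside a Gaussian costs an arbitrarily small
  fraction of the rate and a constant factor.\<close>

lemma square_shift_le:
  fixes x y :: real
  assumes "t > 0"
  shows "(x + y)\<^sup>2 \<le> (1 + t) * x\<^sup>2 + (1 + 1 / t) * y\<^sup>2"
proof -
  have "0 \<le> (t * x - y)\<^sup>2 / t" using assms by simp
  also have "\<dots> = t * x\<^sup>2 - 2 * x * y + y\<^sup>2 / t"
    using assms by (simp add: power2_diff field_simps power2_eq_square)
  finally show ?thesis by (simp add: power2_sum algebra_simps)
qed

lemma Phi_powr_le: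
  assumes g: "g > 0" and d: "d > 0"
  obtains C where "C \<ge> 0" "\<And>x. Phi n x powr (- g) + (1 - Phi n x) powr (- g) \<le> C * exp ((g / 2 + d) * x\<^sup>2)"
proof -
  obtain c Y where c: "c > 0" "Y \<ge> 0" "\<And>x. Phi n x \<ge> c * exp (- ((\<bar>x\<bar> + Y)\<^sup>2 / 2))"
    using Phi_lower[of n] by metis
  \<comment> \<open>Chosen so that g / 2 * (1 + t) = g / 2 + d.\<close>
  define t where "t = 2 * d / g"
  have t: "t > 0" using g d by (simp add: t_def)
  define C where "C = c powr (- g) * exp (g / 2 * ((1 + 1 / t) * Y\<^sup>2))"
  have one: "Phi n x powr (- g) \<le> C * exp ((g / 2 + d) * x\<^sup>2)" for x
  proof -
    have "Phi n x powr (- g) \<le> (c * exp (- ((\<bar>x\<bar> + Y)\<^sup>2 / 2))) powr (- g)"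
      using c g by (intro powr_mono2') auto
    also have "\<dots> = c powr (- g) * exp (g / 2 * (\<bar>x\<bar> + Y)\<^sup>2)"
      using c(1) by (simp add: powr_mult) (simp add: powr_def)
    also have "\<dots> \<le> c powr (- g) * exp (g / 2 * ((1 + t) * \<bar>x\<bar>\<^sup>2 + (1 + 1 / t) * Y\<^sup>2))"
      using g square_shift_le[OF t, of "\<bar>x\<bar>" Y] by (intro mult_left_mono) auto
    also have "g / 2 * ((1 + t) * \<bar>x\<bar>\<^sup>2 + (1 + 1 / t) * Y\<^sup>2) = (g / 2 + d) * x\<^sup>2 + g / 2 * ((1 + 1 / t) * Y\<^sup>2)"
      using g d by (simp add: t_def field_simps)
    finally show ?thesis unfolding C_def exp_add by (simp add: mult_ac)
  qed
  have "Phi n x powr (- g) + (1 - Phi n x) powr (- g) \<le> 2 * C * exp ((g / 2 + d) * x\<^sup>2)" for x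
    using one[of x] one[of "- x"] by (simp add: Phi_minus)
  then show ?thesis using that[of "2 * C"] by (simp add: C_def)
qed

lemma gauss_shift_le:
  fixes x y c \<eta> :: real
  assumes c: "c > 0" and n: "\<eta> > 0" and y: "\<bar>y - x\<bar> \<le> M"
  shows "exp (- (c * y\<^sup>2)) \<le> exp (c\<^sup>2 / \<eta> * M\<^sup>2) * exp (- ((c - \<eta>) * x\<^sup>2))"
proof -
  have "(c - \<eta>) * x\<^sup>2 \<le> c * y\<^sup>2 + c\<^sup>2 / \<eta> * M\<^sup>2"
  proof (cases "c \<le> \<eta>")
    case True
    then have "(c - \<eta>) * x\<^sup>2 \<le> 0" by (simp add: mult_nonpos_nonneg)
    also have "\<dots> \<le> c * y\<^sup>2 + c\<^sup>2 / \<eta> * M\<^sup>2" using c n by simp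
    finally show ?thesis .
  next
    case False
    have m: "(x - y)\<^sup>2 \<le> M\<^sup>2" using y by (metis abs_ge_zero abs_minus_commute power2_abs power_mono)
    \<comment> \<open>The weight \<eta> / c makes (c - \<eta>) * (1 + \<eta> / c) = c - \<eta>^2 / c
      <= c, and it yields the constant c^2 / \<eta>.\<close>
    have "x\<^sup>2 \<le> (1 + \<eta> / c) * y\<^sup>2 + (1 + 1 / (\<eta> / c)) * (x - y)\<^sup>2"
      using square_shift_le[of "\<eta> / c" y "x - y"] c n by simp
    also have "\<dots> \<le> (1 + \<eta> / c) * y\<^sup>2 + (1 + 1 / (\<eta> / c)) * M\<^sup>2"
      using c n m by (intro add_left_mono mult_left_mono) auto
    finally have "(c - \<eta>) * x\<^sup>2 \<le> (c - \<eta>) * ((1 + \<eta> / c) * y\<^sup>2 + (1 + 1 / (\<eta> / c)) * M\<^sup>2)"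
      using False by (intro mult_left_mono) auto
    also have "\<dots> = ((c - \<eta>) * (1 + \<eta> / c)) * y\<^sup>2 + ((c - \<eta>) * (1 + 1 / (\<eta> / c))) * M\<^sup>2"
      by (simp add: algebra_simps)
    also have "\<dots> \<le> c * y\<^sup>2 + c\<^sup>2 / \<eta> * M\<^sup>2"
    proof (intro add_mono mult_right_mono)
      show "(c - \<eta>) * (1 + \<eta> / c) \<le> c" using c n by (simp add: field_simps)
      show "(c - \<eta>) * (1 + 1 / (\<eta> / c)) \<le> c\<^sup>2 / \<eta>" using c n by (simp add: field_simps power2_eq_square)
    qed auto
    finally show ?thesis .
  qed
  then show ?thesis unfolding exp_add[symmetric] by simp
qed

section \<open>The entropy function\<close>

lemma fbeta_sym: "fbeta b (1 - x) = fbeta b x"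
  by (simp add: fbeta_def add.commute algebra_simps)

lemma fbeta_0: "fbeta b 0 = 0" and fbeta_1: "fbeta b 1 = 0"
  by (simp_all add: fbeta_def)

lemma powr_sum_ge:
  assumes "b > 0" "0 \<le> x" "x \<le> (1::real)"
  shows "x powr b + (1 - x) powr b \<ge> (1/2) powr b"
proof (cases "x \<ge> 1/2")
  case True
  then have "x powr b \<ge> (1/2) powr b" using assms by (intro powr_mono2) auto
  then show ?thesis by (simp add: add_increasing2)
next
  case False
  then have "(1 - x) powr b \<ge> (1/2) powr b" using assms by (intro powr_mono2) auto
  then show ?thesis by (simp add: add_increasing)
qed

lemma fbeta_nonneg:
  assumes "b > 0" "0 \<le> x" "x \<le> 1"
  shows "fbeta b x \<ge> 0"
proof -
  consider "b = 1" | "b < 1" | "b > 1" by linarith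
  then show ?thesis
  proof cases
    case 1
    have "y * ln y \<le> 0" if "0 \<le> y" "y \<le> 1" for y :: real
      using that by (cases "y = 0") (auto simp: mult_le_0_iff)
    from this[of x] this[of "1 - x"] have "x * ln x \<le> 0" "(1 - x) * ln (1 - x) \<le> 0"
      using assms by auto
    then show ?thesis using 1 by (simp add: fbeta_def)
  next
    case 2
    have "y powr b \<ge> y" if "0 \<le> y" "y \<le> 1" for y
      using powr_mono'[of b 1 y] that 2 by simp
    from this[of x] this[of "1 - x"] have "x powr b + (1 - x) powr b \<ge> 1" using assms by simp
    then show ?thesis using 2 by (simp add: fbeta_def)
  next
    case 3
    have "y powr b \<le> y" if "0 \<le> y" "y \<le> 1" for y
      using powr_mono'[of 1 b y] that 3 by simp
    from this[of x] this[of "1 - x"] have "x powr b + (1 - x) powr b \<le> 1" using assms by simp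
    moreover have "x powr b + (1 - x) powr b > 0"
      using powr_sum_ge[OF assms] by (rule less_le_trans[rotated]) simp
    ultimately show ?thesis using 3 by (simp add: fbeta_def divide_nonpos_neg)
  qed
qed

text \<open>Lets the logarithmic singularity at b = 1 be treated as a small negative power, like the
  other cases.\<close>

lemma neg_ln_le_powr:
  assumes "0 < x" "x \<le> (1::real)" "g > 0"
  shows "\<bar>ln x\<bar> \<le> x powr (- g) / g"
proof -
  have "ln (1 / x) \<le> (1 / x) powr g / g"
    using assms by (intro ln_powr_bound) auto
  also have "(1 / x) powr g = x powr (- g)"
    using assms by (simp add: powr_minus powr_divide inverse_eq_divide)
  finally show ?thesis using assms by (simp add: ln_div)
qed

lemma continuous_on_x_ln_x: "continuous_on {0..1} (\<lambda>x::real. x * ln x)"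
  unfolding continuous_on_eq_continuous_within
proof
  fix x :: real assume x: "x \<in> {0..1}"
  show "continuous (at x within {0..1}) (\<lambda>x. x * ln x)"
  proof (cases "x = 0")
    case True
    have l: "((\<lambda>y::real. 2 * y powr (1/2)) \<longlongrightarrow> 0) (at 0 within {0..1})"
    proof -
      have "((\<lambda>y::real. 2 * sqrt y) \<longlongrightarrow> 2 * sqrt 0) (at 0 within {0..1})" by (intro tendsto_intros)
      then have "((\<lambda>y::real. 2 * sqrt y) \<longlongrightarrow> 0) (at 0 within {0..1})" by simp
      then show ?thesis
        by (rule Lim_transform_eventually) (auto simp: eventually_at_filter powr_half_sqrt)
    qed
    have "((\<lambda>y::real. \<bar>y * ln y\<bar>) \<longlongrightarrow> 0) (at 0 within {0..1})"
    proof (rule tendsto_sandwich[OF _ _ tendsto_const l])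
      show "\<forall>\<^sub>F y::real in at 0 within {0..1}. \<bar>y * ln y\<bar> \<le> 2 * y powr (1/2)"
        unfolding eventually_at_filter
      proof (intro always_eventually allI impI)
        fix y :: real assume y: "y \<noteq> 0" "y \<in> {0..1}"
        then have "\<bar>ln y\<bar> \<le> y powr (- (1/2)) / (1/2)" by (intro neg_ln_le_powr) auto
        then have "y * \<bar>ln y\<bar> \<le> y powr 1 * (2 * y powr (- (1/2)))" using y by (intro mult_mono) auto
        also have "\<dots> = 2 * y powr (1/2)" by (simp only: powr_add[symmetric] mult.left_commute) simp
        finally show "\<bar>y * ln y\<bar> \<le> 2 * y powr (1/2)" using y by (simp add: abs_mult)
      qed
    qed simp
    then have "((\<lambda>y::real. y * ln y) \<longlongrightarrow> 0) (at 0 within {0..1})" by (rule tendsto_rabs_zero_cancel)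
    then show ?thesis using True by (simp add: continuous_within)
  next
    case False
    then show ?thesis using x by (intro continuous_intros) auto
  qed
qed

lemma continuous_on_fbeta:
  assumes "b > 0"
  shows "continuous_on {0..1} (fbeta b)"
proof (cases "b = 1")
  case True
  have "continuous_on {0..1} (\<lambda>x::real. (1 - x) * ln (1 - x))"
    by (rule continuous_on_compose2[OF continuous_on_x_ln_x]) (auto intro!: continuous_intros)
  then have "continuous_on {0..1} (\<lambda>x::real. - (x * ln x) - (1 - x) * ln (1 - x))"
    by (intro continuous_on_diff continuous_on_minus continuous_on_x_ln_x)
  then show ?thesis using True by (simp add: fbeta_def[abs_def])
next
  case False
  have c: "continuous_on {0..1} (\<lambda>x::real. x powr b)" "continuous_on {0..1} (\<lambda>x::real. (1 - x) powr b)"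
    by (intro continuous_on_powr' continuous_on_diff continuous_on_id continuous_on_const; use assms in simp)+
  have "continuous_on {0..1} (\<lambda>x. ln (x powr b + (1 - x) powr b) / (1 - b))"
  proof (intro continuous_on_divide continuous_on_ln continuous_on_add c continuous_on_const)
    show "\<forall>x\<in>{0..1}. x powr b + (1 - x) powr b \<noteq> 0"
    proof
      fix x :: real assume "x \<in> {0..1}"
      then have "x powr b + (1 - x) powr b \<ge> (1/2) powr b" using powr_sum_ge[OF assms] by auto
      moreover have "(1/2 :: real) powr b > 0" by simp
      ultimately show "x powr b + (1 - x) powr b \<noteq> 0" by linarith
    qed
  qed (use False in auto)
  then show ?thesis using False by (simp add: fbeta_def[abs_def])
qed

definition fbeta' :: "real \<Rightarrow> real \<Rightarrow> real" where
  "fbeta' b x = (if b = 1 then ln (1 - x) - ln x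
     else b * (x powr (b - 1) - (1 - x) powr (b - 1)) / (x powr b + (1 - x) powr b) / (1 - b))"

lemma fbeta'_sym: "fbeta' b (1 - x) = - fbeta' b x"
  by (simp add: fbeta'_def add.commute diff_divide_distrib algebra_simps)

lemma fbeta_deriv:
  assumes "b > 0" "0 < x" "x < 1"
  shows "(fbeta b has_real_derivative fbeta' b x) (at x)"
proof (cases "b = 1")
  case True
  have "((\<lambda>x. - x * ln x - (1 - x) * ln (1 - x)) has_real_derivative fbeta' b x) (at x)"
    using assms True by (auto intro!: derivative_eq_intros simp: fbeta'_def)
  then show ?thesis using True by (simp add: fbeta_def[abs_def])
next
  case False
  have S: "x powr b + (1 - x) powr b > 0" using assms by (simp add: add_pos_pos)
  have 1: "((\<lambda>x. x powr b) has_real_derivative b * x powr (b - 1)) (at x)"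
    using assms by (auto intro!: derivative_eq_intros)
  have 2: "((\<lambda>x. (1 - x) powr b) has_real_derivative - (b * (1 - x) powr (b - 1))) (at x)"
    using assms by (auto intro!: derivative_eq_intros)
  have "((\<lambda>x. ln (x powr b + (1 - x) powr b)) has_real_derivative
      1 / (x powr b + (1 - x) powr b) * (b * x powr (b - 1) + - (b * (1 - x) powr (b - 1)))) (at x)"
    using S by (intro DERIV_chain2[OF DERIV_ln_divide] DERIV_add 1 2) auto
  from DERIV_cdivide[OF this, of "1 - b"]
  have "((\<lambda>x. ln (x powr b + (1 - x) powr b) / (1 - b)) has_real_derivative fbeta' b x) (at x)"
    by (rule DERIV_cong) (use False in \<open>simp only: fbeta'_def if_False times_divide_eq_left mult_1_left right_diff_distrib add_uminus_conv_diff diff_divide_distrib\<close>)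
  then show ?thesis using False by (simp add: fbeta_def[abs_def])
qed

lemma fbeta'_bound:
  assumes "b > 1/2"
  obtains g C where "0 < g" "g < 1/2" "C \<ge> 0"
    "\<And>x. 0 < x \<Longrightarrow> x < 1 \<Longrightarrow> \<bar>fbeta' b x\<bar> \<le> C * (x powr (- g) + (1 - x) powr (- g))"
proof -
  \<comment> \<open>For b < 1 the derivative blows up with order 1 - b, which the hypothesis places
    below 1/2. The floor 1/4 keeps g positive and also serves b >= 1, where the blow-up is at most
    logarithmic.\<close>
  define g where "g = max (1/4) (1 - b)"
  have g: "0 < g" "g < 1/2" "- g \<le> b - 1" using assms by (auto simp: g_def max_def)
  define c where "c = \<bar>b / (1 - b)\<bar> / (1/2) powr b"
  have c0: "c \<ge> 0" by (simp add: c_def)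
  show ?thesis
  proof (rule that[of g "max (1 / g) c"])
    fix x :: real assume x: "0 < x" "x < 1"
    define P where "P = x powr (- g) + (1 - x) powr (- g)"
    have P: "P \<ge> 0" by (simp add: P_def)
    show "\<bar>fbeta' b x\<bar> \<le> max (1 / g) c * (x powr (- g) + (1 - x) powr (- g))"
    proof (cases "b = 1")
      case True
      have "\<bar>ln x\<bar> \<le> x powr (- g) / g" "\<bar>ln (1 - x)\<bar> \<le> (1 - x) powr (- g) / g"
        using x g by (intro neg_ln_le_powr; simp)+
      then have "\<bar>fbeta' b x\<bar> \<le> 1 / g * P"
        using True g(1) by (simp add: fbeta'_def P_def add_divide_distrib)
      also have "\<dots> \<le> max (1 / g) c * P" using P by (intro mult_right_mono) auto
      finally show ?thesis by (simp add: P_def)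
    next
      case False
      define S where "S = x powr b + (1 - x) powr b"
      have S: "S \<ge> (1/2) powr b" unfolding S_def using x assms by (intro powr_sum_ge) auto
      have h: "(1/2 :: real) powr b > 0" by simp
      have S0: "\<bar>S\<bar> = S" using S h by linarith
      have "x powr (b - 1) \<le> x powr (- g)" "(1 - x) powr (b - 1) \<le> (1 - x) powr (- g)"
        using x g(3) by (auto intro!: powr_mono')
      moreover have "0 \<le> x powr (b - 1)" "0 \<le> (1 - x) powr (b - 1)" by auto
      ultimately have n: "\<bar>x powr (b - 1) - (1 - x) powr (b - 1)\<bar> \<le> P" unfolding P_def by linarith
      have "\<bar>fbeta' b x\<bar> = \<bar>b / (1 - b)\<bar> * (\<bar>x powr (b - 1) - (1 - x) powr (b - 1)\<bar> / S)"
        using False by (simp add: fbeta'_def S_def[symmetric] abs_mult S0)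
      also have "\<dots> \<le> \<bar>b / (1 - b)\<bar> * (P / (1/2) powr b)"
        using S h P n by (intro mult_left_mono frac_le) auto
      also have "\<dots> = c * P" by (simp add: c_def)
      also have "\<dots> \<le> max (1 / g) c * P" using P by (intro mult_right_mono) auto
      finally show ?thesis by (simp add: P_def)
    qed
  qed (use g c0 in auto)
qed

text \<open>With y^(1 - g) = y * y^(- g), the cases reduce to monotonicity of y^(- g). The negative
  power sits at b alone, so a may be 0.\<close>

lemma powr_diff_le:
  assumes "0 \<le> a" "0 < b" "0 < g" "g < (1::real)"
  shows "\<bar>a powr (1 - g) - b powr (1 - g)\<bar> \<le> \<bar>a - b\<bar> * b powr (- g)"
proof -
  have split: "y powr (1 - g) = y * y powr (- g)" if "y > 0" for y
    using that powr_add[of y 1 "- g"] by simp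
  consider "a = 0" | "0 < a" "a \<le> b" | "b < a" using assms by linarith
  then show ?thesis
  proof cases
    case 1
    then show ?thesis using assms by (simp add: split)
  next
    case 2
    have "b powr (- g) \<le> a powr (- g)" using 2 assms by (intro powr_mono2') auto
    then have "a * b powr (- g) \<le> a * a powr (- g)" using 2 by simp
    moreover have "a powr (1 - g) \<le> b powr (1 - g)" using 2 assms by (intro powr_mono2) auto
    ultimately show ?thesis using 2 assms by (simp add: split[of b] split[of a] algebra_simps)
  next
    case 3
    have "a powr (- g) \<le> b powr (- g)" using 3 assms by (intro powr_mono2') auto
    then have "a * a powr (- g) \<le> a * b powr (- g)" using 3 assms by simp
    moreover have "b powr (1 - g) \<le> a powr (1 - g)" using 3 assms by (intro powr_mono2) auto
    ultimately show ?thesis using 3 assms by (simp add: split[of b] split[of a] algebra_simps)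
  qed
qed

text \<open>Only one of the two arguments enters the singular factor, so no lower bound on the
  eigenvalues themselves is needed later.\<close>

lemma fbeta_diff_le:
  assumes "b > 1/2"
  obtains g C where "0 < g" "g < 1/2" "C \<ge> 0"
    "\<And>x y. 0 \<le> x \<Longrightarrow> x \<le> 1 \<Longrightarrow> 0 < y \<Longrightarrow> y < 1 \<Longrightarrow>
       \<bar>fbeta b x - fbeta b y\<bar> \<le> C * (\<bar>x - y\<bar> * (y powr (- g) + (1 - y) powr (- g)))"
proof -
  obtain g C where g: "0 < g" "g < 1/2" and C: "C \<ge> 0"
    "\<And>x. 0 < x \<Longrightarrow> x < 1 \<Longrightarrow> \<bar>fbeta' b x\<bar> \<le> C * (x powr (- g) + (1 - x) powr (- g))"
    using fbeta'_bound[OF assms] by blast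
  have b0: "b > 0" using assms by simp
  \<comment> \<open>The factor 2 compensates for 1 - g >= 1/2 in the derivative of H.\<close>
  define D where "D = 2 * C"
  \<comment> \<open>H has derivative 1 - g times the singular bound, so adding D * H makes both
    \<open>fbeta\<close> and its negative nondecreasing. The variation of \<open>fbeta\<close> is
    thereby bounded by that of H, up to the endpoints 0 and 1.\<close>
  define H where "H x = x powr (1 - g) - (1 - x) powr (1 - g)" for x :: real
  have mono: "s * fbeta b x + D * H x \<le> s * fbeta b y + D * H y"
    if s: "\<bar>s\<bar> = 1" and xy: "0 \<le> x" "x \<le> y" "y \<le> 1" for s x y :: real
  proof (rule DERIV_nonneg_imp_increasing_open[OF xy(2), where f = "\<lambda>x. s * fbeta b x + D * H x"])
    fix t assume t: "x < t" "t < y"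
    then have t01: "0 < t" "t < 1" using xy by auto
    define P where "P = t powr (- g) + (1 - t) powr (- g)"
    have "((\<lambda>x. x powr (1 - g)) has_real_derivative (1 - g) * t powr (- g)) (at t)"
      using t01 by (auto intro!: derivative_eq_intros)
    moreover have "((\<lambda>x. (1 - x) powr (1 - g)) has_real_derivative - ((1 - g) * (1 - t) powr (- g))) (at t)"
      using t01 by (auto intro!: derivative_eq_intros)
    ultimately have "(H has_real_derivative (1 - g) * t powr (- g) - - ((1 - g) * (1 - t) powr (- g))) (at t)"
      unfolding H_def[abs_def] by (rule DERIV_diff)
    then have "(H has_real_derivative (1 - g) * P) (at t)"
      by (rule DERIV_cong) (simp add: P_def algebra_simps)
    then have d: "((\<lambda>x. s * fbeta b x + D * H x) has_real_derivative s * fbeta' b t + D * ((1 - g) * P)) (at t)"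
      by (intro DERIV_add DERIV_cmult fbeta_deriv b0 t01)
    have "\<bar>s * fbeta' b t\<bar> \<le> C * P" using C(2)[OF t01] s by (simp add: abs_mult P_def)
    also have "\<dots> \<le> D * ((1 - g) * P)"
    proof -
      have "1 \<le> 2 * (1 - g)" using g by simp
      then have "C * P * 1 \<le> C * P * (2 * (1 - g))" using C(1) by (intro mult_left_mono) (auto simp: P_def)
      then show ?thesis by (simp add: D_def mult_ac)
    qed
    finally have "0 \<le> s * fbeta' b t + D * ((1 - g) * P)" by linarith
    with d show "\<exists>z. ((\<lambda>x. s * fbeta b x + D * H x) has_real_derivative z) (at t) \<and> 0 \<le> z" by blast
  next
    have cH: "continuous_on {x..y} H"
      unfolding H_def
      by (intro continuous_on_diff continuous_on_powr' continuous_on_id continuous_on_const; use xy g in auto)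
    have "continuous_on {x..y} (fbeta b)"
      by (rule continuous_on_subset[OF continuous_on_fbeta[OF b0]]) (use xy in auto)
    then show "continuous_on {x..y} (\<lambda>x. s * fbeta b x + D * H x)"
      by (intro continuous_intros cH)
  qed
  have le: "\<bar>fbeta b x - fbeta b y\<bar> \<le> D * \<bar>H x - H y\<bar>" if "0 \<le> x" "x \<le> y" "y \<le> 1" for x y
  proof -
    have "\<bar>fbeta b x - fbeta b y\<bar> \<le> D * (H y - H x)"
      using mono[of 1 x y] mono[of "-1" x y] that by (simp add: algebra_simps abs_le_iff)
    also have "\<dots> \<le> D * \<bar>H x - H y\<bar>" using C(1) by (intro mult_left_mono) (auto simp: D_def)
    finally show ?thesis .
  qed
  show ?thesis
  proof (rule that[of g D])
    fix x y :: real assume xy: "0 \<le> x" "x \<le> 1" "0 < y" "y < 1"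
    have "\<bar>fbeta b x - fbeta b y\<bar> \<le> D * \<bar>H x - H y\<bar>"
      using le[of x y] le[of y x] xy by (cases "x \<le> y") (auto simp: abs_minus_commute)
    also have "\<bar>H x - H y\<bar> \<le> \<bar>x powr (1 - g) - y powr (1 - g)\<bar> + \<bar>(1 - x) powr (1 - g) - (1 - y) powr (1 - g)\<bar>"
      unfolding H_def by linarith
    also have "\<dots> \<le> \<bar>x - y\<bar> * y powr (- g) + \<bar>(1 - x) - (1 - y)\<bar> * (1 - y) powr (- g)"
      using xy g by (intro add_mono powr_diff_le) auto
    also have "\<dots> = \<bar>x - y\<bar> * (y powr (- g) + (1 - y) powr (- g))"
      by (simp add: distrib_left abs_minus_commute)
    finally show "\<bar>fbeta b x - fbeta b y\<bar> \<le> D * (\<bar>x - y\<bar> * (y powr (- g) + (1 - y) powr (- g)))"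
      using C(1) by (simp add: D_def mult_left_mono)
  qed (use g C in \<open>auto simp: D_def\<close>)
qed

section \<open>Quadrature over unit cells\<close>

lemma nn_integral_unit_cells:
  fixes G :: "real \<Rightarrow> ennreal"
  assumes [measurable]: "G \<in> borel_measurable borel"
  shows "(\<integral>\<^sup>+v. indicator {0<..} v * G v \<partial>lborel) = (\<Sum>a. \<integral>\<^sup>+v. indicator {real a..<real a + 1} v * G v \<partial>lborel)"
proof -
  have cells: "(\<Sum>a. indicator {real a..<real a + 1} v :: ennreal) = indicator {0..} v" for v
  proof -
    have d: "disjoint_family (\<lambda>a. {real a..<real a + 1})"
      unfolding disjoint_family_on_def by (auto simp: set_eq_iff)
    have u: "(\<Union>a. {real a..<real a + 1}) = {0..}"
    proof (intro set_eqI iffI)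
      fix x :: real assume "x \<in> {0..}"
      then have "x \<in> {real (nat \<lfloor>x\<rfloor>)..<real (nat \<lfloor>x\<rfloor>) + 1}" by simp
      then show "x \<in> (\<Union>a. {real a..<real a + 1})" by blast
    qed auto
    show ?thesis using suminf_indicator[OF d, of v] u by simp
  qed
  have "(\<integral>\<^sup>+v. indicator {0<..} v * G v \<partial>lborel) = (\<integral>\<^sup>+v. (\<Sum>a. indicator {real a..<real a + 1} v * G v) \<partial>lborel)"
  proof (rule nn_integral_cong_AE)
    have "AE v::real in lborel. v \<noteq> 0" by (rule AE_lborel_singleton)
    then show "AE v in lborel. indicator {0<..} v * G v = (\<Sum>a. indicator {real a..<real a + 1} v * G v)"
    proof eventually_elim
      case (elim v)
      have "(\<Sum>a. indicator {real a..<real a + 1} v * G v) = indicator {0..} v * G v"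
        by (simp add: ennreal_suminf_multc cells)
      then show ?case using elim by (auto split: split_indicator)
    qed
  qed
  also have "\<dots> = (\<Sum>a. \<integral>\<^sup>+v. indicator {real a..<real a + 1} v * G v \<partial>lborel)"
    by (rule nn_integral_suminf) measurable
  finally show ?thesis .
qed

lemma nat_floor_cell: "v \<in> {real a..<real a + 1} \<Longrightarrow> nat \<lfloor>v\<rfloor> = a"
  by (simp add: nat_eq_iff floor_eq_iff)

lemma nn_integral_step:
  fixes h :: "nat \<Rightarrow> ennreal"
  shows "(\<integral>\<^sup>+v. indicator {0<..} (v::real) * h (nat \<lfloor>v\<rfloor>) \<partial>lborel) = (\<Sum>a. h a)"
proof -
  have [measurable]: "(\<lambda>v::real. h (nat \<lfloor>v\<rfloor>)) \<in> borel_measurable borel" by measurable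
  have "(\<integral>\<^sup>+v. indicator {real a..<real a + 1} v * h (nat \<lfloor>v\<rfloor>) \<partial>lborel) = h a" for a
  proof -
    have "(\<integral>\<^sup>+v. indicator {real a..<real a + 1} v * h (nat \<lfloor>v\<rfloor>) \<partial>lborel) = (\<integral>\<^sup>+v. h a * indicator {real a..<real a + 1} v \<partial>lborel)"
      by (intro nn_integral_cong) (auto split: split_indicator simp: nat_floor_cell)
    also have "\<dots> = h a" by (simp add: nn_integral_cmult)
    finally show ?thesis .
  qed
  note cell = this
  have "(\<integral>\<^sup>+v. indicator {0<..} (v::real) * h (nat \<lfloor>v\<rfloor>) \<partial>lborel)
      = (\<Sum>a. \<integral>\<^sup>+v. indicator {real a..<real a + 1} v * h (nat \<lfloor>v\<rfloor>) \<partial>lborel)"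
    by (rule nn_integral_unit_cells) measurable
  then show ?thesis unfolding cell .
qed

text \<open>On the cell of index a the map is v to 2a + 1 - v, the reflection about the midpoint,
  which preserves the cell up to its endpoints.\<close>

lemma nn_integral_cell_reflect:
  fixes G :: "real \<Rightarrow> ennreal"
  assumes [measurable]: "G \<in> borel_measurable borel"
  shows "(\<integral>\<^sup>+v. indicator {0<..} v * G (2 * real (nat \<lfloor>v\<rfloor>) + 1 - v) \<partial>lborel) = (\<integral>\<^sup>+v. indicator {0<..} v * G v \<partial>lborel)"
proof -
  have "(\<integral>\<^sup>+v. indicator {real a..<real a + 1} v * G (2 * real (nat \<lfloor>v\<rfloor>) + 1 - v) \<partial>lborel)
      = (\<integral>\<^sup>+v. indicator {real a..<real a + 1} v * G v \<partial>lborel)" for a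
  proof -
    have "(\<integral>\<^sup>+v. indicator {real a..<real a + 1} v * G v \<partial>lborel) =
       (\<integral>\<^sup>+v. indicator {real a..<real a + 1} (2 * real a + 1 + - 1 * v) * G (2 * real a + 1 + - 1 * v) \<partial>lborel)"
      by (subst nn_integral_real_affine[where c = "-1" and t = "2 * real a + 1"]) auto
    also have "\<dots> = (\<integral>\<^sup>+v. indicator {real a..<real a + 1} v * G (2 * real (nat \<lfloor>v\<rfloor>) + 1 - v) \<partial>lborel)"
    proof (rule nn_integral_cong_AE)
      have "AE v in lborel. v \<noteq> real a" "AE v in lborel. v \<noteq> real a + 1" by (rule AE_lborel_singleton)+
      then show "AE v in lborel. indicator {real a..<real a + 1} (2 * real a + 1 + - 1 * v) * G (2 * real a + 1 + - 1 * v)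
          = indicator {real a..<real a + 1} v * G (2 * real (nat \<lfloor>v\<rfloor>) + 1 - v)"
        by eventually_elim (auto split: split_indicator simp: nat_floor_cell)
    qed
    finally show ?thesis by simp
  qed
  then show ?thesis by (subst (1 2) nn_integral_unit_cells) auto
qed

text \<open>Here v is a continuous version of kap^2, and u one of x = 2 * (kap - r). The weight is
  the Jacobian, cut off at negative radius; it is what magnifies errors of order 1 / r to order
  1.\<close>

lemma nn_integral_edge_substitution:
  fixes F :: "real \<Rightarrow> ennreal"
  assumes [measurable]: "F \<in> borel_measurable borel"
  shows "(\<integral>\<^sup>+u. ennreal (max 0 (r + u / 2)) * F ((r + u / 2)\<^sup>2) \<partial>lborel) = (\<integral>\<^sup>+v. indicator {0<..} v * F v \<partial>lborel)"
proof -
  have "(\<integral>\<^sup>+v. indicator {0<..} v * F v \<partial>lborel) = (\<integral>\<^sup>+s. ennreal (2 * s) * indicator {0<..} s * F (s\<^sup>2) \<partial>lborel)"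
    by (rule nn_integral_square_substitution) measurable
  also have "\<dots> = ennreal \<bar>1 / 2\<bar> * (\<integral>\<^sup>+u. ennreal (2 * (r + 1/2 * u)) * indicator {0<..} (r + 1/2 * u) * F ((r + 1/2 * u)\<^sup>2) \<partial>lborel)"
    by (rule nn_integral_real_affine) auto
  also have "\<dots> = (\<integral>\<^sup>+u. ennreal (1 / 2) * (ennreal (2 * (r + 1/2 * u)) * indicator {0<..} (r + 1/2 * u) * F ((r + 1/2 * u)\<^sup>2)) \<partial>lborel)"
    by (subst nn_integral_cmult) auto
  also have "\<dots> = (\<integral>\<^sup>+u. ennreal (max 0 (r + u / 2)) * F ((r + u / 2)\<^sup>2) \<partial>lborel)"
  proof (rule nn_integral_cong)
    fix u
    have s: "r + 1/2 * u = r + u / 2" by simp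
    show "ennreal (1 / 2) * (ennreal (2 * (r + 1/2 * u)) * indicator {0<..} (r + 1/2 * u) * F ((r + 1/2 * u)\<^sup>2))
       = ennreal (max 0 (r + u / 2)) * F ((r + u / 2)\<^sup>2)"
    proof (cases "r + u / 2 > 0")
      case True
      have "ennreal (1 / 2) * ennreal (2 * (r + u / 2)) = ennreal (1 / 2 * (2 * (r + u / 2)))"
        by (rule ennreal_mult'[symmetric]) simp
      also have "1 / 2 * (2 * (r + u / 2)) = max 0 (r + u / 2)" using True by simp
      finally have h: "ennreal (1 / 2) * ennreal (2 * (r + u / 2)) = ennreal (max 0 (r + u / 2))" .
      have ind: "indicator {0<..} (r + u / 2) = (1 :: ennreal)" using True by simp
      show ?thesis unfolding s ind h[symmetric] by (simp only: mult_ac mult_1_right mult_1_left)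
    next
      case False
      then show ?thesis unfolding s by (simp add: max_def)
    qed
  qed
  finally show ?thesis by simp
qed

lemma abs_sqrt_diff:
  fixes x y :: real
  assumes "x \<ge> 0" "y > 0"
  shows "sqrt y * \<bar>sqrt x - sqrt y\<bar> \<le> \<bar>x - y\<bar>" and "\<bar>sqrt x - sqrt y\<bar>\<^sup>2 \<le> \<bar>x - y\<bar>"
    and "sqrt x - sqrt y = (x - y) / (sqrt x + sqrt y)"
proof -
  have xy: "x - y = (sqrt x - sqrt y) * (sqrt x + sqrt y)"
    using assms by (simp add: algebra_simps)
  then have a: "\<bar>x - y\<bar> = \<bar>sqrt x - sqrt y\<bar> * (sqrt x + sqrt y)"
    using assms by (simp add: abs_mult)
  show "sqrt y * \<bar>sqrt x - sqrt y\<bar> \<le> \<bar>x - y\<bar>"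
    unfolding a mult.commute[of "sqrt y"] using assms by (intro mult_left_mono) auto
  have "\<bar>sqrt x - sqrt y\<bar> \<le> sqrt x + sqrt y"
    using assms by (simp add: abs_le_iff)
  then show "\<bar>sqrt x - sqrt y\<bar>\<^sup>2 \<le> \<bar>x - y\<bar>"
    unfolding a power2_eq_square by (intro mult_left_mono) auto
  have "sqrt x + sqrt y > 0" using assms by (simp add: add_nonneg_pos)
  then show "sqrt x - sqrt y = (x - y) / (sqrt x + sqrt y)" using xy by (simp add: field_simps)
qed

definition cell :: "real \<Rightarrow> real \<Rightarrow> nat" where
  "cell r u = nat \<lfloor>(r + u / 2)\<^sup>2\<rfloor>"

text \<open>The value of x = 2 * (kap - r) at the index of the cell containing u; in the variable v
  this is the midpoint of the cell.\<close>

definition mid :: "real \<Rightarrow> real \<Rightarrow> real" where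
  "mid r u = 2 * (kap (cell r u) - r)"

text \<open>The point of the same cell symmetric to \<open>u\<close> about the midpoint, in the variable
  \<open>v = (r + u / 2)\<^sup>2\<close>. Averaging over the two kills the first-order quadrature error.\<close>

definition mirror :: "real \<Rightarrow> real \<Rightarrow> real" where
  "mirror r u = 2 * (sqrt (2 * real (cell r u) + 1 - (r + u / 2)\<^sup>2) - r)"

lemma cell_bounds: "real (cell r u) \<le> (r + u / 2)\<^sup>2" "(r + u / 2)\<^sup>2 < real (cell r u) + 1"
proof -
  have "real (cell r u) = of_int \<lfloor>(r + u / 2)\<^sup>2\<rfloor>" by (simp add: cell_def)
  then show "real (cell r u) \<le> (r + u / 2)\<^sup>2" "(r + u / 2)\<^sup>2 < real (cell r u) + 1" by linarith+
qed

text \<open>Both points lie within distance 1 of (r + u / 2)^2 in the variable v. Division by sqrt v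
  gives the rate that pays for the Jacobian; |sqrt x - sqrt y|^2 <= |x - y| gives the bound 2, which
  survives when r + u / 2 is small.\<close>

lemma
  assumes s: "r + u / 2 > 0"
  shows mid_close: "(r + u / 2) * \<bar>mid r u - u\<bar> \<le> 1" "\<bar>mid r u - u\<bar> \<le> 2"
    and mirror_close: "(r + u / 2) * \<bar>mirror r u - u\<bar> \<le> 2" "\<bar>mirror r u - u\<bar> \<le> 2"
    and edge_le_kap: "(r + u / 2) * (1 / kap (cell r u)) \<le> 2"
proof -
  define v where "v = (r + u / 2)\<^sup>2"
  define m where "m = real (cell r u) + 1/2"
  define w where "w = 2 * real (cell r u) + 1 - v"
  have v0: "v > 0" using s by (simp add: v_def)
  have sv: "sqrt v = r + u / 2" using s by (simp add: v_def)
  have cb: "m - 1/2 \<le> v" "v < m + 1/2" using cell_bounds[of r u] by (auto simp: v_def m_def)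
  have w0: "w \<ge> 0" "\<bar>w - v\<bar> \<le> 1" using cb by (auto simp: w_def m_def)
  have m0: "m \<ge> 1/2" by (simp add: m_def)
  have u: "u = 2 * (sqrt v - r)" by (simp add: sv)
  have mid: "mid r u - u = 2 * (sqrt m - sqrt v)" by (subst (2) u) (simp add: mid_def kap_def m_def)
  have mir: "mirror r u - u = 2 * (sqrt w - sqrt v)" by (subst (2) u) (simp add: mirror_def w_def v_def)
  have mv: "\<bar>m - v\<bar> \<le> 1/2" using cb by linarith
  have "sqrt v * \<bar>sqrt m - sqrt v\<bar> \<le> 1/2" using abs_sqrt_diff(1)[of m v] m0 v0 mv by linarith
  then show "(r + u / 2) * \<bar>mid r u - u\<bar> \<le> 1" unfolding mid sv[symmetric] abs_mult by (simp add: mult_ac)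
  have "\<bar>sqrt m - sqrt v\<bar>\<^sup>2 \<le> 1\<^sup>2" using abs_sqrt_diff(2)[of m v] m0 v0 mv by simp
  then have "\<bar>sqrt m - sqrt v\<bar> \<le> 1" by (rule power2_le_imp_le) simp
  then show "\<bar>mid r u - u\<bar> \<le> 2" unfolding mid abs_mult by simp
  have "sqrt v * \<bar>sqrt w - sqrt v\<bar> \<le> 1" using abs_sqrt_diff(1)[of w v] w0 v0 by linarith
  then show "(r + u / 2) * \<bar>mirror r u - u\<bar> \<le> 2" unfolding mir sv[symmetric] abs_mult by (simp add: mult_ac)
  have "\<bar>sqrt w - sqrt v\<bar>\<^sup>2 \<le> 1\<^sup>2" using abs_sqrt_diff(2)[of w v] w0 v0 by simp
  then have "\<bar>sqrt w - sqrt v\<bar> \<le> 1" by (rule power2_le_imp_le) simp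
  then show "\<bar>mirror r u - u\<bar> \<le> 2" unfolding mir abs_mult by simp
  have "sqrt v \<le> sqrt (4 * m)" using cb m0 by (intro real_sqrt_le_mono) linarith
  also have "\<dots> = 2 * kap (cell r u)" unfolding real_sqrt_mult by (simp add: kap_def m_def)
  finally show "(r + u / 2) * (1 / kap (cell r u)) \<le> 2"
    using kap_pos[of "cell r u"] by (simp add: sv field_simps)
qed

section \<open>Uniform Gaussian domination of the quadrature error\<close>

lemma lam_le_1:
  assumes "r \<ge> 0"
  shows "lam n k r \<le> 1"
proof -
  have *: "lam n (n + a) r \<le> 1" for n a
  proof -
    have "ennreal (lam n (n + a) r) \<le> (\<integral>\<^sup>+t. ennreal (pdens n a t) * indicator {0..} t \<partial>lborel)"
      unfolding lam_eq_nn_integral[OF assms] by (intro nn_integral_mono) (auto split: split_indicator)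
    then show ?thesis by (simp add: nn_integral_pdens)
  qed
  show ?thesis
  proof (cases "n \<le> k")
    case True
    then show ?thesis using *[of n "k - n"] by simp
  next
    case False
    then show ?thesis using *[of k "n - k"] by (simp add: lam_swap[of n k])
  qed
qed

lemma Phi_tail:
  obtains C where "C \<ge> 0" "\<And>x. x \<ge> 0 \<Longrightarrow> Phi n x \<le> C * exp (- (1/4 * x\<^sup>2))"
proof -
  obtain C where C: "C \<ge> 0" "\<And>u. hsq n u \<le> C * exp (- ((1/2 - 1/8) * u\<^sup>2))"
    using hsq_le[of "1/8" n] by auto
  define I where "I = (\<integral>u. exp (- (1/8 * (u::real)\<^sup>2)) \<partial>lborel)"
  have I: "I \<ge> 0" unfolding I_def by (intro Bochner_Integration.integral_nonneg) simp
  have "Phi n x \<le> C * I * exp (- (1/4 * x\<^sup>2))" if x: "x \<ge> 0" for x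
  proof -
    have "\<bar>\<integral>u. indicator {x<..} u * hsq n u \<partial>lborel\<bar> \<le> C * I * exp (- (1/4 * x\<^sup>2))"
      unfolding I_def
    proof (rule integral_gauss_tail_le)
      show "\<bar>hsq n u\<bar> \<le> C * exp (- ((1/4 + 1/8) * u\<^sup>2))" for u
        using C(2)[of u] hsq_nonneg[of n u] by simp
    qed (use x in auto)
    then show ?thesis unfolding Phi_eq_integral by linarith
  qed
  then show ?thesis using that[of "C * I"] C I by simp
qed

lemma Phi_shift_le:
  assumes d: "0 < d" "d < 1/4"
  obtains C where "C \<ge> 0" "\<And>x y. \<bar>y - x\<bar> \<le> 2 \<Longrightarrow> \<bar>Phi n y - Phi n x\<bar> \<le> \<bar>y - x\<bar> * (C * exp (- ((1/4 - d) * x\<^sup>2)))"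
proof -
  obtain C where C: "C \<ge> 0" "\<And>u. hsq n u \<le> C * exp (- ((1/2 - 1/4) * u\<^sup>2))"
    using hsq_le[of "1/4" n] by auto
  define M where "M = exp ((1/4)\<^sup>2 / d * 2\<^sup>2)"
  show ?thesis
  proof (rule that[of "C * M"])
    show "C * M \<ge> 0" using C by (simp add: M_def)
    fix x y :: real assume xy: "\<bar>y - x\<bar> \<le> 2"
    have "\<exists>z. \<bar>z - x\<bar> \<le> \<bar>y - x\<bar> \<and> Phi n y - Phi n x = (y - x) * (- hsq n z)"
    proof -
      have D: "\<And>t. (Phi n has_real_derivative - hsq n t) (at t)" by (rule Phi_deriv)
      consider "x = y" | "x < y" | "y < x" by linarith
      then show ?thesis
      proof cases
        case 2
        from MVT2[OF this, of "Phi n" "\<lambda>t. - hsq n t"] D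
        obtain z where "x < z" "z < y" "Phi n y - Phi n x = (y - x) * - hsq n z" by blast
        then show ?thesis by (intro exI[of _ z]) auto
      next
        case 3
        from MVT2[OF this, of "Phi n" "\<lambda>t. - hsq n t"] D
        obtain z where "y < z" "z < x" "Phi n x - Phi n y = (x - y) * - hsq n z" by blast
        then show ?thesis by (intro exI[of _ z]) (auto simp: algebra_simps)
      qed auto
    qed
    then obtain z where z: "\<bar>z - x\<bar> \<le> \<bar>y - x\<bar>" "Phi n y - Phi n x = (y - x) * (- hsq n z)" by blast
    have "hsq n z \<le> C * exp (- (1/4 * z\<^sup>2))" using C(2)[of z] by simp
    also have "\<dots> \<le> C * (M * exp (- ((1/4 - d) * x\<^sup>2)))"
      unfolding M_def using z(1) xy d C(1) by (intro mult_left_mono gauss_shift_le) auto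
    finally have "hsq n z \<le> C * M * exp (- ((1/4 - d) * x\<^sup>2))" by simp
    then have "\<bar>y - x\<bar> * hsq n z \<le> \<bar>y - x\<bar> * (C * M * exp (- ((1/4 - d) * x\<^sup>2)))" by (intro mult_left_mono) auto
    then show "\<bar>Phi n y - Phi n x\<bar> \<le> \<bar>y - x\<bar> * (C * M * exp (- ((1/4 - d) * x\<^sup>2)))"
      unfolding z(2) by (simp add: abs_mult hsq_nonneg)
  qed
qed

text \<open>The discrepancy between sum and integral, pulled back from v to u. Averaging over a
  point and its mirror leaves the integral unchanged by
  \<open>nn_integral_cell_reflect\<close>.\<close>

definition edge_diff :: "nat \<Rightarrow> real \<Rightarrow> real \<Rightarrow> real \<Rightarrow> real" where
  "edge_diff n b r u = max 0 (r + u / 2) * (fbeta b (lam n (n + cell r u) r)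
     - (fbeta b (Phi n u) + fbeta b (Phi n (mirror r u))) / 2)"

text \<open>For u >= 0 this compares with \<open>fbeta b 0 = 0\<close> through
  \<open>fbeta_diff_le\<close>, so that the decay of \<open>Phi\<close> competes with its singular
  factor; the other side follows by symmetry.\<close>

lemma fbeta_Phi_le:
  assumes "b > 1/2"
  obtains C d where "C \<ge> 0" "d > 0" "\<And>u. fbeta b (Phi n u) \<le> C * exp (- (d * u\<^sup>2))"
proof -
  obtain g C where g: "0 < g" "g < 1/2" and C: "C \<ge> 0"
    "\<And>x y. 0 \<le> x \<Longrightarrow> x \<le> 1 \<Longrightarrow> 0 < y \<Longrightarrow> y < 1 \<Longrightarrow>
       \<bar>fbeta b x - fbeta b y\<bar> \<le> C * (\<bar>x - y\<bar> * (y powr (- g) + (1 - y) powr (- g)))"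
    using fbeta_diff_le[OF assms] by blast
  \<comment> \<open>Chosen so that 1/4 - (g / 2 + d) = d.\<close>
  define d where "d = (1/2 - g) / 4"
  have d: "d > 0" using g by (simp add: d_def)
  obtain P where P: "P \<ge> 0" "\<And>x. Phi n x powr (- g) + (1 - Phi n x) powr (- g) \<le> P * exp ((g / 2 + d) * x\<^sup>2)"
    using Phi_powr_le[OF g(1) d] by blast
  obtain T where T: "T \<ge> 0" "\<And>x. x \<ge> 0 \<Longrightarrow> Phi n x \<le> T * exp (- (1/4 * x\<^sup>2))"
    using Phi_tail[of n] by blast
  have pos: "fbeta b (Phi n u) \<le> C * (T * P) * exp (- (d * u\<^sup>2))" if u: "u \<ge> 0" for u
  proof -
    have "fbeta b (Phi n u) \<le> \<bar>fbeta b 0 - fbeta b (Phi n u)\<bar>" by (simp add: fbeta_0)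
    also have "\<dots> \<le> C * (\<bar>0 - Phi n u\<bar> * (Phi n u powr (- g) + (1 - Phi n u) powr (- g)))"
      using Phi_pos Phi_less_1 by (intro C(2)) auto
    also have "\<dots> \<le> C * ((T * exp (- (1/4 * u\<^sup>2))) * (P * exp ((g / 2 + d) * u\<^sup>2)))"
      using T(2)[OF u] P(2)[of u] C(1) T(1) Phi_pos[of n u] by (intro mult_left_mono mult_mono) auto
    also have "\<dots> = C * (T * P) * (exp (- (1/4 * u\<^sup>2)) * exp ((g / 2 + d) * u\<^sup>2))" by (simp add: mult_ac)
    also have "exp (- (1/4 * u\<^sup>2)) * exp ((g / 2 + d) * u\<^sup>2) = exp (- (d * u\<^sup>2))"
      unfolding exp_add[symmetric] by (simp add: d_def field_simps)
    finally show ?thesis .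
  qed
  have "fbeta b (Phi n u) \<le> C * (T * P) * exp (- (d * u\<^sup>2))" for u
  proof (cases "u \<ge> 0")
    case False
    have "fbeta b (Phi n u) = fbeta b (Phi n (- u))" by (simp add: Phi_minus fbeta_sym)
    then show ?thesis using pos[of "- u"] False by simp
  qed (rule pos)
  then show ?thesis using that[of "C * (T * P)" d] C(1) T(1) P(1) d by simp
qed

text \<open>The Jacobian is paid for by the factor 1 / kap in the comparison of \<open>lam\<close>
  with \<open>Phi\<close> and by the displacement bounds for \<open>mid\<close> and
  \<open>mirror\<close>; hence the bound is uniform in r.\<close>

lemma edge_diff_dominated:
  assumes "b > 1/2"
  obtains C d where "C \<ge> 0" "d > 0" "\<And>r u. r \<ge> 0 \<Longrightarrow> \<bar>edge_diff n b r u\<bar> \<le> C * exp (- (d * u\<^sup>2))"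
proof -
  obtain g C where g: "0 < g" "g < 1/2" and C: "C \<ge> 0"
    "\<And>x y. 0 \<le> x \<Longrightarrow> x \<le> 1 \<Longrightarrow> 0 < y \<Longrightarrow> y < 1 \<Longrightarrow>
       \<bar>fbeta b x - fbeta b y\<bar> \<le> C * (\<bar>x - y\<bar> * (y powr (- g) + (1 - y) powr (- g)))"
    using fbeta_diff_le[OF assms] by blast
  \<comment> \<open>Then 1/4 - g / 2 = 2 * d. The Gaussian factor E loses d / 2 of the rate, the
    singular factor another d / 2, and d remains. For \<open>lam\<close> the loss is split into d /
    4 for the comparison at \<open>mid\<close> and d / 4 for moving from \<open>mid\<close> to
    u.\<close>
  define d where "d = (1/2 - g) / 4"
  have d: "0 < d" "d < 1/4" "0 < d / 2" "d / 2 < 1/4" "0 < d / 4" "d / 4 \<le> 1/4" using g by (auto simp: d_def)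
  obtain P where P: "P \<ge> 0" "\<And>x. Phi n x powr (- g) + (1 - Phi n x) powr (- g) \<le> P * exp ((g / 2 + d / 2) * x\<^sup>2)"
    using Phi_powr_le[OF g(1) d(3)] by blast
  obtain S where S: "S \<ge> 0" "\<And>x y. \<bar>y - x\<bar> \<le> 2 \<Longrightarrow> \<bar>Phi n y - Phi n x\<bar> \<le> \<bar>y - x\<bar> * (S * exp (- ((1/4 - d / 2) * x\<^sup>2)))"
    using Phi_shift_le[OF d(3,4)] by blast
  obtain L where L: "L \<ge> 0" "\<And>a r. r \<ge> 0 \<Longrightarrow>
    \<bar>lam n (n + a) r - Phi n (2 * (kap a - r))\<bar> \<le> 1 / kap a * (L * exp (- ((1/4 - d / 4) * (2 * (kap a - r))\<^sup>2)))"
    using lam_Phi_diff_le[OF d(5,6)] by blast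
  define M where "M = exp ((1/4 - d / 4)\<^sup>2 / (d / 4) * 2\<^sup>2)"
  \<comment> \<open>The factor 2 is the bound in \<open>edge_le_kap\<close>; 3 = 1 + 2 collects the
    displacement constants of \<open>mid\<close> and \<open>mirror\<close>.\<close>
  define R where "R = 2 * (L * M) + 3 * S"
  have R: "R \<ge> 0" using L(1) S(1) by (simp add: R_def M_def)
  have "\<bar>edge_diff n b r u\<bar> \<le> C * (R * P) * exp (- (d * u\<^sup>2))" if r: "r \<ge> 0" for r u
  proof (cases "r + u / 2 > 0")
    case False
    then show ?thesis using C(1) R P(1) by (simp add: edge_diff_def max_def)
  next
    case True
    define s where "s = r + u / 2"
    define l where "l = lam n (n + cell r u) r"
    define E where "E = exp (- ((1/4 - d / 2) * u\<^sup>2))"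
    define Q where "Q = Phi n u powr (- g) + (1 - Phi n u) powr (- g)"
    have s: "s > 0" using True by (simp add: s_def)
    have Q: "Q \<ge> 0" by (simp add: Q_def)
    note close = mid_close[OF True, folded s_def] mirror_close[OF True, folded s_def] edge_le_kap[OF True, folded s_def]
    have l01: "0 \<le> l" "l \<le> 1" unfolding l_def by (auto intro: lam_nonneg lam_le_1 r)
    have "\<bar>l - Phi n (mid r u)\<bar> \<le> 1 / kap (cell r u) * (L * exp (- ((1/4 - d / 4) * (mid r u)\<^sup>2)))"
      unfolding l_def mid_def by (rule L(2)[OF r])
    also have "\<dots> \<le> 1 / kap (cell r u) * (L * (M * exp (- ((1/4 - d / 4 - d / 4) * u\<^sup>2))))"
      unfolding M_def using close(2) d L(1) kap_pos[of "cell r u"]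
      by (intro mult_left_mono gauss_shift_le) auto
    also have "1/4 - d / 4 - d / 4 = 1/4 - d / 2" by simp
    finally have "\<bar>l - Phi n (mid r u)\<bar> \<le> 1 / kap (cell r u) * (L * (M * E))"
      by (simp only: E_def)
    then have "s * \<bar>l - Phi n (mid r u)\<bar> \<le> s * (1 / kap (cell r u) * (L * (M * E)))"
      using s by (intro mult_left_mono) auto
    also have "\<dots> = (s * (1 / kap (cell r u))) * (L * (M * E))" by (simp only: mult.assoc)
    also have "\<dots> \<le> 2 * (L * (M * E))"
      using close(5) L(1) by (intro mult_right_mono) (auto simp: M_def E_def)
    finally have b1: "s * \<bar>l - Phi n (mid r u)\<bar> \<le> 2 * (L * (M * E))" .
    have shift: "s * \<bar>Phi n y - Phi n u\<bar> \<le> k * (S * E)" if y: "\<bar>y - u\<bar> \<le> 2" "s * \<bar>y - u\<bar> \<le> k" for y k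
    proof -
      have "s * \<bar>Phi n y - Phi n u\<bar> \<le> s * (\<bar>y - u\<bar> * (S * E))"
        unfolding E_def using s by (intro mult_left_mono S(2) y) auto
      also have "\<dots> = (s * \<bar>y - u\<bar>) * (S * E)" by (simp only: mult.assoc)
      also have "\<dots> \<le> k * (S * E)" using y(2) S(1) by (intro mult_right_mono) (auto simp: E_def)
      finally show ?thesis .
    qed
    have "s * (\<bar>l - Phi n u\<bar> + \<bar>Phi n (mirror r u) - Phi n u\<bar>)
       \<le> s * \<bar>l - Phi n (mid r u)\<bar> + s * \<bar>Phi n (mid r u) - Phi n u\<bar> + s * \<bar>Phi n (mirror r u) - Phi n u\<bar>"
      unfolding distrib_left[symmetric] using s by (intro mult_left_mono) auto
    also have "\<dots> \<le> 2 * (L * (M * E)) + 1 * (S * E) + 2 * (S * E)"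
      by (intro add_mono b1 shift close)
    also have "\<dots> = R * E" by (simp add: R_def algebra_simps)
    finally have b2: "s * (\<bar>l - Phi n u\<bar> + \<bar>Phi n (mirror r u) - Phi n u\<bar>) \<le> R * E" .
    have f1: "\<bar>fbeta b l - fbeta b (Phi n u)\<bar> \<le> C * (\<bar>l - Phi n u\<bar> * Q)"
      unfolding Q_def by (intro C(2) l01 Phi_pos Phi_less_1)
    have f2: "\<bar>fbeta b (Phi n (mirror r u)) - fbeta b (Phi n u)\<bar> \<le> C * (\<bar>Phi n (mirror r u) - Phi n u\<bar> * Q)"
      unfolding Q_def by (intro C(2) less_imp_le Phi_pos Phi_less_1)
    have tri: "\<bar>A - (B + D) / 2\<bar> \<le> \<bar>A - B\<bar> + \<bar>D - B\<bar>" for A B D :: real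
    proof -
      have "A - (B + D) / 2 = (A - B) - (D - B) / 2" by (simp add: field_simps)
      then have h: "\<bar>A - (B + D) / 2\<bar> \<le> \<bar>A - B\<bar> + \<bar>(D - B) / 2\<bar>" by (simp only: abs_triangle_ineq4)
      have "\<bar>(D - B) / 2\<bar> \<le> \<bar>D - B\<bar>" unfolding abs_divide by simp
      then show ?thesis by (rule order_trans[OF h add_left_mono])
    qed
    have "\<bar>edge_diff n b r u\<bar> = s * \<bar>fbeta b l - (fbeta b (Phi n u) + fbeta b (Phi n (mirror r u))) / 2\<bar>"
      using s by (simp add: edge_diff_def s_def[symmetric] l_def[symmetric] abs_mult)
    also have "\<dots> \<le> s * (\<bar>fbeta b l - fbeta b (Phi n u)\<bar> + \<bar>fbeta b (Phi n (mirror r u)) - fbeta b (Phi n u)\<bar>)"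
      using s by (intro mult_left_mono tri) auto
    also have "\<dots> \<le> s * (C * (\<bar>l - Phi n u\<bar> * Q) + C * (\<bar>Phi n (mirror r u) - Phi n u\<bar> * Q))"
      using s by (intro mult_left_mono add_mono f1 f2) auto
    also have "\<dots> = C * ((s * (\<bar>l - Phi n u\<bar> + \<bar>Phi n (mirror r u) - Phi n u\<bar>)) * Q)"
      by (simp only: distrib_left distrib_right mult_ac)
    also have "\<dots> \<le> C * ((R * E) * (P * exp ((g / 2 + d / 2) * u\<^sup>2)))"
      using C(1) Q R by (intro mult_left_mono mult_mono[OF b2 P(2)[of u, folded Q_def]]) (auto simp: E_def)
    also have "\<dots> = C * (R * P) * (E * exp ((g / 2 + d / 2) * u\<^sup>2))" by (simp only: mult_ac)
    also have "E * exp ((g / 2 + d / 2) * u\<^sup>2) = exp (- (d * u\<^sup>2))"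
      unfolding E_def exp_add[symmetric] by (simp add: d_def field_simps)
    finally show ?thesis .
  qed
  then show ?thesis using that[of "C * (R * P)" d] C(1) R P(1) d(1) by simp
qed

text \<open>A first-order expansion under a growing weight W, valid as long as W * (X - p) stays
  bounded. Caratheodory's form of the derivative also covers X r = p.\<close>

lemma DERIV_scaled_tendsto:
  fixes h :: "real \<Rightarrow> real"
  assumes D: "(h has_real_derivative D) (at p)" and X: "(X \<longlongrightarrow> p) F"
    and B: "\<forall>\<^sub>F r in F. \<bar>W r * (X r - p)\<bar> \<le> B"
  shows "((\<lambda>r. W r * (h (X r) - h p) - D * (W r * (X r - p))) \<longlongrightarrow> 0) F"
proof -
  obtain q where q: "\<And>z. h z - h p = q z * (z - p)" "isCont q p" "q p = D"
    using D unfolding CARAT_DERIV by blast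
  have "((\<lambda>r. q (X r) - D) \<longlongrightarrow> q p - D) F"
    by (intro tendsto_diff tendsto_const isCont_tendsto_compose[OF q(2) X])
  then have l: "((\<lambda>r. q (X r) - D) \<longlongrightarrow> 0) F" by (simp add: q(3))
  have "((\<lambda>r. B * \<bar>q (X r) - D\<bar>) \<longlongrightarrow> B * 0) F"
    by (intro tendsto_mult tendsto_const tendsto_rabs_zero l)
  then have lB: "((\<lambda>r. B * \<bar>q (X r) - D\<bar>) \<longlongrightarrow> 0) F" by simp
  have "((\<lambda>r. \<bar>W r * (h (X r) - h p) - D * (W r * (X r - p))\<bar>) \<longlongrightarrow> 0) F"
  proof (rule tendsto_sandwich[OF _ _ tendsto_const lB])
    show "\<forall>\<^sub>F r in F. \<bar>W r * (h (X r) - h p) - D * (W r * (X r - p))\<bar> \<le> B * \<bar>q (X r) - D\<bar>"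
      using B
    proof eventually_elim
      case (elim r)
      have "W r * (h (X r) - h p) - D * (W r * (X r - p)) = (W r * (X r - p)) * (q (X r) - D)"
        unfolding q(1) by (simp add: algebra_simps)
      then show ?case using elim by (simp add: abs_mult mult_right_mono)
    qed
  qed simp
  then show ?thesis by (rule tendsto_rabs_zero_cancel)
qed

section \<open>Pointwise limit of the quadrature error\<close>

lemma edge_at_top: "filterlim (\<lambda>r. r + u / 2) at_top (at_top :: real filter)"
  using filterlim_tendsto_add_at_top[OF tendsto_const filterlim_ident, of "u / 2"] by (simp add: add.commute)

lemma edge_pos: "\<forall>\<^sub>F r in at_top. r + u / 2 > (0::real)"
  using edge_at_top[of u] by (simp add: filterlim_at_top_dense)

lemma tendsto_of_scaled_bound:
  fixes X :: "real \<Rightarrow> real"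
  assumes "\<forall>\<^sub>F r in at_top. (r + u / 2) * \<bar>X r - p\<bar> \<le> B"
  shows "(X \<longlongrightarrow> p) at_top"
proof -
  have l: "((\<lambda>r. B / (r + u / 2)) \<longlongrightarrow> 0) at_top"
    by (rule tendsto_divide_0[OF tendsto_const filterlim_at_top_imp_at_infinity[OF edge_at_top]])
  have "((\<lambda>r. \<bar>X r - p\<bar>) \<longlongrightarrow> 0) at_top"
  proof (rule tendsto_sandwich[OF _ _ tendsto_const l])
    show "\<forall>\<^sub>F r in at_top. \<bar>X r - p\<bar> \<le> B / (r + u / 2)"
      using assms edge_pos[of u] by eventually_elim (simp add: field_simps)
  qed simp
  then show ?thesis by (rule LIM_zero_cancel[OF tendsto_rabs_zero_cancel])
qed

lemma mid_tendsto: "((\<lambda>r. mid r u) \<longlongrightarrow> u) at_top"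
proof (rule tendsto_of_scaled_bound)
  show "\<forall>\<^sub>F r in at_top. (r + u / 2) * \<bar>mid r u - u\<bar> \<le> 1"
    using edge_pos[of u] by eventually_elim (rule mid_close)
qed

lemma mirror_tendsto: "((\<lambda>r. mirror r u) \<longlongrightarrow> u) at_top"
proof (rule tendsto_of_scaled_bound)
  show "\<forall>\<^sub>F r in at_top. (r + u / 2) * \<bar>mirror r u - u\<bar> \<le> 2"
    using edge_pos[of u] by eventually_elim (rule mirror_close)
qed

lemma edge_ratio_tendsto:
  fixes X :: "real \<Rightarrow> real"
  assumes X: "(X \<longlongrightarrow> u) at_top"
  shows "((\<lambda>r. (r + u / 2) / (r + X r / 2 + (r + u / 2))) \<longlongrightarrow> 1/2) at_top"
    and "((\<lambda>r. (r + u / 2) / (r + X r / 2)) \<longlongrightarrow> 1) at_top"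
proof -
  have "((\<lambda>r. (X r - u) / 2 / (r + u / 2)) \<longlongrightarrow> 0) at_top"
  proof (rule tendsto_divide_0)
    show "((\<lambda>r. (X r - u) / 2) \<longlongrightarrow> (u - u) / 2) at_top" by (intro tendsto_intros X) auto
  qed (rule filterlim_at_top_imp_at_infinity[OF edge_at_top])
  then have q: "((\<lambda>r. 1 + (X r - u) / 2 / (r + u / 2)) \<longlongrightarrow> 1 + 0) at_top"
    by (intro tendsto_add tendsto_const)
  have ev: "\<forall>\<^sub>F r in at_top. 1 + (X r - u) / 2 / (r + u / 2) = (r + X r / 2) / (r + u / 2)"
    using edge_pos[of u] by eventually_elim (simp add: field_simps)
  have "((\<lambda>r. 1 / (1 + (X r - u) / 2 / (r + u / 2))) \<longlongrightarrow> 1 / (1 + 0)) at_top"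
    by (intro tendsto_divide tendsto_const q) simp
  then have "((\<lambda>r. 1 / (1 + (X r - u) / 2 / (r + u / 2))) \<longlongrightarrow> 1) at_top" by simp
  then show "((\<lambda>r. (r + u / 2) / (r + X r / 2)) \<longlongrightarrow> 1) at_top"
  proof (rule Lim_transform_eventually)
    show "\<forall>\<^sub>F r in at_top. 1 / (1 + (X r - u) / 2 / (r + u / 2)) = (r + u / 2) / (r + X r / 2)"
      using ev
    proof eventually_elim
      case (elim r)
      show ?case unfolding elim by simp
    qed
  qed
  have "((\<lambda>r. 1 / ((1 + (X r - u) / 2 / (r + u / 2)) + 1)) \<longlongrightarrow> 1 / ((1 + 0) + 1)) at_top"
    by (intro tendsto_divide tendsto_add tendsto_const q) simp
  then have "((\<lambda>r. 1 / ((1 + (X r - u) / 2 / (r + u / 2)) + 1)) \<longlongrightarrow> 1/2) at_top" by simp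
  then show "((\<lambda>r. (r + u / 2) / (r + X r / 2 + (r + u / 2))) \<longlongrightarrow> 1/2) at_top"
  proof (rule Lim_transform_eventually)
    show "\<forall>\<^sub>F r in at_top. 1 / ((1 + (X r - u) / 2 / (r + u / 2)) + 1) = (r + u / 2) / (r + X r / 2 + (r + u / 2))"
      using ev edge_pos[of u]
    proof eventually_elim
      case (elim r)
      have "a / s + 1 = (a + s) / s" if "s > 0" for a s :: real
        using that by (simp add: add_divide_distrib)
      from this[OF elim(2), of "r + X r / 2"] show ?case unfolding elim(1) by simp
    qed
  qed
qed

text \<open>In the variable v the displacement of the mirror point is exactly twice that of the
  midpoint. After the square roots, the two denominators have ratio tending to 1.\<close>

lemma mid_mirror_cancel:
  "((\<lambda>r. (r + u / 2) * (mid r u - u) - (r + u / 2) * (mirror r u - u) / 2) \<longlongrightarrow> 0) at_top"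
proof -
  define t where "t r = real (cell r u) + 1/2 - (r + u / 2)\<^sup>2" for r
  define A where "A r = (r + u / 2) / (r + mid r u / 2 + (r + u / 2))" for r
  define B where "B r = (r + u / 2) / (r + mirror r u / 2 + (r + u / 2))" for r
  have tb: "\<bar>t r\<bar> \<le> 1" for r using cell_bounds[of r u] unfolding t_def by linarith
  have "((\<lambda>r. A r - B r) \<longlongrightarrow> 1/2 - 1/2) at_top"
    unfolding A_def B_def by (intro tendsto_diff edge_ratio_tendsto(1) mid_tendsto mirror_tendsto)
  then have "((\<lambda>r. A r - B r) \<longlongrightarrow> 0) at_top" by simp
  from tendsto_mult[OF tendsto_const[of 2] tendsto_rabs_zero[OF this]]
  have l: "((\<lambda>r. 2 * \<bar>A r - B r\<bar>) \<longlongrightarrow> 0) at_top" by simp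
  have "((\<lambda>r. \<bar>2 * t r * (A r - B r)\<bar>) \<longlongrightarrow> 0) at_top"
  proof (rule tendsto_sandwich[OF _ _ tendsto_const l])
    show "\<forall>\<^sub>F r in at_top. \<bar>2 * t r * (A r - B r)\<bar> \<le> 2 * \<bar>A r - B r\<bar>"
      using tb by (intro always_eventually allI) (simp add: abs_mult mult_left_le_one_le)
  qed simp
  then have "((\<lambda>r. 2 * t r * (A r - B r)) \<longlongrightarrow> 0) at_top" by (rule tendsto_rabs_zero_cancel)
  then show ?thesis
  proof (rule Lim_transform_eventually)
    show "\<forall>\<^sub>F r in at_top. 2 * t r * (A r - B r) = (r + u / 2) * (mid r u - u) - (r + u / 2) * (mirror r u - u) / 2"
      using edge_pos[of u]
    proof eventually_elim
      case (elim r)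
      define s where "s = r + u / 2"
      define m where "m = real (cell r u) + 1/2"
      define w where "w = 2 * real (cell r u) + 1 - s\<^sup>2"
      have s: "s > 0" "sqrt (s\<^sup>2) = s" using elim by (auto simp: s_def)
      have w0: "w \<ge> 0" using cell_bounds[of r u] by (simp add: w_def s_def)
      have sm: "r + mid r u / 2 = sqrt m" by (simp add: mid_def kap_def m_def diff_divide_distrib)
      have sw: "r + mirror r u / 2 = sqrt w" by (simp add: mirror_def w_def s_def diff_divide_distrib)
      have d1: "mid r u - u = 2 * (sqrt m - s)" using sm by (simp add: s_def)
      have d2: "mirror r u - u = 2 * (sqrt w - s)" using sw by (simp add: s_def)
      have e1: "sqrt m - s = (m - s\<^sup>2) / (sqrt m + s)" using abs_sqrt_diff(3)[of m "s\<^sup>2"] s by (simp add: m_def)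
      have e2: "sqrt w - s = (w - s\<^sup>2) / (sqrt w + s)" using abs_sqrt_diff(3)[of w "s\<^sup>2"] s w0 by simp
      have t: "t r = m - s\<^sup>2" "w - s\<^sup>2 = 2 * t r" by (auto simp: t_def m_def w_def s_def)
      show ?case
      proof -
        have "2 * c * (s / x - s / y) = s * (2 * (c / x)) - s * (2 * (2 * c / y)) / 2" for c x y :: real
          by (simp add: algebra_simps)
        then show ?thesis
          unfolding A_def B_def sm sw d1 d2 s_def[symmetric] e1 e2 t(2) t(1)[symmetric] .
      qed
    qed
  qed
qed

lemma cell_at_top: "filterlim (\<lambda>r. cell r u) at_top at_top"
  unfolding filterlim_at_top
proof
  fix N :: nat
  have "filterlim (\<lambda>r. (r + u / 2)\<^sup>2) at_top at_top"
    by (intro filterlim_pow_at_top edge_at_top) simp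
  then have "\<forall>\<^sub>F r in at_top. real N + 1 \<le> (r + u / 2)\<^sup>2" by (simp add: filterlim_at_top)
  then show "\<forall>\<^sub>F r in at_top. N \<le> cell r u"
  proof eventually_elim
    case (elim r)
    then show ?case using cell_bounds(2)[of r u] by linarith
  qed
qed

text \<open>All terms are expanded to first order around u and multiplied by s = r + u / 2. The
  contributions of \<open>mid\<close> and \<open>mirror\<close> cancel, and only the deviation of
  \<open>lam\<close> from \<open>Phi\<close> at the cell midpoint survives.\<close>

lemma edge_diff_tendsto:
  assumes b: "b > 0"
  shows "((\<lambda>r. edge_diff n b r u) \<longlongrightarrow> fbeta' b (Phi n u) * corr n u) at_top"
proof -
  define p where "p = Phi n u"
  define s where "s r = r + u / 2" for r
  define l where "l r = lam n (n + cell r u) r" for r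
  define D where "D = fbeta' b p"
  have sp: "\<forall>\<^sub>F r in at_top. s r > 0" unfolding s_def by (rule edge_pos)
  have p01: "0 < p" "p < 1" by (auto simp: p_def Phi_pos Phi_less_1)
  have Df: "(fbeta b has_real_derivative D) (at p)" unfolding D_def by (rule fbeta_deriv[OF b p01])
  have Dp: "(Phi n has_real_derivative - hsq n u) (at u)" by (rule Phi_deriv)
  have Dg: "((\<lambda>u. fbeta b (Phi n u)) has_real_derivative D * (- hsq n u)) (at u)"
    using DERIV_chain2[OF Df[unfolded p_def] Dp] by simp
  have mb: "\<forall>\<^sub>F r in at_top. \<bar>s r * (mid r u - u)\<bar> \<le> 1"
    using sp by eventually_elim (use mid_close in \<open>simp add: abs_mult s_def\<close>)
  have rb: "\<forall>\<^sub>F r in at_top. \<bar>s r * (mirror r u - u)\<bar> \<le> 2"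
    using sp by eventually_elim (use mirror_close in \<open>simp add: abs_mult s_def\<close>)
  have K: "((\<lambda>r. (l r - Phi n (mid r u)) * kap (cell r u)) \<longlongrightarrow> corr n u) at_top"
    unfolding l_def mid_def
    by (rule lam_Phi_diff_tendsto[OF cell_at_top]) (use mid_tendsto[of u] in \<open>simp add: mid_def\<close>)
  have kr: "r + mid r u / 2 = kap (cell r u)" for r by (simp add: mid_def diff_divide_distrib)
  have "((\<lambda>r. s r / kap (cell r u)) \<longlongrightarrow> 1) at_top"
    using edge_ratio_tendsto(2)[OF mid_tendsto[of u]] unfolding kr s_def .
  from tendsto_mult[OF this K]
  have i: "((\<lambda>r. s r * (l r - Phi n (mid r u))) \<longlongrightarrow> corr n u) at_top"
    using kap_pos by (simp add: less_imp_neq[symmetric])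
  have ii: "((\<lambda>r. s r * (Phi n (mid r u) - p) - (- hsq n u) * (s r * (mid r u - u))) \<longlongrightarrow> 0) at_top"
    unfolding p_def by (rule DERIV_scaled_tendsto[OF Dp mid_tendsto mb])
  have iv: "((\<lambda>r. s r * (fbeta b (Phi n (mirror r u)) - fbeta b p) - (D * (- hsq n u)) * (s r * (mirror r u - u))) \<longlongrightarrow> 0) at_top"
    unfolding p_def by (rule DERIV_scaled_tendsto[OF Dg mirror_tendsto rb])
  \<comment> \<open>Boundedness of s * (l - p) is the condition for expanding \<open>fbeta\<close>
    at the eigenvalue itself; it also gives convergence of l to p.\<close>
  have lb: "\<forall>\<^sub>F r in at_top. \<bar>s r * (l r - p)\<bar> \<le> (\<bar>corr n u\<bar> + 1) + (1 + \<bar>hsq n u\<bar>)"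
  proof -
    have e1: "\<forall>\<^sub>F r in at_top. \<bar>s r * (l r - Phi n (mid r u)) - corr n u\<bar> < 1"
      using tendstoD[OF i, of 1] by (simp add: dist_real_def)
    have e2: "\<forall>\<^sub>F r in at_top. \<bar>s r * (Phi n (mid r u) - p) - (- hsq n u) * (s r * (mid r u - u))\<bar> < 1"
      using tendstoD[OF ii, of 1] by (simp add: dist_real_def)
    show ?thesis using e1 e2 mb
    proof eventually_elim
      case (elim r)
      have "\<bar>hsq n u * (s r * (mid r u - u))\<bar> \<le> \<bar>hsq n u\<bar> * 1"
        unfolding abs_mult[of "hsq n u"] using elim(3) by (intro mult_left_mono) auto
      moreover have "s r * (l r - p) = s r * (l r - Phi n (mid r u)) + s r * (Phi n (mid r u) - p)"
        by (simp add: algebra_simps)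
      ultimately show ?case using elim(1,2) by linarith
    qed
  qed
  have ll: "(l \<longlongrightarrow> p) at_top"
  proof (rule tendsto_of_scaled_bound)
    show "\<forall>\<^sub>F r in at_top. (r + u / 2) * \<bar>l r - p\<bar> \<le> (\<bar>corr n u\<bar> + 1) + (1 + \<bar>hsq n u\<bar>)"
      using lb sp by eventually_elim (simp add: abs_mult s_def)
  qed
  have iii: "((\<lambda>r. s r * (fbeta b (l r) - fbeta b p) - D * (s r * (l r - p))) \<longlongrightarrow> 0) at_top"
    by (rule DERIV_scaled_tendsto[OF Df ll lb])
  have v: "((\<lambda>r. s r * (mid r u - u) - s r * (mirror r u - u) / 2) \<longlongrightarrow> 0) at_top"
    unfolding s_def by (rule mid_mirror_cancel)
  \<comment> \<open>Here x is the weight s and c is minus the Hermite density. The left side lists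
    the Taylor remainders iii, ii and iv, the term i with limit \<open>corr n u\<close>, and the
    cancelling displacements v.\<close>
  have "x * (A - B) - D * (x * (y - q)) + D * (x * (y - z)) + D * (x * (z - q) - c * d)
      - (x * (E - B) - D * c * e) / 2 + D * c * (d - e / 2) = x * (A - (B + E) / 2)" for x A B y q z c d E e :: real
    by (simp add: field_simps)
  note collect = this
  have "((\<lambda>r. (s r * (fbeta b (l r) - fbeta b p) - D * (s r * (l r - p)))
      + D * (s r * (l r - Phi n (mid r u)))
      + D * (s r * (Phi n (mid r u) - p) - (- hsq n u) * (s r * (mid r u - u)))
      - (s r * (fbeta b (Phi n (mirror r u)) - fbeta b p) - (D * (- hsq n u)) * (s r * (mirror r u - u))) / 2
      + D * (- hsq n u) * (s r * (mid r u - u) - s r * (mirror r u - u) / 2))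
     \<longlongrightarrow> 0 + D * corr n u + D * 0 - 0 / 2 + D * (- hsq n u) * 0) at_top"
    by (intro tendsto_add tendsto_diff tendsto_mult tendsto_divide tendsto_const iii i ii iv v) auto
  then have "((\<lambda>r. s r * (fbeta b (l r) - (fbeta b p + fbeta b (Phi n (mirror r u))) / 2)) \<longlongrightarrow> D * corr n u) at_top"
    unfolding collect by simp
  then show ?thesis unfolding D_def p_def
  proof (rule Lim_transform_eventually)
    show "\<forall>\<^sub>F r in at_top. s r * (fbeta b (l r) - (fbeta b (Phi n u) + fbeta b (Phi n (mirror r u))) / 2) = edge_diff n b r u"
      using sp by eventually_elim (simp add: edge_diff_def s_def l_def)
  qed
qed

section \<open>Integration of the error and assembly of the trace\<close>

lemma borel_measurable_fbeta[measurable]: "fbeta b \<in> borel_measurable borel"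
  unfolding fbeta_def by measurable

lemma borel_measurable_mirror[measurable]: "mirror r \<in> borel_measurable borel"
  unfolding mirror_def cell_def by measurable

lemma borel_measurable_cell[measurable]: "(\<lambda>u. h (cell r u)) \<in> borel_measurable borel" for h :: "nat \<Rightarrow> real"
  unfolding cell_def by measurable

lemma borel_measurable_edge_diff[measurable]: "edge_diff n b r \<in> borel_measurable borel"
proof -
  have [measurable]: "(\<lambda>u. fbeta b (lam n (n + cell r u) r)) \<in> borel_measurable borel"
    by (rule borel_measurable_cell[where h = "\<lambda>a. fbeta b (lam n (n + a) r)"])
  show ?thesis unfolding edge_diff_def by measurable
qed

lemma integral_edge_diff_tendsto:
  assumes b: "b > 1/2"
  shows "((\<lambda>r. \<integral>u. edge_diff n b r u \<partial>lborel) \<longlongrightarrow> 0) at_top"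
proof -
  obtain C d where C: "C \<ge> 0" "d > 0" "\<And>r u. r \<ge> 0 \<Longrightarrow> \<bar>edge_diff n b r u\<bar> \<le> C * exp (- (d * u\<^sup>2))"
    using edge_diff_dominated[OF b] by blast
  have b0: "b > 0" using b by simp
  define L where "L u = fbeta' b (Phi n u) * corr n u" for u
  have lim: "((\<lambda>r. edge_diff n b r u) \<longlongrightarrow> L u) at_top" for u
    unfolding L_def by (rule edge_diff_tendsto[OF b0])
  have [measurable]: "L \<in> borel_measurable borel"
    by (rule borel_measurable_LIMSEQ_metric[where f = "\<lambda>i. edge_diff n b (real i)"])
       (auto intro: filterlim_compose[OF lim filterlim_real_sequentially])
  have "((\<lambda>r. \<integral>u. edge_diff n b r u \<partial>lborel) \<longlongrightarrow> (\<integral>u. L u \<partial>lborel)) at_top"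
  proof (rule integral_dominated_convergence_at_top[where w = "\<lambda>u. C * exp (- (d * u\<^sup>2))"])
    show "integrable lborel (\<lambda>u. C * exp (- (d * u\<^sup>2)))" using integrable_gauss[OF C(2)] by auto
    show "\<forall>\<^sub>F r in at_top. AE u in lborel. norm (edge_diff n b r u) \<le> C * exp (- (d * u\<^sup>2))"
      using eventually_ge_at_top[of 0] by eventually_elim (use C(3) in auto)
  qed (auto simp: lim)
  moreover have "(\<integral>u. L u \<partial>lborel) = 0"
  proof -
    \<comment> \<open>The derivative of the entropy at \<open>Phi\<close> is odd in u and
      \<open>corr\<close> is even.\<close>
    have "L (- u) = - L u" for u by (simp add: L_def Phi_minus fbeta'_sym corr_even)
    then have "(\<integral>u. L u \<partial>lborel) = - (\<integral>u. L u \<partial>lborel)"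
      using lborel_integral_real_affine[of "-1" L 0] by simp
    then show ?thesis by simp
  qed
  ultimately show ?thesis by simp
qed

text \<open>For fixed r the factor 1 + |u| dominates the Jacobian up to a constant; it costs half of
  the Gaussian rate.\<close>

lemma fbeta_Phi_moment_le:
  assumes "b > 1/2"
  obtains K d where "K \<ge> 0" "d > 0" "\<And>u. (1 + \<bar>u\<bar>) * fbeta b (Phi n u) \<le> K * exp (- (d * u\<^sup>2))"
proof -
  obtain C d where C: "C \<ge> 0" "d > 0" "\<And>u. fbeta b (Phi n u) \<le> C * exp (- (d * u\<^sup>2))"
    using fbeta_Phi_le[OF assms] by blast
  have "subgauss (\<lambda>e u. 1 + \<bar>u\<bar>)" by (intro subgauss_intros)
  then obtain D where D: "D \<ge> 0" "\<And>e u. 0 \<le> (e::real) \<Longrightarrow> e \<le> 2 \<Longrightarrow> \<bar>1 + \<bar>u\<bar>\<bar> \<le> D * exp (d / 2 * u\<^sup>2)"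
    using subgaussD[of _ "d / 2"] C(2) by (metis half_gt_zero)
  have "(1 + \<bar>u\<bar>) * fbeta b (Phi n u) \<le> D * C * exp (- (d / 2 * u\<^sup>2))" for u
  proof -
    have "(1 + \<bar>u\<bar>) * fbeta b (Phi n u) \<le> (D * exp (d / 2 * u\<^sup>2)) * (C * exp (- (d * u\<^sup>2)))"
      using D(2)[of 0 u] D(1) C(3)[of u] assms
      by (intro mult_mono fbeta_nonneg less_imp_le[OF Phi_pos] less_imp_le[OF Phi_less_1]) auto
    also have "\<dots> = D * C * (exp (d / 2 * u\<^sup>2) * exp (- (d * u\<^sup>2)))" by (simp only: mult_ac)
    also have "exp (d / 2 * u\<^sup>2) * exp (- (d * u\<^sup>2)) = exp (- (d / 2 * u\<^sup>2))"
      unfolding exp_add[symmetric] by simp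
    finally show ?thesis .
  qed
  then show ?thesis using that[of "D * C" "d / 2"] C D by simp
qed

text \<open>The series is the integral over v of a step function. Working with nonnegative
  integrals, summability comes out of the integrability of \<open>edge_diff\<close> and of the
  weighted profile.\<close>

lemma
  assumes b: "b > 1/2" and r: "r \<ge> 0"
  shows summable_fbeta_lam: "summable (\<lambda>a. fbeta b (lam n (n + a) r))"
    and suminf_fbeta_lam: "(\<Sum>a. fbeta b (lam n (n + a) r)) =
      (\<integral>u. edge_diff n b r u \<partial>lborel) + (\<integral>u. max 0 (r + u / 2) * fbeta b (Phi n u) \<partial>lborel)"
proof -
  have b0: "b > 0" using b by simp
  define g where "g u = fbeta b (Phi n u)" for u
  define B where "B u = max 0 (r + u / 2)" for u
  define f where "f a = fbeta b (lam n (n + a) r)" for a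
  have g0: "g u \<ge> 0" for u unfolding g_def by (intro fbeta_nonneg b0 less_imp_le Phi_pos Phi_less_1)
  have f0: "f a \<ge> 0" for a unfolding f_def by (intro fbeta_nonneg b0 lam_nonneg lam_le_1 r)
  have B0: "B u \<ge> 0" for u by (simp add: B_def)
  have [measurable]: "g \<in> borel_measurable borel" "B \<in> borel_measurable borel" "(\<lambda>u. f (cell r u)) \<in> borel_measurable borel"
    unfolding g_def B_def by measurable
  obtain K d where K: "K \<ge> 0" "d > 0" "\<And>u. (1 + \<bar>u\<bar>) * g u \<le> K * exp (- (d * u\<^sup>2))"
    using fbeta_Phi_moment_le[OF b, of n] unfolding g_def by blast
  have Bg: "integrable lborel (\<lambda>u. B u * g u)"
  proof (rule integrable_gauss_bound[OF K(2)])
    fix u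
    have "B u \<le> r + \<bar>u\<bar> / 2" using r by (simp add: B_def abs_if)
    also have "\<dots> \<le> (r + 1) * (1 + \<bar>u\<bar>)"
      using r mult_nonneg_nonneg[OF r abs_ge_zero[of u]] unfolding distrib_right distrib_left by linarith
    finally have "B u * g u \<le> (r + 1) * (1 + \<bar>u\<bar>) * g u" using g0 by (rule mult_right_mono)
    also have "\<dots> \<le> (r + 1) * (K * exp (- (d * u\<^sup>2)))"
      unfolding mult.assoc using K(3)[of u] r by (intro mult_left_mono) auto
    finally show "\<bar>B u * g u\<bar> \<le> (r + 1) * K * exp (- (d * u\<^sup>2))"
      using B0[of u] g0[of u] by (simp add: mult.assoc)
  qed measurable
  have Jd: "integrable lborel (edge_diff n b r)"
  proof -
    obtain C d where C: "C \<ge> 0" "d > 0" "\<And>r u. r \<ge> 0 \<Longrightarrow> \<bar>edge_diff n b r u\<bar> \<le> C * exp (- (d * u\<^sup>2))"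
      using edge_diff_dominated[OF b] by blast
    show ?thesis by (rule integrable_gauss_bound[OF C(2) _ C(3)[OF r]]) measurable
  qed
  define F where "F v = ennreal (g (2 * (sqrt v - r)))" for v
  have Fm[measurable]: "F \<in> borel_measurable borel" unfolding F_def by measurable
  have [measurable]: "(\<lambda>v. F (2 * real (nat \<lfloor>v\<rfloor>) + 1 - v)) \<in> borel_measurable borel" by measurable
  have nnB: "(\<integral>\<^sup>+u. ennreal (B u * g u) \<partial>lborel) = (\<integral>\<^sup>+v. indicator {0<..} v * F v \<partial>lborel)"
  proof -
    have "(\<integral>\<^sup>+u. ennreal (B u * g u) \<partial>lborel) = (\<integral>\<^sup>+u. ennreal (B u) * F ((r + u / 2)\<^sup>2) \<partial>lborel)"
    proof (rule nn_integral_cong)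
      fix u
      show "ennreal (B u * g u) = ennreal (B u) * F ((r + u / 2)\<^sup>2)"
        by (cases "r + u / 2 > 0") (auto simp: B_def F_def ennreal_mult' max_def)
    qed
    then show ?thesis unfolding B_def by (simp only: nn_integral_edge_substitution[OF Fm])
  qed
  \<comment> \<open>In the variable v, passing to the mirror point is the reflection within each
    cell, so the integral equals the one in \<open>nnB\<close>.\<close>
  have nnM: "(\<integral>\<^sup>+u. ennreal (B u * g (mirror r u)) \<partial>lborel) = (\<integral>\<^sup>+v. indicator {0<..} v * F v \<partial>lborel)"
  proof -
    have "(\<integral>\<^sup>+u. ennreal (B u * g (mirror r u)) \<partial>lborel)
       = (\<integral>\<^sup>+u. ennreal (B u) * (\<lambda>v. F (2 * real (nat \<lfloor>v\<rfloor>) + 1 - v)) ((r + u / 2)\<^sup>2) \<partial>lborel)"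
      by (rule nn_integral_cong) (simp add: F_def mirror_def cell_def ennreal_mult' B0)
    also have "\<dots> = (\<integral>\<^sup>+v. indicator {0<..} v * F (2 * real (nat \<lfloor>v\<rfloor>) + 1 - v) \<partial>lborel)"
      unfolding B_def by (rule nn_integral_edge_substitution) measurable
    also have "\<dots> = (\<integral>\<^sup>+v. indicator {0<..} v * F v \<partial>lborel)"
      by (rule nn_integral_cell_reflect) measurable
    finally show ?thesis .
  qed
  have nnF: "(\<integral>\<^sup>+u. ennreal (B u * f (cell r u)) \<partial>lborel) = (\<Sum>a. ennreal (f a))"
  proof -
    have "(\<integral>\<^sup>+u. ennreal (B u * f (cell r u)) \<partial>lborel)
       = (\<integral>\<^sup>+u. ennreal (B u) * (\<lambda>v. ennreal (f (nat \<lfloor>v\<rfloor>))) ((r + u / 2)\<^sup>2) \<partial>lborel)"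
      by (rule nn_integral_cong) (simp add: cell_def ennreal_mult' B0)
    also have "\<dots> = (\<integral>\<^sup>+v. indicator {0<..} (v::real) * ennreal (f (nat \<lfloor>v\<rfloor>)) \<partial>lborel)"
      unfolding B_def by (rule nn_integral_edge_substitution) measurable
    also have "\<dots> = (\<Sum>a. ennreal (f a))" by (rule nn_integral_step)
    finally show ?thesis .
  qed
  have fin: "(\<integral>\<^sup>+u. ennreal (B u * g u) \<partial>lborel) = ennreal (\<integral>u. B u * g u \<partial>lborel)"
    by (rule nn_integral_eq_integral[OF Bg]) (simp add: B0 g0)
  have Mg: "integrable lborel (\<lambda>u. B u * g (mirror r u))"
  proof (rule integrableI_nonneg)
    have "(\<integral>\<^sup>+u. ennreal (B u * g (mirror r u)) \<partial>lborel) = ennreal (\<integral>u. B u * g u \<partial>lborel)"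
      unfolding nnM nnB[symmetric] by (rule fin)
    then show "(\<integral>\<^sup>+u. ennreal (B u * g (mirror r u)) \<partial>lborel) < \<infinity>" by simp
  qed (simp_all add: B0 g0)
  have Meq: "(\<integral>u. B u * g (mirror r u) \<partial>lborel) = (\<integral>u. B u * g u \<partial>lborel)"
  proof -
    have "ennreal (\<integral>u. B u * g (mirror r u) \<partial>lborel) = ennreal (\<integral>u. B u * g u \<partial>lborel)"
      using nn_integral_eq_integral[OF Mg] nnM nnB fin by (simp add: B0 g0)
    then show ?thesis
      by (subst (asm) ennreal_inj) (auto intro!: Bochner_Integration.integral_nonneg mult_nonneg_nonneg B0 g0)
  qed
  have decomp: "B u * f (cell r u) = edge_diff n b r u + (B u * g u + B u * g (mirror r u)) / 2" for u
    by (simp add: edge_diff_def B_def f_def g_def field_simps)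
  have If: "integrable lborel (\<lambda>u. B u * f (cell r u))"
    unfolding decomp by (intro Bochner_Integration.integrable_add integrable_divide Jd Bg Mg)
  have val: "(\<integral>u. B u * f (cell r u) \<partial>lborel) = (\<integral>u. edge_diff n b r u \<partial>lborel) + (\<integral>u. B u * g u \<partial>lborel)"
    unfolding decomp using Jd Bg Mg Meq by simp
  have sumf: "(\<Sum>a. ennreal (f a)) = ennreal (\<integral>u. B u * f (cell r u) \<partial>lborel)"
    unfolding nnF[symmetric] by (rule nn_integral_eq_integral[OF If]) (simp add: B0 f0)
  have I0: "0 \<le> (\<integral>u. B u * f (cell r u) \<partial>lborel)"
    by (intro Bochner_Integration.integral_nonneg mult_nonneg_nonneg B0 f0)
  have "f sums (\<integral>u. B u * f (cell r u) \<partial>lborel)"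
  proof -
    have "(\<lambda>a. ennreal (f a)) sums ennreal (\<integral>u. B u * f (cell r u) \<partial>lborel)"
      unfolding sumf[symmetric] by (rule summable_sums) simp
    then show ?thesis using f0 I0 by (simp add: sums_ennreal)
  qed
  then show "summable (\<lambda>a. fbeta b (lam n (n + a) r))" "(\<Sum>a. fbeta b (lam n (n + a) r)) =
      (\<integral>u. edge_diff n b r u \<partial>lborel) + (\<integral>u. max 0 (r + u / 2) * fbeta b (Phi n u) \<partial>lborel)"
    using val by (auto simp: sums_iff f_def[abs_def] B_def g_def)
qed

text \<open>For a fixed index the ray in \<open>lam_eq_wt\<close> grows to the whole line as r
  increases.\<close>

lemma lam_tendsto_1: "((\<lambda>r. lam n k r) \<longlongrightarrow> 1) at_top"
proof -
  have *: "((\<lambda>r. lam n (n + a) r) \<longlongrightarrow> 1) at_top" for n a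
  proof -
    let ?Z = "\<integral>u. wt n (1 / kap a) u \<partial>lborel"
    have "((\<lambda>r. \<integral>u. indicator {2 * (kap a - r)<..} u * wt n (1 / kap a) u \<partial>lborel) \<longlongrightarrow> ?Z) at_top"
    proof (rule integral_dominated_convergence_at_top[where w = "wt n (1 / kap a)"])
      show "AE u in lborel. ((\<lambda>r. indicator {2 * (kap a - r)<..} u * wt n (1 / kap a) u) \<longlongrightarrow> wt n (1 / kap a) u) at_top"
      proof (intro AE_I2)
        fix u
        have "\<forall>\<^sub>F r in at_top. wt n (1 / kap a) u = indicator {2 * (kap a - r)<..} u * wt n (1 / kap a) u"
          using eventually_gt_at_top[of "kap a - u / 2"] by eventually_elim (auto simp: indicator_def)
        then show "((\<lambda>r. indicator {2 * (kap a - r)<..} u * wt n (1 / kap a) u) \<longlongrightarrow> wt n (1 / kap a) u) at_top"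
          by (rule Lim_transform_eventually[OF tendsto_const])
      qed
      show "\<forall>\<^sub>F r in at_top. AE u in lborel. norm (indicator {2 * (kap a - r)<..} u * wt n (1 / kap a) u) \<le> wt n (1 / kap a) u"
        by (intro always_eventually allI AE_I2) (auto simp: indicator_def wt_nonneg)
    qed (use integrable_wt in auto)
    then have "((\<lambda>r. (\<integral>u. indicator {2 * (kap a - r)<..} u * wt n (1 / kap a) u \<partial>lborel) / ?Z) \<longlongrightarrow> ?Z / ?Z) at_top"
      using integral_wt_pos[of n a] by (intro tendsto_divide tendsto_const) auto
    then have "((\<lambda>r. (\<integral>u. indicator {2 * (kap a - r)<..} u * wt n (1 / kap a) u \<partial>lborel) / ?Z) \<longlongrightarrow> 1) at_top"
      using integral_wt_pos[of n a] by simp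
    then show ?thesis
    proof (rule Lim_transform_eventually)
      show "\<forall>\<^sub>F r in at_top. (\<integral>u. indicator {2 * (kap a - r)<..} u * wt n (1 / kap a) u \<partial>lborel) / ?Z = lam n (n + a) r"
        using eventually_ge_at_top[of 0] by eventually_elim (simp add: lam_eq_wt)
    qed
  qed
  show ?thesis
  proof (cases "n \<le> k")
    case True
    then show ?thesis using *[of n "k - n"] by simp
  next
    case False
    then show ?thesis using *[of k "n - k"] by (simp add: lam_swap[of n k])
  qed
qed

text \<open>Since max 0 (r + u / 2) = r + max (u / 2) (- r), the difference converges to the
  integral of u / 2 against an even function, which is 0.\<close>

lemma integral_edge_weight_tendsto:
  assumes b: "b > 1/2"
  shows "((\<lambda>r. (\<integral>u. max 0 (r + u / 2) * fbeta b (Phi n u) \<partial>lborel) - r * (\<integral>u. fbeta b (Phi n u) \<partial>lborel)) \<longlongrightarrow> 0) at_top"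
proof -
  have b0: "b > 0" using b by simp
  define g where "g u = fbeta b (Phi n u)" for u
  have g0: "g u \<ge> 0" for u unfolding g_def by (intro fbeta_nonneg b0 less_imp_le Phi_pos Phi_less_1)
  have geven: "g (- u) = g u" for u by (simp add: g_def Phi_minus fbeta_sym)
  have [measurable]: "g \<in> borel_measurable borel" unfolding g_def by measurable
  obtain K d where K: "K \<ge> 0" "d > 0" "\<And>u. (1 + \<bar>u\<bar>) * g u \<le> K * exp (- (d * u\<^sup>2))"
    using fbeta_Phi_moment_le[OF b, of n] unfolding g_def by blast
  have dom: "\<bar>x * g u\<bar> \<le> K * exp (- (d * u\<^sup>2))" if "\<bar>x\<bar> \<le> 1 + \<bar>u\<bar>" for x u
  proof -
    have "\<bar>x * g u\<bar> = \<bar>x\<bar> * g u" using g0[of u] by (simp add: abs_mult)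
    also have "\<dots> \<le> (1 + \<bar>u\<bar>) * g u" using that g0 by (rule mult_right_mono)
    finally show ?thesis using K(3)[of u] by linarith
  qed
  have mb: "\<bar>max (u / 2) (- r)\<bar> \<le> 1 + \<bar>u\<bar>" if "r \<ge> 0" for r u :: real
    using that by (auto simp: max_def abs_if)
  have gi: "integrable lborel g"
    by (rule integrable_gauss_bound[OF K(2)]) (use dom[of 1] in auto)
  have lim: "((\<lambda>r. \<integral>u. max (u / 2) (- r) * g u \<partial>lborel) \<longlongrightarrow> (\<integral>u. u / 2 * g u \<partial>lborel)) at_top"
  proof (rule integral_dominated_convergence_at_top[where w = "\<lambda>u. K * exp (- (d * u\<^sup>2))"])
    show "integrable lborel (\<lambda>u. K * exp (- (d * u\<^sup>2)))" using integrable_gauss[OF K(2)] by auto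
    show "AE u in lborel. ((\<lambda>r. max (u / 2) (- r) * g u) \<longlongrightarrow> u / 2 * g u) at_top"
    proof (intro AE_I2)
      fix u
      have "\<forall>\<^sub>F r in at_top. u / 2 * g u = max (u / 2) (- r) * g u"
        using eventually_ge_at_top[of "- u / 2"] by eventually_elim (auto simp: max_def)
      then show "((\<lambda>r. max (u / 2) (- r) * g u) \<longlongrightarrow> u / 2 * g u) at_top"
        by (rule Lim_transform_eventually[OF tendsto_const])
    qed
    show "\<forall>\<^sub>F r in at_top. AE u in lborel. norm (max (u / 2) (- r) * g u) \<le> K * exp (- (d * u\<^sup>2))"
      using eventually_ge_at_top[of 0] by eventually_elim (unfold real_norm_def, intro AE_I2 dom mb)
  qed measurable
  have "(\<integral>u. u / 2 * g u \<partial>lborel) = - (\<integral>u. u / 2 * g u \<partial>lborel)"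
    using lborel_integral_real_affine[of "-1" "\<lambda>u. u / 2 * g u" 0] by (simp add: geven)
  then have zero: "(\<integral>u. u / 2 * g u \<partial>lborel) = 0" by simp
  have "\<forall>\<^sub>F r in at_top. (\<integral>u. max (u / 2) (- r) * g u \<partial>lborel) =
      (\<integral>u. max 0 (r + u / 2) * g u \<partial>lborel) - r * (\<integral>u. g u \<partial>lborel)"
    using eventually_ge_at_top[of 0]
  proof eventually_elim
    case (elim r)
    have mi: "integrable lborel (\<lambda>u. max (u / 2) (- r) * g u)"
      by (rule integrable_gauss_bound[OF K(2) _ dom[OF mb[OF elim]]]) measurable
    have "(\<integral>u. max 0 (r + u / 2) * g u \<partial>lborel) = (\<integral>u. max (u / 2) (- r) * g u + r * g u \<partial>lborel)"
      by (intro Bochner_Integration.integral_cong) (auto simp: max_def algebra_simps)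
    then show ?case using mi gi by simp
  qed
  from Lim_transform_eventually[OF lim this] show ?thesis unfolding zero unfolding g_def .
qed

theorem theorem2p6:
  fixes \<alpha> :: nat and \<beta> :: real
  assumes "\<beta> > 1/2"
  shows "((\<lambda>r. Sab \<alpha> \<beta> r - r * integral\<^sup>L lborel (\<lambda>x. fbeta \<beta> (Phi \<alpha> x)))
           \<longlongrightarrow> 0) at_top"
proof -
  have b0: "\<beta> > 0" using assms by simp
  \<comment> \<open>These are the finitely many indices below \<alpha>, outside the parametrisation
    k = \<alpha> + a; their eigenvalues tend to 1, where \<open>fbeta\<close> vanishes.\<close>
  have low: "((\<lambda>r. fbeta \<beta> (lam \<alpha> k r)) \<longlongrightarrow> 0) at_top" for k
  proof -
    have "((\<lambda>r. fbeta \<beta> (lam \<alpha> k r)) \<longlongrightarrow> fbeta \<beta> 1) at_top"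
    proof (rule continuous_on_tendsto_compose[OF continuous_on_fbeta[OF b0] lam_tendsto_1])
      show "\<forall>\<^sub>F r in at_top. lam \<alpha> k r \<in> {0..1}"
        using eventually_ge_at_top[of 0] by eventually_elim (simp add: lam_nonneg lam_le_1)
    qed simp
    then show ?thesis by (simp add: fbeta_1)
  qed
  have "((\<lambda>r. (\<Sum>k<\<alpha>. fbeta \<beta> (lam \<alpha> k r)) + (\<integral>u. edge_diff \<alpha> \<beta> r u \<partial>lborel)
      + ((\<integral>u. max 0 (r + u / 2) * fbeta \<beta> (Phi \<alpha> u) \<partial>lborel) - r * (\<integral>u. fbeta \<beta> (Phi \<alpha> u) \<partial>lborel)))
     \<longlongrightarrow> (\<Sum>k<\<alpha>. 0) + 0 + 0) at_top"
    by (intro tendsto_add tendsto_sum low integral_edge_diff_tendsto integral_edge_weight_tendsto assms)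
  then have lim: "((\<lambda>r. (\<Sum>k<\<alpha>. fbeta \<beta> (lam \<alpha> k r)) + (\<integral>u. edge_diff \<alpha> \<beta> r u \<partial>lborel)
      + ((\<integral>u. max 0 (r + u / 2) * fbeta \<beta> (Phi \<alpha> u) \<partial>lborel) - r * (\<integral>u. fbeta \<beta> (Phi \<alpha> u) \<partial>lborel)))
     \<longlongrightarrow> 0) at_top" by simp
  show ?thesis
  proof (rule Lim_transform_eventually[OF lim])
    show "\<forall>\<^sub>F r in at_top. (\<Sum>k<\<alpha>. fbeta \<beta> (lam \<alpha> k r)) + (\<integral>u. edge_diff \<alpha> \<beta> r u \<partial>lborel)
      + ((\<integral>u. max 0 (r + u / 2) * fbeta \<beta> (Phi \<alpha> u) \<partial>lborel) - r * (\<integral>u. fbeta \<beta> (Phi \<alpha> u) \<partial>lborel))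
      = Sab \<alpha> \<beta> r - r * integral\<^sup>L lborel (\<lambda>x. fbeta \<beta> (Phi \<alpha> x))"
      using eventually_ge_at_top[of 0]
    proof eventually_elim
      case (elim r)
      have s: "summable (\<lambda>k. fbeta \<beta> (lam \<alpha> k r))"
        using summable_fbeta_lam[OF assms elim, of \<alpha>]
          summable_iff_shift[of "\<lambda>k. fbeta \<beta> (lam \<alpha> k r)" \<alpha>] by (simp add: add.commute)
      have "Sab \<alpha> \<beta> r = (\<Sum>k. fbeta \<beta> (lam \<alpha> k r))"
        using s by (rule Sab_eq_suminf) (intro fbeta_nonneg b0 lam_nonneg lam_le_1 elim)
      also have "\<dots> = (\<Sum>a. fbeta \<beta> (lam \<alpha> (a + \<alpha>) r)) + (\<Sum>k<\<alpha>. fbeta \<beta> (lam \<alpha> k r))"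
        by (rule suminf_split_initial_segment[OF s])
      finally show ?case
        using suminf_fbeta_lam[OF assms elim, of \<alpha>] by (simp add: add.commute)
    qed
  qed
qed

end
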